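(* Let $\mathsf{D}=(D_n)_{n\ge1}$ be a minimal regular elliptic divisibility sequence associated to the elliptic curve $E/\mathbb{Q}$ and point $P\in E(\mathbb{Q})$. \begin{itemize} \item[(a)] Let $n\ge1$ and let $p$ be a prime. If $n\in\mathcal{S}(\mathsf{D})$ and either $p\mid D_n$ or $E$ has additive reduction at $p$, then $(n\to np)\in\operatorname{Arr}(\mathsf{D})$. \item[(b)] Let $n\ge1$, $d\ge1$. If $n\in\mathcal{S}(\mathsf{D})$ and $d\in\mathcal{A}_{\mathrm{gen}}(\mathsf{D})$, then $nd\in\mathcal{S}(\mathsf{D})$ and $\gcd(d,n)\in\{1,d\}$. Furthermore, if $n\in\mathcal{S}(\mathsf{D})$, $d\in\mathcal{A}_{\mathrm{gen}}(\mathsf{D})$ and $\gcd(d,n)=1$, then $(n\to nd)\in\operatorname{Arr}(\mathsf{D})$. \item[(c)] Let $n\ge1$ and let $p$ be a prime with $n\in\mathcal{S}(\mathsf{D})$, $p\nmid D_n$ and $(n\to np)\in\operatorname{Arr}(\mathsf{D})$. (1) If $E$ has good reduction at $p$ and $\#E(\mathbb{F}_p)\ne 2p$, then $p\in\mathcal{A}(\mathsf{D})$ (and if $p\ge7$ one always has $\#E(\mathbb{F}_p)\ne2p$). (2) If $E$ has bad reduction at $p$, then $E$ has additive reduction at $p$. \item[(d)] Let $n\ge1$ and $d\ge1$ with $d$ composite. Let $t$ be the number of primes $p\mid d$ such that $r_p$ is composite, and let $p_0$ be the smallest prime divisor of $nd$. Suppose $(n\to nd)\in\operatorname{Arr}(\mathsf{D})$.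 Then one of the following holds: (i) $t=0$ and $d\in\mathcal{A}_{\mathrm{gen}}(\mathsf{D})$; (ii) $t\ge1$ and $$\prod_{p\mid d}\Bigl(1+\frac{1}{\sqrt p}\Bigr)^2\ \ge\ \prod_{p\mid d}\frac{\#E_{\mathrm{ns}}(\mathbb{F}_p)}{p}\ \ge\ p_0^{\,t},$$ where the products run over the distinct primes dividing $d$. \end{itemize}
   Context: Let $E/\mathbb{Q}$ be an elliptic curve given by a Weierstrass equation with integer coefficients and let $P\in E(\mathbb{Q})$ be a point of infinite order. The elliptic divisibility sequence (EDS) $\mathsf{D}=(D_n)_{n\ge1}$ associated to $(E,P)$ is the sequence of positive integers obtained by writing $x([n]P)=A_n/D_n^2$ in lowest terms. It is minimal if the Weierstrass equation is a global minimal Weierstrass equation; $\operatorname{Disc}(E)$ denotes the minimal discriminant. For a prime $p$, $E_{\mathrm{ns}}(\mathbb{F}_p)$ denotes the group of nonsingular points of the reduction of $E$ modulo $p$ (equal to $E(\mathbb{F}_p)$ when $E$ has good reduction at $p$), and "$P\in E_{\mathrm{ns}}(\mathbb{F}_p)$" means $P$ reduces to a nonsingular point mod $p$. For $n\ge1$ the rank of apparition is $r_n=\min\{r\ge1:n\mid D_r\}$. Regularity: $\mathsf{D}$ is $2$-irregular if all hold: (I1) $E$ has good reduction at $2$; (I2) $\#E(\mathbb{F}_2)=4$; (I3) $r_2=4$; (I4) $D_2$ is odd; (I5) $\operatorname{ord}_2(D_4)=1$; otherwise it is $2$-regular. $\mathsf{D}$ is regular if it is $2$-regular and $P\in E_{\mathrm{ns}}(\mathbb{F}_p)$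 for every prime $p\mid\operatorname{Disc}(E)$. $\mathcal{S}(\mathsf{D})=\{n\ge1:n\mid D_n\}$; $\operatorname{Arr}(\mathsf{D})$ is the set of $(n\to m)$ with $n,m\in\mathcal{S}(\mathsf{D})$, $n\mid m$, $n\ne m$, and no $k\in\mathcal{S}(\mathsf{D})$ with $n\mid k\mid m$ other than $k\in\{n,m\}$. A generalized aliquot cycle for $\mathsf{D}$ is a tuple $(p_1,\dots,p_\ell)$, $\ell\ge1$, of distinct primes with $r_{p_i}=p_{i+1}$ for $1\le i\le\ell$ ($p_{\ell+1}=p_1$); it is an aliquot cycle if moreover every $p_i$ is a prime of good reduction for $E$. $\mathcal{A}(\mathsf{D})$ (resp. $\mathcal{A}_{\mathrm{gen}}(\mathsf{D})$) is the set of products $p_1\cdots p_\ell$ over all aliquot cycles (resp. generalized aliquot cycles). *)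

theory Defs
  imports Complex_Main "HOL-Number_Theory.Number_Theory"
begin

section \<open>Weierstrass equations\<close>

text \<open>
  The equation \<open>y\<^sup>2 + a1 x y + a3 y = x\<^sup>3 + a2 x\<^sup>2 + a4 x + a6\<close>.
\<close>

datatype 'a weierstrass =
  Weierstrass (wa1: 'a) (wa2: 'a) (wa3: 'a) (wa4: 'a) (wa6: 'a)

definition weierstrass_poly :: "'a::comm_ring_1 weierstrass \<Rightarrow> 'a \<Rightarrow> 'a \<Rightarrow> 'a" where
  "weierstrass_poly W x y =
     y^2 + wa1 W * x * y + wa3 W * y - (x^3 + wa2 W * x^2 + wa4 W * x + wa6 W)"

definition weierstrass_poly_dx :: "'a::comm_ring_1 weierstrass \<Rightarrow> 'a \<Rightarrow> 'a \<Rightarrow> 'a" where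
  "weierstrass_poly_dx W x y = wa1 W * y - (3 * x^2 + 2 * wa2 W * x + wa4 W)"

definition weierstrass_poly_dy :: "'a::comm_ring_1 weierstrass \<Rightarrow> 'a \<Rightarrow> 'a \<Rightarrow> 'a" where
  "weierstrass_poly_dy W x y = 2 * y + wa1 W * x + wa3 W"

definition discriminant :: "'a::comm_ring_1 weierstrass \<Rightarrow> 'a" where
  "discriminant W =
     (let b2 = wa1 W ^ 2 + 4 * wa2 W;
          b4 = 2 * wa4 W + wa1 W * wa3 W;
          b6 = wa3 W ^ 2 + 4 * wa6 W;
          b8 = wa1 W ^ 2 * wa6 W + 4 * wa2 W * wa6 W - wa1 W * wa3 W * wa4 W
               + wa2 W * wa3 W ^ 2 - wa4 W ^ 2
      in - (b2^2 * b8) - 8 * b4^3 - 27 * b6^2 + 9 * b2 * b4 * b6)"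

abbreviation over_rat :: "int weierstrass \<Rightarrow> rat weierstrass" where
  "over_rat \<equiv> map_weierstrass of_int"

definition elliptic_curve :: "int weierstrass \<Rightarrow> bool" where
  "elliptic_curve W \<longleftrightarrow> discriminant W \<noteq> 0"

text \<open>
  Isomorphism over the rationals: an admissible substitution
  \<open>x = u\<^sup>2 x' + r\<close>, \<open>y = u\<^sup>3 y' + u\<^sup>2 s x' + t\<close> carries one equation to \<open>u\<^sup>6\<close> times the other.
  The rational field is infinite, so agreement of values is agreement of polynomials.
\<close>

definition isomorphic_over_rat :: "int weierstrass \<Rightarrow> int weierstrass \<Rightarrow> bool" where
  "isomorphic_over_rat W V \<longleftrightarrow>
     (\<exists>u r s t :: rat. u \<noteq> 0 \<and>
        (\<forall>x y. weierstrass_poly (over_rat W) (u^2 * x + r) (u^3 * y + u^2 * s * x + t)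
             = u^6 * weierstrass_poly (over_rat V) x y))"

definition global_minimal :: "int weierstrass \<Rightarrow> bool" where
  "global_minimal W \<longleftrightarrow>
     (\<forall>V. isomorphic_over_rat W V \<longrightarrow>
        (\<forall>p::int. prime p \<longrightarrow>
           multiplicity p (discriminant W) \<le> multiplicity p (discriminant V)))"


section \<open>Points and the group law\<close>

datatype 'a point = Infinity | Affine 'a 'a

definition curve_points :: "'a::comm_ring_1 weierstrass \<Rightarrow> 'a point set" where
  "curve_points W = insert Infinity {Affine x y | x y. weierstrass_poly W x y = 0}"

text \<open>Chord and tangent addition; \<open>l\<close> is the slope of the line through the two points.\<close>

fun point_add :: "'a::field weierstrass \<Rightarrow> 'a point \<Rightarrow> 'a point \<Rightarrow> 'a point" where
  "point_add W Infinity Q = Q"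
| "point_add W P Infinity = P"
| "point_add W (Affine x1 y1) (Affine x2 y2) =
     (if x1 = x2 \<and> y1 + y2 + wa1 W * x2 + wa3 W = 0 then Infinity
      else let l = (if x1 = x2
                    then (3 * x1^2 + 2 * wa2 W * x1 + wa4 W - wa1 W * y1)
                         / (2 * y1 + wa1 W * x1 + wa3 W)
                    else (y2 - y1) / (x2 - x1));
               x3 = l^2 + wa1 W * l - wa2 W - x1 - x2;
               y3 = - (l + wa1 W) * x3 - (y1 - l * x1) - wa3 W
           in Affine x3 y3)"

fun point_mult :: "'a::field weierstrass \<Rightarrow> nat \<Rightarrow> 'a point \<Rightarrow> 'a point" where
  "point_mult W 0 P = Infinity"
| "point_mult W (Suc n) P = point_add W P (point_mult W n P)"

definition infinite_order :: "'a::field weierstrass \<Rightarrow> 'a point \<Rightarrow> bool" where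
  "infinite_order W P \<longleftrightarrow> (\<forall>n\<ge>1. point_mult W n P \<noteq> Infinity)"


section \<open>Reduction modulo a prime\<close>

text \<open>
  The field with \<open>p\<close> elements is represented by the residues \<open>{0..<p}\<close>. Reduction of a curve
  always refers to the given equation, so the notions below have their usual meaning for the
  curve itself when the equation is a global minimal one.
\<close>

definition points_mod :: "int weierstrass \<Rightarrow> nat \<Rightarrow> int point set" where
  "points_mod W p = insert Infinity
     {Affine x y | x y. x \<in> {0..<int p} \<and> y \<in> {0..<int p} \<and>
        [weierstrass_poly W x y = 0] (mod int p)}"

definition singular_mod :: "int weierstrass \<Rightarrow> nat \<Rightarrow> int \<Rightarrow> int \<Rightarrow> bool" where
  "singular_mod W p x y \<longleftrightarrow>
     [weierstrass_poly W x y = 0] (mod int p) \<and>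
     [weierstrass_poly_dx W x y = 0] (mod int p) \<and>
     [weierstrass_poly_dy W x y = 0] (mod int p)"

definition ns_points_mod :: "int weierstrass \<Rightarrow> nat \<Rightarrow> int point set" where
  "ns_points_mod W p = points_mod W p - {Affine x y | x y. singular_mod W p x y}"

definition rat_mod :: "nat \<Rightarrow> rat \<Rightarrow> int" where
  "rat_mod p r =
     (case quotient_of r of (a, b) \<Rightarrow> (a * modular_inverse (int p) b) mod int p)"

text \<open>
  For a point of an integral Weierstrass equation the prime \<open>p\<close> divides the denominator of the
  first coordinate iff it divides that of the second, and then the point reduces to infinity.
\<close>

fun reduce_point :: "nat \<Rightarrow> rat point \<Rightarrow> int point" where
  "reduce_point p Infinity = Infinity"
| "reduce_point p (Affine x y) =
     (if int p dvd snd (quotient_of x) then Infinity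
      else Affine (rat_mod p x) (rat_mod p y))"

definition good_reduction :: "int weierstrass \<Rightarrow> nat \<Rightarrow> bool" where
  "good_reduction W p \<longleftrightarrow> \<not> int p dvd discriminant W"

text \<open>
  Additive reduction means that the reduced curve has a cusp. The quadratic part of the
  equation at a point \<open>(x, y)\<close> is \<open>Y\<^sup>2 + a1 X Y - (3 x + a2) X\<^sup>2\<close>, and a singular point is a
  cusp iff this form is a square \<open>(Y - c X)\<^sup>2\<close>. Singular point and slope are unique, hence
  rational over the (perfect) prime field, so it suffices to look for them among residues.
\<close>

definition additive_reduction :: "int weierstrass \<Rightarrow> nat \<Rightarrow> bool" where
  "additive_reduction W p \<longleftrightarrow>
     (\<exists>x y c :: int. singular_mod W p x y \<and>
        [wa1 W = - 2 * c] (mod int p) \<and> [- (3 * x + wa2 W) = c^2] (mod int p))"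


section \<open>Elliptic divisibility sequences\<close>

text \<open>Only the values at positive indices are meaningful.\<close>

definition eds :: "int weierstrass \<Rightarrow> rat point \<Rightarrow> nat \<Rightarrow> nat" where
  "eds W P n = (THE d. d > 0 \<and>
     (\<exists>(a::int) y. coprime a (int d) \<and>
        point_mult (over_rat W) n P = Affine (of_int a / of_nat d ^ 2) y))"

lemma eds_eqI:
  assumes "d > 0" "coprime a (int d)" "point_mult (over_rat W) n P = Affine (of_int a / of_nat d ^ 2) y"
  shows "eds W P n = d"
  unfolding eds_def
proof (rule the_equality)
  show "0 < d \<and> (\<exists>a y. coprime a (int d) \<and> point_mult (over_rat W) n P = Affine (of_int a / of_nat d ^ 2) y)"
    using assms by blast
next
  fix e assume "0 < e \<and> (\<exists>a y. coprime a (int e) \<and> point_mult (over_rat W) n P = Affine (of_int a / of_nat e ^ 2) y)"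
  then obtain b where e: "e > 0" "coprime b (int e)" "(of_int a / of_nat d ^ 2 :: rat) = of_int b / of_nat e ^ 2"
    using assms(3) by auto
  then have "(of_int (a * int e ^ 2) :: rat) = of_int (b * int d ^ 2)"
    using assms(1) by (simp add: field_simps)
  then have eq: "a * int e ^ 2 = b * int d ^ 2" by (simp only: of_int_eq_iff)
  have "int e ^ 2 dvd int d ^ 2" 
    using e(2) eq by (metis coprime_commute coprime_dvd_mult_right_iff coprime_power_left_iff dvd_triv_right)
  moreover have "int d ^ 2 dvd int e ^ 2" 
    using assms(2) eq by (metis coprime_commute coprime_dvd_mult_right_iff coprime_power_left_iff dvd_triv_right)
  ultimately show "e = d" by (simp add: dvd_antisym)
qed

text \<open>The rank of apparition; 0 when \<open>n\<close> divides no term.\<close>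

definition rank_app :: "(nat \<Rightarrow> nat) \<Rightarrow> nat \<Rightarrow> nat" where
  "rank_app D n = (if \<exists>r\<ge>1. n dvd D r then LEAST r. r \<ge> 1 \<and> n dvd D r else 0)"

definition two_irregular :: "int weierstrass \<Rightarrow> rat point \<Rightarrow> bool" where
  "two_irregular W P \<longleftrightarrow>
     good_reduction W 2 \<and>
     card (points_mod W 2) = 4 \<and>
     rank_app (eds W P) 2 = 4 \<and>
     odd (eds W P 2) \<and>
     multiplicity 2 (eds W P 4) = 1"

definition regular :: "int weierstrass \<Rightarrow> rat point \<Rightarrow> bool" where
  "regular W P \<longleftrightarrow>
     \<not> two_irregular W P \<and>
     (\<forall>p::nat. prime p \<and> int p dvd discriminant W \<longrightarrow> reduce_point p P \<in> ns_points_mod W p)"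

definition index_divisors :: "(nat \<Rightarrow> nat) \<Rightarrow> nat set" where
  "index_divisors D = {n. n \<ge> 1 \<and> n dvd D n}"

definition arrows :: "(nat \<Rightarrow> nat) \<Rightarrow> (nat \<times> nat) set" where
  "arrows D = {(n, m). n \<in> index_divisors D \<and> m \<in> index_divisors D \<and> n dvd m \<and> n \<noteq> m \<and>
     (\<forall>k \<in> index_divisors D. n dvd k \<and> k dvd m \<longrightarrow> k = n \<or> k = m)}"

definition gen_aliquot_cycle :: "(nat \<Rightarrow> nat) \<Rightarrow> nat list \<Rightarrow> bool" where
  "gen_aliquot_cycle D ps \<longleftrightarrow>
     ps \<noteq> [] \<and> distinct ps \<and> (\<forall>p\<in>set ps. prime p) \<and>
     (\<forall>i<length ps. rank_app D (ps ! i) = ps ! (Suc i mod length ps))"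

definition aliquot_cycle :: "int weierstrass \<Rightarrow> rat point \<Rightarrow> nat list \<Rightarrow> bool" where
  "aliquot_cycle W P ps \<longleftrightarrow>
     gen_aliquot_cycle (eds W P) ps \<and> (\<forall>p\<in>set ps. good_reduction W p)"

definition gen_aliquot_products :: "(nat \<Rightarrow> nat) \<Rightarrow> nat set" where
  "gen_aliquot_products D = {prod_list ps | ps. gen_aliquot_cycle D ps}"

definition aliquot_products :: "int weierstrass \<Rightarrow> rat point \<Rightarrow> nat set" where
  "aliquot_products W P = {prod_list ps | ps. aliquot_cycle W P ps}"

definition composite :: "nat \<Rightarrow> bool" where
  "composite n \<longleftrightarrow> n > 1 \<and> \<not> prime n"

end

theory Submission
  imports Defs "HOL-Computational_Algebra.Computational_Algebra" "Berlekamp_Zassenhaus.Finite_Field"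
begin

text \<open>
  The points killed by reduction modulo \<open>p\<close> are filtered by the \<open>p\<close>-adic valuation of
  \<open>z = - x / y\<close>, and addition of points is addition of the \<open>z\<close> up to higher order. Hence
  \<open>p ^ k\<close> divides \<open>D m\<close> exactly when a rank divides \<open>m\<close>, and passing from \<open>m\<close> to
  \<open>p * m\<close> gains a factor \<open>p\<close>. Since \<open>P\<close> reduces to a nonsingular point, the rank \<open>r p\<close> divides
  the number \<open>N p\<close> of nonsingular points modulo \<open>p\<close>, which lies in the Hasse interval at good
  primes and is \<open>p\<close>, \<open>p - 1\<close> or \<open>p + 1\<close> at bad ones. The rest is combinatorics: \<open>n\<close>
  divides \<open>D n\<close> as soon as the ranks of its prime divisors divide \<open>n\<close>, regularity at 2 excluding
  the one exception \<open>r 2 = 4\<close>. In (d), if all ranks of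
  primes of \<open>d\<close> are prime, iterating \<open>r\<close> inside \<open>d\<close> runs into a cycle, which exhausts \<open>d\<close>;
  each composite rank forces an extra factor of at least \<open>p0\<close> in \<open>\<Prod> N p / p\<close>.
\<close>

section \<open>The group law on the nonsingular points of a cubic\<close>

text \<open>The group law is set up on the nonsingular points of an arbitrary cubic over a field
  because it serves three times: for the rational points, for reduction modulo \<open>p\<close>
  whether or not the curve stays smooth, and for the twist over the function field in the Hasse
  bound.

  The exception at 2 has the following source. Passing from \<open>m\<close> to \<open>p * m\<close>
  guarantees just one further factor \<open>p\<close>, and this process starts at the rank of
  \<open>p\<close>. If \<open>p^a\<close> divides \<open>r p\<close> with \<open>a \<ge> 2\<close>,
  an index carrying \<open>p^a\<close> may have a term divisible by \<open>p\<close> only once.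
  Since \<open>r p \<le> N p \<le> 2 * p + 1\<close>, the square of \<open>p\<close> divides
  \<open>r p\<close> only if \<open>p = 2\<close> and \<open>r 2 = 4\<close>, and irregularity
  describes the case in which the valuation of \<open>D 4\<close> is then too small.

  Square roots are avoided until the end: the upper Hasse bound is carried as the integer
  alternative \<open>N \<le> p + 1\<close> or \<open>(N - p - 1)^2 \<le> 4 * p\<close>.\<close>

definition nonsing :: "'a::field weierstrass \<Rightarrow> 'a point set" where
  "nonsing W = insert Infinity {Affine x y | x y. weierstrass_poly W x y = 0 \<and>
     (weierstrass_poly_dx W x y \<noteq> 0 \<or> weierstrass_poly_dy W x y \<noteq> 0)}"

fun point_neg :: "'a::field weierstrass \<Rightarrow> 'a point \<Rightarrow> 'a point" where
  "point_neg W Infinity = Infinity"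
| "point_neg W (Affine x y) = Affine x (- y - wa1 W * x - wa3 W)"

text \<open>
  The cubic restricted to the line \<open>y = l x + m\<close> has the roots \<open>x1, x2, x3\<close>; the three
  equations are Vieta's formulas.
\<close>

definition line_through ::
    "'a::comm_ring_1 weierstrass \<Rightarrow> 'a \<Rightarrow> 'a \<Rightarrow> 'a \<Rightarrow> 'a \<Rightarrow> 'a \<Rightarrow> bool" where
  "line_through W l m x1 x2 x3 \<longleftrightarrow>
     x1 + x2 + x3 = l^2 + wa1 W * l - wa2 W \<and>
     x1 * x2 + x1 * x3 + x2 * x3 = wa4 W - 2 * l * m - wa1 W * m - wa3 W * l \<and>
     x1 * x2 * x3 = m^2 + wa3 W * m - wa6 W"

context
  fixes W :: "'a::idom weierstrass"
begin

lemma point_neg_eq_iff: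
  fixes y1 y2 x :: 'a
  shows "y1 + y2 + wa1 W * x + wa3 W = 0 \<longleftrightarrow> y2 = - y1 - wa1 W * x - wa3 W"
  by (rule iffI; Groebner_Basis.algebra)

lemma same_abscissa:
  assumes "weierstrass_poly W x y1 = 0" "weierstrass_poly W x y2 = 0"
  shows "(y1 - y2) * (y1 + y2 + wa1 W * x + wa3 W) = 0"
  using assms unfolding weierstrass_poly_def by Groebner_Basis.algebra

text \<open>The expression is the divided difference, at two abscissas, of the cubic cut out on the
  line \<open>y = l * x + m\<close>. For a tangent it degenerates to the derivative; it is spelled
  with \<open>x\<close> twice so as to have the same shape as for a chord.\<close>

lemma tangent_divided_difference:
  assumes "weierstrass_poly_dy W x y * l = - weierstrass_poly_dx W x y" "y = l * x + m"
  shows "x^2 + x*x + x^2 + (wa2 W - l^2 - wa1 W * l) * (x + x)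
      + (wa4 W - 2 * l * m - wa1 W * m - wa3 W * l) = 0"
  using assms unfolding weierstrass_poly_dy_def weierstrass_poly_dx_def by Groebner_Basis.algebra

lemma chord_divided_difference:
  assumes "weierstrass_poly W x1 y1 = 0" "weierstrass_poly W x2 y2 = 0"
    "y1 = l * x1 + m" "y2 = l * x2 + m"
  shows "(x1 - x2) * (x1^2 + x1*x2 + x2^2 + (wa2 W - l^2 - wa1 W * l) * (x1 + x2)
      + (wa4 W - 2 * l * m - wa1 W * m - wa3 W * l)) = 0"
  using assms unfolding weierstrass_poly_def by Groebner_Basis.algebra

lemma line_throughI:
  assumes "weierstrass_poly W x1 (l * x1 + m) = 0" 
    "x1^2 + x1*x2 + x2^2 + (wa2 W - l^2 - wa1 W * l) * (x1 + x2)
      + (wa4 W - 2 * l * m - wa1 W * m - wa3 W * l) = 0"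
  shows "line_through W l m x1 x2 (l^2 + wa1 W * l - wa2 W - x1 - x2)"
proof -
  define x3 where "x3 = l^2 + wa1 W * l - wa2 W - x1 - x2"
  have a2: "wa2 W = l^2 + wa1 W * l - x1 - x2 - x3"
    by (simp add: x3_def)
  have a4: "wa4 W = 2 * l * m + wa1 W * m + wa3 W * l + x1 * x2 + x1 * x3 + x2 * x3"
    using assms(2) unfolding a2 by Groebner_Basis.algebra
  have "x1 * x2 * x3 = m^2 + wa3 W * m - wa6 W"
    using assms(1) unfolding weierstrass_poly_def a2 a4 by Groebner_Basis.algebra
  then show ?thesis unfolding line_through_def x3_def[symmetric]
    by (auto simp: a2 a4)
qed

text \<open>The second identity computes the derivative at \<open>x3\<close> of the cubic on the
  line, once from its roots and once from the partial derivatives. If the third point were singular,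
  it would have to coincide with one of the first two; this gives closure of the nonsingular points
  under addition.\<close>

lemma line_through_third:
  assumes "line_through W l m x1 x2 x3"
  shows "weierstrass_poly W x3 (l * x3 + m) = 0"
    "(x3 - x1) * (x3 - x2) = 
      - (weierstrass_poly_dx W x3 (l * x3 + m) + l * weierstrass_poly_dy W x3 (l * x3 + m))"
proof -
  have a: "wa2 W = l^2 + wa1 W * l - (x1 + x2 + x3)"
    "wa4 W = x1 * x2 + x1 * x3 + x2 * x3 + 2 * l * m + wa1 W * m + wa3 W * l"
    "wa6 W = m^2 + wa3 W * m - x1 * x2 * x3"
    using assms unfolding line_through_def by (auto simp: algebra_simps)
  show "weierstrass_poly W x3 (l * x3 + m) = 0"
    unfolding weierstrass_poly_def a by Groebner_Basis.algebra
  show "(x3 - x1) * (x3 - x2) = 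
      - (weierstrass_poly_dx W x3 (l * x3 + m) + l * weierstrass_poly_dy W x3 (l * x3 + m))"
    unfolding weierstrass_poly_dx_def weierstrass_poly_dy_def a by Groebner_Basis.algebra
qed

end

section \<open>Negation and addition on the nonsingular points\<close>

lemma Infinity_nonsing [simp]: "Infinity \<in> nonsing W"
  by (simp add: nonsing_def)

lemma Affine_nonsing_iff:
  "Affine x y \<in> nonsing W \<longleftrightarrow> weierstrass_poly W x y = 0 \<and>
     (weierstrass_poly_dx W x y \<noteq> 0 \<or> weierstrass_poly_dy W x y \<noteq> 0)"
  by (auto simp: nonsing_def)

lemma point_add_Infinity_right [simp]: "point_add W P Infinity = P"
  by (cases P) auto

lemma point_add_eq_Infinity_iff:
  "point_add W P Q = Infinity \<longleftrightarrow> Q = point_neg W P"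
proof (cases P; cases Q)
  fix x1 y1 x2 y2 assume [simp]: "P = Affine x1 y1" "Q = Affine x2 y2"
  show ?thesis using point_neg_eq_iff[of y1 y2 W x1] by (auto simp: Let_def)
qed auto

lemma point_neg_neg [simp]: "point_neg W (point_neg W P) = P"
  by (cases P) auto

lemma weierstrass_poly_neg:
  "weierstrass_poly W x (- y - wa1 W * x - wa3 W) = weierstrass_poly W x y"
  by (simp add: weierstrass_poly_def algebra_simps power2_eq_square)

lemma point_neg_nonsing [simp]: "point_neg W P \<in> nonsing W \<longleftrightarrow> P \<in> nonsing W"
proof -
  have *: "point_neg W P \<in> nonsing W" if "P \<in> nonsing W" for P
  proof (cases P)
    case (Affine x y)
    let ?y = "- y - wa1 W * x - wa3 W"
    have dy: "weierstrass_poly_dy W x ?y = - weierstrass_poly_dy W x y"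
      by (simp add: weierstrass_poly_dy_def algebra_simps)
    have dx: "weierstrass_poly_dx W x ?y = weierstrass_poly_dx W x y - wa1 W * weierstrass_poly_dy W x y"
      by (simp add: weierstrass_poly_dy_def weierstrass_poly_dx_def algebra_simps)
    show ?thesis using that Affine dx dy
      by (auto simp: Affine_nonsing_iff weierstrass_poly_neg)
  qed simp
  show ?thesis using *[of P] *[of "point_neg W P"] by auto
qed

lemma point_add_Affine:
  assumes "\<not> (x1 = x2 \<and> y1 + y2 + wa1 W * x2 + wa3 W = 0)"
    and "l = (if x1 = x2
       then (3 * x1^2 + 2 * wa2 W * x1 + wa4 W - wa1 W * y1) / (2 * y1 + wa1 W * x1 + wa3 W)
       else (y2 - y1) / (x2 - x1))"
    and "x3 = l^2 + wa1 W * l - wa2 W - x1 - x2"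
  shows "point_add W (Affine x1 y1) (Affine x2 y2)
    = Affine x3 (- (l + wa1 W) * x3 - (y1 - l * x1) - wa3 W)"
  unfolding point_add.simps if_not_P[OF assms(1)] assms(2)[symmetric] Let_def assms(3)[symmetric] ..

lemma point_add_chord:
  assumes "x1 \<noteq> x2" "l * (x2 - x1) = y2 - y1" "x3 = l^2 + wa1 W * l - wa2 W - x1 - x2"
  shows "point_add W (Affine x1 y1) (Affine x2 y2)
    = Affine x3 (- (l + wa1 W) * x3 - (y1 - l * x1) - wa3 W)"
proof (rule point_add_Affine)
  have "l = (y2 - y1) / (x2 - x1)" using assms(1,2) by (simp add: eq_divide_eq)
  then show "l = (if x1 = x2
       then (3 * x1^2 + 2 * wa2 W * x1 + wa4 W - wa1 W * y1) / (2 * y1 + wa1 W * x1 + wa3 W)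
       else (y2 - y1) / (x2 - x1))" using assms(1) by simp
qed (use assms in auto)

lemma point_add_commute:
  assumes "P \<in> curve_points W" "Q \<in> curve_points W"
  shows "point_add W P Q = point_add W Q P"
proof (cases P; cases Q)
  fix x1 y1 x2 y2 assume PQ: "P = Affine x1 y1" "Q = Affine x2 y2"
  have c: "weierstrass_poly W x1 y1 = 0" "weierstrass_poly W x2 y2 = 0"
    using assms PQ by (auto simp: curve_points_def)
  show ?thesis
  proof (cases "x1 = x2")
    case True
    have "(y1 - y2) * (y1 + y2 + wa1 W * x2 + wa3 W) = 0"
      using c True same_abscissa by blast
    then have "y1 + y2 + wa1 W * x2 + wa3 W = 0 \<or> y1 = y2" by auto
    then show ?thesis
    proof
      assume i: "y1 + y2 + wa1 W * x2 + wa3 W = 0"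
      then have "y2 + y1 + wa1 W * x1 + wa3 W = 0" using True by (simp only: add.commute[of y1 y2])
      then show ?thesis unfolding PQ using i True by simp
    qed (simp add: PQ True)
  next
    case False
    define l where "l = (y2 - y1) / (x2 - x1)"
    define x3 where "x3 = l^2 + wa1 W * l - wa2 W - x1 - x2"
    have l1: "l * (x2 - x1) = y2 - y1" using False by (simp add: l_def)
    have l2: "l * (x1 - x2) = y1 - y2" by (metis l1 minus_diff_eq mult_minus_right)
    have m: "y2 - l * x2 = y1 - l * x1" using l1 by (metis diff_eq_diff_eq right_diff_distrib diff_diff_eq2 add_diff_eq add.commute)
    have "x3 = l^2 + wa1 W * l - wa2 W - x2 - x1" by (simp add: x3_def)
    then show ?thesis unfolding PQ
      using point_add_chord[OF False l1 x3_def] point_add_chord[OF False[symmetric] l2] m by simp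
  qed
qed auto

text \<open>Treats chord and tangent together: later arguments use the line, its Vieta relations and
  the slope equation cleared of its denominator.\<close>

lemma point_add_line:
  assumes P: "weierstrass_poly W x1 y1 = 0" and Q: "weierstrass_poly W x2 y2 = 0"
    and S: "point_add W (Affine x1 y1) (Affine x2 y2) = Affine x3 y3"
  obtains l m where "y1 = l * x1 + m" "y2 = l * x2 + m" "y3 = - (l * x3 + m) - wa1 W * x3 - wa3 W"
    "line_through W l m x1 x2 x3"
    "x1 \<noteq> x2 \<and> l * (x2 - x1) = y2 - y1 \<or>
     x1 = x2 \<and> y1 = y2 \<and> weierstrass_poly_dy W x1 y1 \<noteq> 0 \<and>
     weierstrass_poly_dy W x1 y1 * l = - weierstrass_poly_dx W x1 y1"
proof -
  define l where "l = (if x1 = x2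
                    then (3 * x1^2 + 2 * wa2 W * x1 + wa4 W - wa1 W * y1)
                         / (2 * y1 + wa1 W * x1 + wa3 W)
                    else (y2 - y1) / (x2 - x1))"
  define m where "m = y1 - l * x1"
  have n: "\<not> (x1 = x2 \<and> y1 + y2 + wa1 W * x2 + wa3 W = 0)"
    using S by (auto split: if_splits)
  have x3: "x3 = l^2 + wa1 W * l - wa2 W - x1 - x2"
    and y3': "y3 = - (l + wa1 W) * x3 - (y1 - l * x1) - wa3 W"
    using S point_add_Affine[OF n l_def refl] by auto
  have y3: "y3 = - (l * x3 + m) - wa1 W * x3 - wa3 W"
    unfolding y3' m_def by (simp add: algebra_simps)
  have y1: "y1 = l * x1 + m" by (simp add: m_def)
  have alt: "x1 \<noteq> x2 \<and> l * (x2 - x1) = y2 - y1 \<or>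
     x1 = x2 \<and> y1 = y2 \<and> weierstrass_poly_dy W x1 y1 \<noteq> 0 \<and>
     weierstrass_poly_dy W x1 y1 * l = - weierstrass_poly_dx W x1 y1"
  proof (cases "x1 = x2")
    case True
    have "(y1 - y2) * (y1 + y2 + wa1 W * x2 + wa3 W) = 0"
      using P Q True same_abscissa by blast
    then have "y1 = y2" using n True by auto
    moreover have "2 * y1 + wa1 W * x1 + wa3 W \<noteq> 0" using n True \<open>y1 = y2\<close> by (metis mult_2)
    ultimately show ?thesis using True
      by (simp add: l_def weierstrass_poly_dy_def weierstrass_poly_dx_def)
  qed (simp add: l_def)
  have y2: "y2 = l * x2 + m" using alt y1 by (auto simp: algebra_simps)
  have dd: "x1^2 + x1*x2 + x2^2 + (wa2 W - l^2 - wa1 W * l) * (x1 + x2)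
      + (wa4 W - 2 * l * m - wa1 W * m - wa3 W * l) = 0"
  proof (cases "x1 = x2")
    case True
    then show ?thesis using alt tangent_divided_difference[of W x1 y1 l m] y1 by auto
  next
    case False
    then show ?thesis using chord_divided_difference[OF P Q y1 y2] by simp
  qed
  have "line_through W l m x1 x2 x3"
    using line_throughI[OF _ dd] P unfolding x3 y1 by simp
  then show ?thesis using that y1 y2 y3 alt by blast
qed

lemma point_add_nonsing:
  assumes "P \<in> nonsing W" "Q \<in> nonsing W"
  shows "point_add W P Q \<in> nonsing W"
proof (cases P; cases Q)
  fix x1 y1 x2 y2 assume PQ: "P = Affine x1 y1" "Q = Affine x2 y2"
  show ?thesis
  proof (cases "point_add W P Q")
    case (Affine x3 y3)
    have c: "weierstrass_poly W x1 y1 = 0" "weierstrass_poly W x2 y2 = 0"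
      using assms PQ by (auto simp: Affine_nonsing_iff)
    obtain l m where *: "y1 = l * x1 + m" "y2 = l * x2 + m" "y3 = - (l * x3 + m) - wa1 W * x3 - wa3 W"
       "line_through W l m x1 x2 x3" using point_add_line[OF c, of x3 y3] Affine by (metis PQ)
    define z where "z = l * x3 + m"
    have z: "weierstrass_poly W x3 z = 0"
    using line_through_third(1)[OF *(4)] by (simp add: z_def)
    have "Affine x3 z \<in> nonsing W"
    proof (rule ccontr)
      assume "Affine x3 z \<notin> nonsing W"
      then have s: "weierstrass_poly_dx W x3 z = 0" "weierstrass_poly_dy W x3 z = 0"
        using z by (auto simp: Affine_nonsing_iff)
      have "(x3 - x1) * (x3 - x2) = - (weierstrass_poly_dx W x3 z + l * weierstrass_poly_dy W x3 z)"
        using line_through_third(2)[OF *(4)] by (simp add: z_def)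
      then have "x3 = x1 \<or> x3 = x2" using s by simp
      then have "Affine x3 z = P \<or> Affine x3 z = Q" using *(1,2) PQ by (auto simp: z_def)
      then show False using \<open>Affine x3 z \<notin> nonsing W\<close> assms by auto
    qed
    moreover have "point_neg W (Affine x3 z) = Affine x3 y3" by (simp add: *(3) z_def)
    ultimately show ?thesis using Affine by (metis point_neg_nonsing)
  qed simp
qed (use assms in auto)

section \<open>Polynomial identities for the ideal computations\<close>

context
  fixes W :: "'a::idom weierstrass"
begin

text \<open>Modulo the curve, three vertical lines multiply to the line times its conjugate: the
  second factor is minus the line evaluated at the ordinate \<open>- Y - wa1 W * X - wa3 W\<close>.
  It is written around the sum point, which displays it as an element of the ideal of that point.
  \<open>X\<close> and \<open>Y\<close> stay free so that generic coordinates can be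
  inserted.\<close>

lemma line_through_factor:
  assumes "line_through W l m x1 x2 x3"
  shows "(X - x1) * (X - x2) * (X - x3) =
    (Y - l * X - m) * ((Y - (- (l * x3 + m) - wa1 W * x3 - wa3 W)) + (l + wa1 W) * (X - x3))
    - weierstrass_poly W X Y"
proof -
  have a: "wa2 W = l^2 + wa1 W * l - (x1 + x2 + x3)"
    "wa4 W = x1 * x2 + x1 * x3 + x2 * x3 + 2 * l * m + wa1 W * m + wa3 W * l"
    "wa6 W = m^2 + wa3 W * m - x1 * x2 * x3"
    using assms unfolding line_through_def by (auto simp: algebra_simps)
  show ?thesis unfolding weierstrass_poly_def a by Groebner_Basis.algebra
qed

lemma weierstrass_poly_taylor:
  assumes "weierstrass_poly W x y = 0"
  shows "weierstrass_poly W X Y = (Y - y)^2 + wa1 W * (X - x) * (Y - y)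
    + weierstrass_poly_dy W x y * (Y - y) + weierstrass_poly_dx W x y * (X - x)
    - (X - x)^3 - (3 * x + wa2 W) * (X - x)^2"
proof -
  have a: "wa6 W = y^2 + wa1 W * x * y + wa3 W * y - (x^3 + wa2 W * x^2 + wa4 W * x)"
    using assms unfolding weierstrass_poly_def by (auto simp: algebra_simps)
  show ?thesis
    unfolding weierstrass_poly_def weierstrass_poly_dx_def weierstrass_poly_dy_def a
    by Groebner_Basis.algebra
qed

lemma inverse_points_factor:
  assumes "weierstrass_poly W x y1 = 0" "y1 + y2 + wa1 W * x + wa3 W = 0"
  shows "(Y - y1) * (Y - y2) = weierstrass_poly W X Y
    - (X - x) * (wa1 W * Y - (X^2 + x * X + x^2 + wa2 W * (X + x) + wa4 W))"
proof -
  have a: "wa6 W = y1^2 + wa1 W * x * y1 + wa3 W * y1 - (x^3 + wa2 W * x^2 + wa4 W * x)"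
    using assms(1) unfolding weierstrass_poly_def by (auto simp: algebra_simps)
  have b: "y2 = - y1 - wa1 W * x - wa3 W"
    using assms(2) point_neg_eq_iff by blast
  show ?thesis unfolding weierstrass_poly_def a b by Groebner_Basis.algebra
qed

end

subsection \<open>Ideals of the coordinate ring\<close>

text \<open>
  The coordinate ring is represented by bivariate polynomials (in \<open>Y\<close> over \<open>X\<close>) modulo the
  Weierstrass polynomial. Associativity follows since \<open>P \<mapsto> \<langle>X - x, Y - y\<rangle>\<close>
  induces an injective map to the ideal class group that turns point addition into multiplication.
\<close>

definition cst :: "'a::field \<Rightarrow> 'a poly poly" where "cst c = [:[:c:]:]"
definition coordX :: "'a::field poly poly" where "coordX = [:[:0, 1:]:]"
definition coordY :: "'a::field poly poly" where "coordY = [:0, 1:]"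

lemma cst_hom:
  fixes a b :: "'a::field"
  shows "cst (a + b) = cst a + cst b" "cst (a - b) = cst a - cst b" "cst (- a) = - cst a"
  "cst (a * b) = cst a * cst b" "cst (0::'a) = 0" "cst (1::'a) = 1" "cst (a ^ n) = cst a ^ n"
proof -
  show *: "cst (a * b) = cst a * cst b" for a b :: 'a by (simp add: cst_def)
  show 1: "cst (1::'a) = 1" by (simp add: cst_def one_pCons)
  show "cst (a ^ n) = cst a ^ n" by (induction n) (simp_all add: * 1)
qed (simp_all add: cst_def)

lemma cst_numeral: "cst (numeral n) = numeral n"
proof -
  have "cst (of_nat k) = of_nat k" for k by (induction k) (simp_all add: cst_hom)
  from this[of "numeral n"] show ?thesis by simp
qed

lemma cst_eq_0_iff [simp]: "cst a = 0 \<longleftrightarrow> a = 0" by (simp add: cst_def)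

definition gen_curve :: "'a::field weierstrass \<Rightarrow> 'a poly poly weierstrass" where
  "gen_curve W = map_weierstrass cst W"

lemma gen_curve_sel [simp]:
  "wa1 (gen_curve W) = cst (wa1 W)" "wa2 (gen_curve W) = cst (wa2 W)" "wa3 (gen_curve W) = cst (wa3 W)"
  "wa4 (gen_curve W) = cst (wa4 W)" "wa6 (gen_curve W) = cst (wa6 W)"
  by (simp_all add: gen_curve_def weierstrass.map_sel)

lemma cst_weierstrass:
  "weierstrass_poly (gen_curve W) (cst x) (cst y) = cst (weierstrass_poly W x y)"
  "weierstrass_poly_dx (gen_curve W) (cst x) (cst y) = cst (weierstrass_poly_dx W x y)"
  "weierstrass_poly_dy (gen_curve W) (cst x) (cst y) = cst (weierstrass_poly_dy W x y)"
  by (simp_all add: weierstrass_poly_def weierstrass_poly_dx_def weierstrass_poly_dy_def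
      cst_hom cst_numeral)

lemma cst_line_through:
  assumes "line_through W l m x1 x2 x3"
  shows "line_through (gen_curve W) (cst l) (cst m) (cst x1) (cst x2) (cst x3)"
proof -
  have "cst (x1 + x2 + x3) = cst (l^2 + wa1 W * l - wa2 W)"
    "cst (x1 * x2 + x1 * x3 + x2 * x3) = cst (wa4 W - 2 * l * m - wa1 W * m - wa3 W * l)"
    "cst (x1 * x2 * x3) = cst (m^2 + wa3 W * m - wa6 W)"
    using assms unfolding line_through_def by metis+
  then show ?thesis unfolding line_through_def gen_curve_sel cst_hom cst_numeral by blast
qed

definition wpol :: "'a::field weierstrass \<Rightarrow> 'a poly poly" where
  "wpol W = weierstrass_poly (gen_curve W) coordX coordY"

text \<open>An ideal of the coordinate ring is represented by its preimage under the quotient map,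
  hence the membership of \<open>wpol W\<close>.\<close>

definition is_ideal :: "'a::field weierstrass \<Rightarrow> 'a poly poly set \<Rightarrow> bool" where
  "is_ideal W A \<longleftrightarrow> wpol W \<in> A \<and> (\<forall>a\<in>A. \<forall>b\<in>A. a + b \<in> A) \<and> (\<forall>a\<in>A. \<forall>c. c * a \<in> A)"

lemma is_idealD:
  assumes "is_ideal W A"
  shows "a \<in> A \<Longrightarrow> b \<in> A \<Longrightarrow> a + b \<in> A" "a \<in> A \<Longrightarrow> c * a \<in> A" "a \<in> A \<Longrightarrow> a * c \<in> A"
    "0 \<in> A" "a \<in> A \<Longrightarrow> - a \<in> A" "a \<in> A \<Longrightarrow> b \<in> A \<Longrightarrow> a - b \<in> A" "wpol W * c \<in> A" "c * wpol W \<in> A"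
proof -
  show 1: "a \<in> A \<Longrightarrow> b \<in> A \<Longrightarrow> a + b \<in> A" for a b using assms by (auto simp: is_ideal_def)
  show 2: "a \<in> A \<Longrightarrow> c * a \<in> A" for a c using assms by (auto simp: is_ideal_def)
  show 3: "a \<in> A \<Longrightarrow> a * c \<in> A" for a c using 2 by (simp add: mult.commute)
  show "wpol W * c \<in> A" "c * wpol W \<in> A" using 2 3 assms by (auto simp: is_ideal_def)
  show "0 \<in> A" using 2[of "wpol W" 0] assms by (auto simp: is_ideal_def)
  show 4: "a \<in> A \<Longrightarrow> - a \<in> A" for a using 2[of a "-1"] by simp
  show "a \<in> A \<Longrightarrow> b \<in> A \<Longrightarrow> a - b \<in> A" using 1[of a "-b"] 4 by simp
qed

lemma UNIV_ideal [simp]: "is_ideal W UNIV" by (simp add: is_ideal_def)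

text \<open>The product of \<open>A\<close> with the maximal ideal of the point. The summand
  \<open>c * wpol W\<close> passes to the preimage; a single pair \<open>a\<close>, \<open>b\<close>
  suffices when \<open>A\<close> is an ideal.\<close>

fun act :: "'a::field weierstrass \<Rightarrow> 'a point \<Rightarrow> 'a poly poly set \<Rightarrow> 'a poly poly set" where
  "act W Infinity A = A"
| "act W (Affine x y) A =
     {a * (coordX - cst x) + b * (coordY - cst y) + c * wpol W | a b c. a \<in> A \<and> b \<in> A}"

definition scale :: "'a::field weierstrass \<Rightarrow> 'a poly poly \<Rightarrow> 'a poly poly set \<Rightarrow> 'a poly poly set" where
  "scale W s A = {s * a + c * wpol W | a c. a \<in> A}"

lemma act_AffineI:
  "a \<in> A \<Longrightarrow> b \<in> A \<Longrightarrow> t = a * (coordX - cst x) + b * (coordY - cst y) + c * wpol W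
    \<Longrightarrow> t \<in> act W (Affine x y) A"
  by auto

lemma act_AffineE:
  assumes "t \<in> act W (Affine x y) A"
  obtains a b c where "a \<in> A" "b \<in> A" "t = a * (coordX - cst x) + b * (coordY - cst y) + c * wpol W"
  using assms by auto

lemma scaleI: "a \<in> A \<Longrightarrow> t = s * a + c * wpol W \<Longrightarrow> t \<in> scale W s A"
  by (auto simp: scale_def)

lemma act_ideal:
  assumes "is_ideal W A"
  shows "is_ideal W (act W P A)"
proof (cases P)
  case (Affine x y)
  note D = is_idealD[OF assms]
  let ?X = "coordX - cst x" and ?Y = "coordY - cst y"
  have "wpol W = 0 * ?X + 0 * ?Y + 1 * wpol W" by simp
  then have 1: "wpol W \<in> act W (Affine x y) A" using D(4) by (blast intro: act_AffineI)
  have 2: "s + t \<in> act W (Affine x y) A"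
    if st: "s \<in> act W (Affine x y) A" "t \<in> act W (Affine x y) A" for s t
  proof -
    obtain a b c a' b' c' where "a \<in> A" "b \<in> A" "a' \<in> A" "b' \<in> A"
      and "s = a * ?X + b * ?Y + c * wpol W" "t = a' * ?X + b' * ?Y + c' * wpol W"
      using st by (meson act_AffineE)
    moreover from this have "s + t = (a + a') * ?X + (b + b') * ?Y + (c + c') * wpol W"
      by (simp only: distrib_right add_ac)
    ultimately show ?thesis using D(1) by (blast intro: act_AffineI)
  qed
  have 3: "r * s \<in> act W (Affine x y) A" if s: "s \<in> act W (Affine x y) A" for r s
  proof -
    obtain a b c where "a \<in> A" "b \<in> A" "s = a * ?X + b * ?Y + c * wpol W"
      using s by (rule act_AffineE)
    moreover from this have "r * s = (r * a) * ?X + (r * b) * ?Y + (r * c) * wpol W"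
      by (simp only: distrib_left mult.assoc)
    ultimately show ?thesis using D(2) by (blast intro: act_AffineI)
  qed
  show ?thesis using 1 2 3 by (auto simp: is_ideal_def Affine simp del: act.simps)
qed (use assms in auto)

lemma act2_Affine:
  assumes "is_ideal W A"
  shows "act W (Affine x1 y1) (act W (Affine x2 y2) A) =
    {a * ((coordX - cst x1) * (coordX - cst x2)) + b * ((coordX - cst x1) * (coordY - cst y2))
     + c * ((coordY - cst y1) * (coordX - cst x2)) + d * ((coordY - cst y1) * (coordY - cst y2))
     + e * wpol W | a b c d e. a \<in> A \<and> b \<in> A \<and> c \<in> A \<and> d \<in> A}" (is "?L = ?R")
proof
  show "?L \<subseteq> ?R"
  proof
    fix t assume "t \<in> ?L"
    then obtain s1 s2 c where t: "s1 \<in> act W (Affine x2 y2) A" "s2 \<in> act W (Affine x2 y2) A"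
      "t = s1 * (coordX - cst x1) + s2 * (coordY - cst y1) + c * wpol W" by (rule act_AffineE)
    obtain a b e where s1: "a \<in> A" "b \<in> A" "s1 = a * (coordX - cst x2) + b * (coordY - cst y2) + e * wpol W"
      using t(1) by (rule act_AffineE)
    obtain a' b' e' where s2: "a' \<in> A" "b' \<in> A" "s2 = a' * (coordX - cst x2) + b' * (coordY - cst y2) + e' * wpol W"
      using t(2) by (rule act_AffineE)
    have "t = a * ((coordX - cst x1) * (coordX - cst x2)) + b * ((coordX - cst x1) * (coordY - cst y2))
     + a' * ((coordY - cst y1) * (coordX - cst x2)) + b' * ((coordY - cst y1) * (coordY - cst y2))
     + (e * (coordX - cst x1) + e' * (coordY - cst y1) + c) * wpol W"
      unfolding t(3) s1(3) s2(3) by (simp add: algebra_simps)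
    then show "t \<in> ?R" using s1 s2 by blast
  qed
  show "?R \<subseteq> ?L"
  proof
    fix t assume "t \<in> ?R"
    then obtain a b c d e where t: "a \<in> A" "b \<in> A" "c \<in> A" "d \<in> A"
      "t = a * ((coordX - cst x1) * (coordX - cst x2)) + b * ((coordX - cst x1) * (coordY - cst y2))
     + c * ((coordY - cst y1) * (coordX - cst x2)) + d * ((coordY - cst y1) * (coordY - cst y2))
     + e * wpol W" by blast
    have "a * (coordX - cst x2) + b * (coordY - cst y2) + 0 * wpol W \<in> act W (Affine x2 y2) A"
      "c * (coordX - cst x2) + d * (coordY - cst y2) + 0 * wpol W \<in> act W (Affine x2 y2) A"
      using t by (blast intro: act_AffineI)+
    then show "t \<in> ?L"
      by (rule act_AffineI[of _ _ _ _ _ _ e]) (simp add: t(5) algebra_simps)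
  qed
qed

lemma scale_scale: "scale W s (scale W t A) = scale W (s * t) A"
proof
  show "scale W s (scale W t A) \<subseteq> scale W (s * t) A"
  proof
    fix r assume "r \<in> scale W s (scale W t A)"
    then obtain a c d where "a \<in> A" "r = s * (t * a + c * wpol W) + d * wpol W" by (auto simp: scale_def)
    then show "r \<in> scale W (s * t) A"
      by (intro scaleI[of a _ _ _ "s * c + d"]) (auto simp: algebra_simps)
  qed
  show "scale W (s * t) A \<subseteq> scale W s (scale W t A)"
  proof
    fix r assume "r \<in> scale W (s * t) A"
    then obtain a c where r: "a \<in> A" "r = s * t * a + c * wpol W" by (auto simp: scale_def)
    have "t * a + 0 * wpol W \<in> scale W t A" using r(1) by (blast intro: scaleI)
    then show "r \<in> scale W s (scale W t A)"
      by (rule scaleI[of _ _ _ _ c]) (simp add: r algebra_simps)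
  qed
qed

lemma act_scale: "act W P (scale W s A) = scale W s (act W P A)"
proof (cases P)
  case (Affine x y)
  let ?X = "coordX - cst x" and ?Y = "coordY - cst y"
  have "act W (Affine x y) (scale W s A) \<subseteq> scale W s (act W (Affine x y) A)"
  proof
    fix t assume "t \<in> act W (Affine x y) (scale W s A)"
    then obtain s1 s2 c where t: "s1 \<in> scale W s A" "s2 \<in> scale W s A" "t = s1 * ?X + s2 * ?Y + c * wpol W"
      by (rule act_AffineE)
    obtain a d b e where ab: "a \<in> A" "b \<in> A" "s1 = s * a + d * wpol W" "s2 = s * b + e * wpol W"
      using t(1,2) by (auto simp: scale_def)
    have "a * ?X + b * ?Y + 0 * wpol W \<in> act W (Affine x y) A" using ab by (blast intro: act_AffineI)
    then show "t \<in> scale W s (act W (Affine x y) A)"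
      by (rule scaleI[of _ _ _ _ "d * ?X + e * ?Y + c"]) (simp add: t(3) ab algebra_simps)
  qed
  moreover have "scale W s (act W (Affine x y) A) \<subseteq> act W (Affine x y) (scale W s A)"
  proof
    fix t assume "t \<in> scale W s (act W (Affine x y) A)"
    then obtain a b c d where t: "a \<in> A" "b \<in> A" "t = s * (a * ?X + b * ?Y + c * wpol W) + d * wpol W"
      by (auto simp: scale_def)
    have "s * a + 0 * wpol W \<in> scale W s A" "s * b + 0 * wpol W \<in> scale W s A"
      using t by (blast intro: scaleI)+
    then show "t \<in> act W (Affine x y) (scale W s A)"
      by (rule act_AffineI[of _ _ _ _ _ _ "s * c + d"]) (simp add: t(3) algebra_simps)
  qed
  ultimately show ?thesis using Affine by blast
qed auto

text \<open>Equality of ideal classes with denominators cleared, so that fractional ideals never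
  appear.\<close>

definition same_class :: "'a::field weierstrass \<Rightarrow> 'a poly poly set \<Rightarrow> 'a poly poly set \<Rightarrow> bool" where
  "same_class W A B \<longleftrightarrow>
     (\<exists>s t. \<not> wpol W dvd s \<and> \<not> wpol W dvd t \<and> scale W s A = scale W t B)"

lemma same_class_sym: "same_class W A B \<Longrightarrow> same_class W B A"
  unfolding same_class_def by metis

lemma same_class_act: "same_class W A B \<Longrightarrow> same_class W (act W P A) (act W P B)"
  unfolding same_class_def by (metis act_scale)

text \<open>Products of generators fall into the ideal of the vertical line by
  \<open>inverse_points_factor\<close>. Conversely \<open>X - x\<close> has to be recovered: if
  \<open>y1 \<noteq> y2\<close>, from the difference of the two ordinate generators; if
  \<open>y1 = y2\<close>, the derivative in \<open>Y\<close> vanishes, so nonsingularity makes the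
  one in \<open>X\<close> invertible, and the Taylor expansion can be solved for
  \<open>X - x\<close>.\<close>

lemma act_inverse:
  assumes P: "Affine x y1 \<in> nonsing W" and M: "is_ideal W M"
    and y: "y1 + y2 + wa1 W * x + wa3 W = 0"
  shows "act W (Affine x y1) (act W (Affine x y2) M) = scale W (coordX - cst x) M"
proof -
  define u v v' where "u = coordX - cst x" and "v = coordY - cst y1" and "v' = coordY - cst y2"
  have wp: "weierstrass_poly W x y1 = 0" using P by (simp add: Affine_nonsing_iff)
  have y': "cst y1 + cst y2 + cst (wa1 W) * cst x + cst (wa3 W) = 0"
    using arg_cong[OF y, of cst] by (simp add: cst_hom)
  have wp': "weierstrass_poly (gen_curve W) (cst x) (cst y1) = 0" by (simp add: cst_weierstrass wp)
  define g where "g = cst (wa1 W) * coordY - (coordX^2 + cst x * coordX + cst x ^2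
      + cst (wa2 W) * (coordX + cst x) + cst (wa4 W))"
  have vv: "v * v' = wpol W - u * g"
    using inverse_points_factor[OF wp', of "cst y2" coordY coordX] y'
    by (simp add: wpol_def u_def v_def v'_def g_def)
  note D = is_idealD[OF M]
  have A2: "act W (Affine x y1) (act W (Affine x y2) M) = {a * (u * u) + b * (u * v') + c * (v * u)
     + d * (v * v') + e * wpol W | a b c d e. a \<in> M \<and> b \<in> M \<and> c \<in> M \<and> d \<in> M}" (is "?L = ?R")
    unfolding act2_Affine[OF M] u_def v_def v'_def ..
  have "?R \<subseteq> scale W u M"
  proof
    fix t assume "t \<in> ?R"
    then obtain a b c d e where t: "a \<in> M" "b \<in> M" "c \<in> M" "d \<in> M"
      "t = a * (u * u) + b * (u * v') + c * (v * u) + d * (v * v') + e * wpol W" by blast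
    have "a * u + b * v' + c * v - d * g \<in> M" using t(1-4) by (simp add: D)
    then show "t \<in> scale W u M"
      by (rule scaleI[of _ _ _ _ "d + e"]) (unfold t(5) vv, simp add: algebra_simps)
  qed
  moreover have "scale W u M \<subseteq> ?R"
  proof
    fix t assume "t \<in> scale W u M"
    then obtain e c where t: "e \<in> M" "t = u * e + c * wpol W" by (auto simp: scale_def)
    show "t \<in> ?R"
    proof (cases "y1 = y2")
      case False
      define k where "k = cst (inverse (y1 - y2))"
      have "k * cst (y1 - y2) = 1" unfolding k_def using False by (simp flip: cst_hom)
      moreover have "v' - v = cst (y1 - y2)" by (simp add: v'_def v_def cst_hom)
      ultimately have k: "k * (v' - v) = 1" by simp
      have "e * k \<in> M" "- (e * k) \<in> M" "0 \<in> M" using t(1) by (simp_all add: D)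
      moreover have "t = 0 * (u * u) + e * k * (u * v') + (- (e * k)) * (v * u) + 0 * (v * v') + c * wpol W"
      proof -
        have "e * k * (u * v') + (- (e * k)) * (v * u) = u * e * (k * (v' - v))"
          by (simp add: algebra_simps)
        then show ?thesis using k t by simp
      qed
      ultimately show ?thesis by blast
    next
      case True
      have "weierstrass_poly_dy W x y1 = 0"
        unfolding weierstrass_poly_dy_def mult_2 using y unfolding True .
      then have dx: "weierstrass_poly_dx W x y1 \<noteq> 0" and dy: "weierstrass_poly_dy W x y1 = 0"
        using P by (auto simp: Affine_nonsing_iff)
      have v': "v' = v" using True by (simp add: v_def v'_def)
      define k where "k = cst (inverse (weierstrass_poly_dx W x y1))"
      define q where "q = cst (weierstrass_poly_dx W x y1)"
      have k: "k * q = 1" unfolding k_def q_def using dx by (simp flip: cst_hom)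
      have "wpol W = v^2 + cst (wa1 W) * u * v + q * u - u^3 - (3 * cst x + cst (wa2 W)) * u^2"
        using weierstrass_poly_taylor[OF wp', of coordX coordY] dy
        by (simp add: wpol_def u_def v_def q_def cst_weierstrass cst_hom)
      then have "q * u = wpol W - v * v - cst (wa1 W) * (u * v) + (u + 3 * cst x + cst (wa2 W)) * (u * u)"
        by (simp add: algebra_simps power2_eq_square power3_eq_cube)
      then have ue: "u * e = e * k * (wpol W - v * v - cst (wa1 W) * (u * v) + (u + 3 * cst x + cst (wa2 W)) * (u * u))"
        using k by (metis (no_types, lifting) mult.assoc mult.commute mult.right_neutral)
      have "t = (e * k * (u + 3 * cst x + cst (wa2 W))) * (u * u) + (- (e * k * cst (wa1 W))) * (u * v')
         + 0 * (v * u) + (- (e * k)) * (v * v') + (e * k + c) * wpol W"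
        unfolding t(2) ue v' by (simp add: algebra_simps)
      moreover have "e * k * (u + 3 * cst x + cst (wa2 W)) \<in> M" "- (e * k * cst (wa1 W)) \<in> M"
        "- (e * k) \<in> M" "0 \<in> M" using t(1) by (simp_all add: D)
      ultimately show ?thesis by blast
    qed
  qed
  ultimately show ?thesis unfolding A2 u_def[symmetric] by blast
qed

text \<open>With vertical lines \<open>u\<close>, \<open>u'\<close>, \<open>t\<close> through the
  two points and their sum, and \<open>L\<close> the line through the two, the curve turns
  \<open>u * u' * t\<close> into \<open>L\<close> times an element of the ideal of the sum. The
  converse inclusion rests on \<open>L\<close> lying in the product of the two ideals: by a
  difference of generators for a chord, and by the linear part of the Taylor expansion for a
  tangent.\<close>

lemma act_sum:
  assumes P: "Affine x1 y1 \<in> nonsing W" and Q: "Affine x2 y2 \<in> nonsing W" and M: "is_ideal W M"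
    and S: "point_add W (Affine x1 y1) (Affine x2 y2) = Affine x3 y3"
  obtains l m where "scale W (coordX - cst x3) (act W (Affine x1 y1) (act W (Affine x2 y2) M))
      = scale W (coordY - cst l * coordX - cst m) (act W (Affine x3 y3) M)"
proof -
  have wp: "weierstrass_poly W x1 y1 = 0" "weierstrass_poly W x2 y2 = 0"
    using P Q by (simp_all add: Affine_nonsing_iff)
  obtain l m where y: "y1 = l * x1 + m" "y2 = l * x2 + m" "y3 = - (l * x3 + m) - wa1 W * x3 - wa3 W"
    and line: "line_through W l m x1 x2 x3" and
    alt: "x1 \<noteq> x2 \<and> l * (x2 - x1) = y2 - y1 \<or>
     x1 = x2 \<and> y1 = y2 \<and> weierstrass_poly_dy W x1 y1 \<noteq> 0 \<and>
     weierstrass_poly_dy W x1 y1 * l = - weierstrass_poly_dx W x1 y1"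
    using point_add_line[OF wp S] .
  define u u' v v' where "u = coordX - cst x1" and "u' = coordX - cst x2"
    and "v = coordY - cst y1" and "v' = coordY - cst y2"
  define t s where "t = coordX - cst x3" and "s = coordY - cst y3"
  define k k' where "k = cst l" and "k' = cst l + cst (wa1 W)"
  define L where "L = coordY - k * coordX - cst m"
  have v: "v = L + k * u" "v' = L + k * u'"
    unfolding v_def v'_def L_def k_def u_def u'_def y by (simp_all add: cst_hom algebra_simps)
  have wp': "weierstrass_poly (gen_curve W) (cst x1) (cst y1) = 0" by (simp add: cst_weierstrass wp)
  have uut: "u * u' * t = L * (s + k' * t) - wpol W"
    using line_through_factor[OF cst_line_through[OF line], of coordX coordY]
    unfolding u_def u'_def t_def s_def L_def k_def k'_def y wpol_def by (simp add: cst_hom)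
  note D = is_idealD[OF M]
  have A2: "act W (Affine x1 y1) (act W (Affine x2 y2) M) = {a * (u * u') + b * (u * v') + c * (v * u')
     + d * (v * v') + e * wpol W | a b c d e. a \<in> M \<and> b \<in> M \<and> c \<in> M \<and> d \<in> M}" (is "?L = ?R")
    unfolding act2_Affine[OF M] u_def v_def v'_def u'_def ..
  have "scale W t ?R \<subseteq> scale W L (act W (Affine x3 y3) M)"
  proof
    fix r assume "r \<in> scale W t ?R"
    then obtain r' f where r': "r' \<in> ?R" "r = t * r' + f * wpol W" unfolding scale_def by blast
    then obtain a b c d e where M': "a \<in> M" "b \<in> M" "c \<in> M" "d \<in> M"
      "r' = a * (u * u') + b * (u * v') + c * (v * u') + d * (v * v') + e * wpol W" by blast
    \<comment> \<open>Modulo \<open>L\<close> the ordinate generators are \<open>k * u\<close> and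
      \<open>k * u'\<close>: \<open>E\<close> collects the coefficient of \<open>u * u'\<close>, and
      \<open>F\<close> the cofactor of \<open>L\<close>.\<close>
    define E where "E = a + k * b + k * c + k^2 * d"
    define F where "F = b * u + c * u' + d * (L + k * u + k * u')"
    have EF: "E \<in> M" "F \<in> M" "k' * E + F \<in> M" unfolding E_def F_def using M'(1-4) by (simp_all add: D)
    have "t * r' = E * (u * u' * t) + L * t * F + e * t * wpol W"
      unfolding M'(5) E_def F_def v by (simp add: algebra_simps power2_eq_square)
    then have "r = L * ((k' * E + F) * t + E * s + 0 * wpol W) + (e * t + f - E) * wpol W"
      unfolding r' uut by (simp add: algebra_simps)
    moreover have "(k' * E + F) * t + E * s + 0 * wpol W \<in> act W (Affine x3 y3) M"
      using EF by (blast intro: act_AffineI[where x = x3 and y = y3, folded t_def s_def])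
    ultimately show "r \<in> scale W L (act W (Affine x3 y3) M)" by (blast intro: scaleI)
  qed
  moreover have LR: "\<exists>c. e * L + c * wpol W \<in> ?R" if e: "e \<in> M" for e
    using alt
  proof
    assume a: "x1 \<noteq> x2 \<and> l * (x2 - x1) = y2 - y1"
    define h where "h = cst (inverse (x1 - x2))"
    have "h * cst (x1 - x2) = 1" unfolding h_def using a by (simp flip: cst_hom)
    moreover have "u' - u = cst (x1 - x2)" by (simp add: u'_def u_def cst_hom)
    ultimately have h: "h * (u' - u) = 1" by simp
    have "0 * (u * u') + (- (e * h)) * (u * v') + e * h * (v * u') + 0 * (v * v') + 0 * wpol W
      = e * L * (h * (u' - u))" unfolding v by (simp add: algebra_simps)
    then have "e * L + 0 * wpol W = 0 * (u * u') + (- (e * h)) * (u * v') + e * h * (v * u') + 0 * (v * v') + 0 * wpol W"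
      using h by simp
    moreover have "- (e * h) \<in> M" "e * h \<in> M" "0 \<in> M" using e by (simp_all add: D)
    ultimately show ?thesis by blast
  next
    assume a: "x1 = x2 \<and> y1 = y2 \<and> weierstrass_poly_dy W x1 y1 \<noteq> 0 \<and>
     weierstrass_poly_dy W x1 y1 * l = - weierstrass_poly_dx W x1 y1"
    define h where "h = cst (inverse (weierstrass_poly_dy W x1 y1))"
    define q q' where "q = cst (weierstrass_poly_dy W x1 y1)" and "q' = cst (weierstrass_poly_dx W x1 y1)"
    have "inverse (weierstrass_poly_dy W x1 y1) * weierstrass_poly_dy W x1 y1 = 1" using a by (intro left_inverse) blast
    then have h: "h * q = 1" unfolding h_def q_def by (simp flip: cst_hom)
    have "weierstrass_poly_dx W x1 y1 = - (weierstrass_poly_dy W x1 y1 * l)" using a by (metis minus_minus)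
    then have q': "q' = - (q * k)" unfolding q_def q'_def k_def by (simp flip: cst_hom)
    have uv: "u' = u" "v' = v" using a by (simp_all add: u_def u'_def v_def v'_def)
    have "wpol W = v^2 + cst (wa1 W) * u * v + q * v + q' * u - u^3 - (3 * cst x1 + cst (wa2 W)) * u^2"
      using weierstrass_poly_taylor[OF wp', of coordX coordY]
      by (simp add: wpol_def u_def v_def q_def q'_def cst_weierstrass cst_hom)
    then have "q * (v - k * u) = wpol W - v * v - cst (wa1 W) * (u * v) + (u + 3 * cst x1 + cst (wa2 W)) * (u * u)"
      by (simp add: q' algebra_simps power2_eq_square power3_eq_cube)
    moreover have "v - k * u = L" by (simp add: v)
    ultimately have "e * L = e * h * (wpol W - v * v - cst (wa1 W) * (u * v) + (u + 3 * cst x1 + cst (wa2 W)) * (u * u))"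
      using h by (metis (no_types, lifting) mult.assoc mult.right_neutral)
    then have "e * L + (- (e * h)) * wpol W = (e * h * (u + 3 * cst x1 + cst (wa2 W))) * (u * u') 
      + (- (e * h * cst (wa1 W))) * (u * v') + 0 * (v * u') + (- (e * h)) * (v * v') + 0 * wpol W"
      unfolding uv by (simp add: algebra_simps)
    moreover have "e * h * (u + 3 * cst x1 + cst (wa2 W)) \<in> M" "- (e * h * cst (wa1 W)) \<in> M"
      "- (e * h) \<in> M" "0 \<in> M" using e by (simp_all add: D)
    ultimately show ?thesis by blast
  qed
  have "scale W L (act W (Affine x3 y3) M) \<subseteq> scale W t ?R"
  proof
    fix r assume "r \<in> scale W L (act W (Affine x3 y3) M)"
    then obtain r' f where r': "r' \<in> act W (Affine x3 y3) M" "r = L * r' + f * wpol W"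
      unfolding scale_def by blast
    obtain a b c where ab: "a \<in> M" "b \<in> M" "r' = a * t + b * s + c * wpol W"
      using r'(1) unfolding t_def s_def by (rule act_AffineE)
    \<comment> \<open>Write \<open>a * t + b * s = (a - b * k') * t + b * (s + k' * t)\<close>.
      Multiplication by \<open>L\<close> turns the second part into \<open>b * (u * u' * t)\<close>
      modulo the curve, and the first part is handled by \<open>LR\<close>.\<close>
    have "a - b * k' \<in> M" using ab(1,2) by (simp add: D)
    then obtain c' where c': "(a - b * k') * L + c' * wpol W \<in> ?R" using LR by blast
    have R: "is_ideal W ?R" unfolding A2[symmetric] by (intro act_ideal M)
    have "b * (u * u') + 0 * (u * v') + 0 * (v * u') + 0 * (v * v') + 0 * wpol W \<in> ?R"
      using ab D(4) by blast
    then have "(a - b * k') * L + c' * wpol W + b * (u * u') \<in> ?R"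
      using is_idealD(1)[OF R] c' by simp
    moreover have "r = t * ((a - b * k') * L + c' * wpol W + b * (u * u')) + (b - c' * t + L * c + f) * wpol W"
    proof -
      have "t * ((a - b * k') * L + c' * wpol W + b * (u * u')) = t * a * L - t * b * k' * L + t * c' * wpol W + b * (u * u' * t)"
        by (simp add: algebra_simps)
      also have "\<dots> = t * a * L + b * L * s + (t * c' - b) * wpol W" unfolding uut by (simp add: algebra_simps)
      finally show ?thesis unfolding r' ab by (simp add: algebra_simps)
    qed
    ultimately show "r \<in> scale W t ?R" by (blast intro: scaleI)
  qed
  ultimately have "scale W t ?L = scale W L (act W (Affine x3 y3) M)" unfolding A2 by blast
  then show ?thesis using that unfolding t_def L_def k_def by blast
qed

subsection \<open>The norm and injectivity of the class map\<close>

definition lin_coeff :: "'a::field weierstrass \<Rightarrow> 'a poly" where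
  "lin_coeff W = [:wa3 W, wa1 W:]"

definition cubic :: "'a::field weierstrass \<Rightarrow> 'a poly" where
  "cubic W = [:wa6 W, wa4 W, wa2 W, 1:]"

text \<open>The norm of \<open>f + g * Y\<close> over the polynomials in \<open>X\<close>:
  \<open>Y\<close> and its conjugate have sum \<open>- lin_coeff W\<close> and product
  \<open>- cubic W\<close>.\<close>

definition pnorm :: "'a::field weierstrass \<Rightarrow> 'a poly \<Rightarrow> 'a poly \<Rightarrow> 'a poly" where
  "pnorm W f g = f^2 - f * g * lin_coeff W - g^2 * cubic W"

lemma wpol_eq: "wpol W = [:- cubic W, lin_coeff W, 1:]"
  by (simp add: wpol_def weierstrass_poly_def coordX_def coordY_def cst_def cubic_def lin_coeff_def
      power2_eq_square power3_eq_cube one_pCons)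

lemma degree_wpol: "degree (wpol W) = 2"
  by (simp add: wpol_eq)

lemma wpol_dvd_linear_iff: "wpol W dvd [:f, g:] \<longleftrightarrow> f = 0 \<and> g = 0"
proof
  assume "wpol W dvd [:f, g:]"
  moreover have "degree [:f, g:] < degree (wpol W)" by (simp add: degree_wpol)
  ultimately have "[:f, g:] = 0" by (metis dvd_imp_degree_le not_le)
  then show "f = 0 \<and> g = 0" by simp
qed simp

lemma wpol_dvd_mult_linear:
  "wpol W dvd [:f, g:] * [:f', g':] - [:f * f' + g * g' * cubic W, f * g' + g * f' - g * g' * lin_coeff W:]"
proof -
  have "[:f, g:] * [:f', g':] - [:f * f' + g * g' * cubic W, f * g' + g * f' - g * g' * lin_coeff W:]
    = wpol W * [:g * g':]"
    by (simp add: wpol_eq algebra_simps)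
  then show ?thesis by (simp only: dvd_triv_left)
qed

lemma pnorm_mult:
  "pnorm W (f * f' + g * g' * cubic W) (f * g' + g * f' - g * g' * lin_coeff W) = pnorm W f g * pnorm W f' g'"
  unfolding pnorm_def by Groebner_Basis.algebra

lemma reduce_mod_wpol: "\<exists>f g. wpol W dvd h - [:f, g:]"
proof (induction h)
  case 0
  have "wpol W dvd 0 - [:0, 0:]" by simp
  then show ?case by blast
next
  case (pCons a h)
  then obtain f g where "wpol W dvd h - [:f, g:]" by blast
  then have "wpol W dvd [:0, 1:] * (h - [:f, g:])" by (rule dvd_mult)
  moreover have "wpol W dvd [:0, 1:] * [:f, g:] - [:g * cubic W, f - g * lin_coeff W:]"
    using wpol_dvd_mult_linear[of W 0 1 f g] by simp
  ultimately have "wpol W dvd [:0, 1:] * (h - [:f, g:]) + ([:0, 1:] * [:f, g:] - [:g * cubic W, f - g * lin_coeff W:])"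
    by (rule dvd_add)
  also have "\<dots> = pCons a h - [:a + g * cubic W, f - g * lin_coeff W:]"
    by (simp add: algebra_simps)
  finally show ?case by blast
qed

text \<open>The outer terms have degrees \<open>2 * degree f\<close> and
  \<open>2 * degree g + 3\<close>, of different parity, so they cannot cancel, and the middle term
  is always smaller than the larger one. Thus an element whose norm has degree below 3 involves no
  \<open>Y\<close>.\<close>

lemma degree_pnorm:
  assumes "g \<noteq> 0"
  shows "pnorm W f g \<noteq> 0 \<and> degree (pnorm W f g) \<ge> 3"
proof -
  let ?B = "lin_coeff W" and ?C = "cubic W"
  have C: "degree ?C = 3" "?C \<noteq> 0" by (auto simp: cubic_def)
  have B: "degree ?B \<le> 1" by (simp add: lin_coeff_def)
  have gC: "degree (g^2 * ?C) = 2 * degree g + 3"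
    using assms C by (simp add: degree_mult_eq degree_power_eq)
  have fgB: "degree (f * g * ?B) \<le> degree f + degree g + 1"
    using degree_mult_le[of "f * g" ?B] degree_mult_le[of f g] B by linarith
  show ?thesis
  proof (cases "degree f \<ge> degree g + 2")
    case True
    then have f0: "f \<noteq> 0" by auto
    have f2: "degree (f^2) = 2 * degree f" using f0 by (simp add: degree_power_eq)
    have "degree (f * g * ?B + g^2 * ?C) < degree (f^2)"
      using True f2 fgB gC by (intro degree_add_less) linarith+
    moreover have "pnorm W f g = f^2 - (f * g * ?B + g^2 * ?C)" by (simp add: pnorm_def)
    ultimately have "degree (pnorm W f g) = 2 * degree f"
      using f2 by (metis degree_add_eq_left degree_minus diff_conv_add_uminus)
    then show ?thesis using True by auto
  next
    case False
    have "degree (f^2) \<le> 2 * degree f" by (metis degree_power_le mult.commute)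
    then have "degree (f^2 - f * g * ?B) < degree (g^2 * ?C)"
      using False fgB gC by (intro degree_diff_less) linarith+
    then have "degree (pnorm W f g) = degree (g^2 * ?C)"
      unfolding pnorm_def by (metis degree_add_eq_right degree_minus diff_conv_add_uminus)
    then show ?thesis using gC by auto
  qed
qed

lemma pnorm_eq_0_iff: "pnorm W f g = 0 \<longleftrightarrow> f = 0 \<and> g = 0"
proof
  assume *: "pnorm W f g = 0"
  then have "g = 0" using degree_pnorm by blast
  then show "f = 0 \<and> g = 0" using * by (simp add: pnorm_def)
qed (simp add: pnorm_def)

lemma dvd_diff_trans:
  fixes a b c w :: "'b::comm_ring_1"
  assumes "w dvd a - b" "w dvd b - c"
  shows "w dvd a - c"
proof -
  have "a - c = (a - b) + (b - c)" by simp
  then show ?thesis using assms by (metis dvd_add)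
qed

lemma dvd_wpol_cong:
  assumes "wpol W dvd a - a'" "wpol W dvd b - b'"
  shows "wpol W dvd a * b - a' * b'"
proof -
  have "a * b - a' * b' = (a - a') * b + a' * (b - b')" by (simp add: algebra_simps)
  then show ?thesis using assms by (metis dvd_add dvd_mult dvd_mult2)
qed

text \<open>A remainder vanishes exactly when its norm does, and the norm is multiplicative with
  values in an integral domain.\<close>

lemma prime_wpol:
  assumes "wpol W dvd a * b"
  shows "wpol W dvd a \<or> wpol W dvd b"
proof -
  obtain f g f' g' where r: "wpol W dvd a - [:f, g:]" "wpol W dvd b - [:f', g':]"
    using reduce_mod_wpol by metis
  let ?r = "[:f * f' + g * g' * cubic W, f * g' + g * f' - g * g' * lin_coeff W:]"
  have "wpol W dvd a * b - [:f, g:] * [:f', g':]" using dvd_wpol_cong r by blast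
  then have "wpol W dvd a * b - ?r"
    using wpol_dvd_mult_linear by (rule dvd_diff_trans)
  then have "wpol W dvd a * b - (a * b - ?r)" using assms by (rule dvd_diff[rotated])
  then have "wpol W dvd ?r" by simp
  then have "pnorm W f g * pnorm W f' g' = 0"
    unfolding pnorm_mult[symmetric] wpol_dvd_linear_iff pnorm_eq_0_iff .
  then have "[:f, g:] = 0 \<or> [:f', g':] = 0" by (auto simp: pnorm_eq_0_iff)
  then show ?thesis using r by auto
qed

lemma same_class_trans:
  assumes "same_class W A B" "same_class W B C"
  shows "same_class W A C"
proof -
  obtain s t where 1: "\<not> wpol W dvd s" "\<not> wpol W dvd t" "scale W s A = scale W t B"
    using assms(1) by (auto simp: same_class_def)
  obtain s' t' where 2: "\<not> wpol W dvd s'" "\<not> wpol W dvd t'" "scale W s' B = scale W t' C"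
    using assms(2) by (auto simp: same_class_def)
  have "scale W (s' * s) A = scale W s' (scale W t B)" by (simp flip: scale_scale add: 1(3))
  also have "\<dots> = scale W t (scale W s' B)" unfolding scale_scale by (simp only: mult.commute)
  also have "\<dots> = scale W (t * t') C" unfolding 2(3) scale_scale ..
  finally have "scale W (s' * s) A = scale W (t * t') C" .
  moreover have "\<not> wpol W dvd s' * s" "\<not> wpol W dvd t * t'"
    using 1(1,2) 2(1,2) prime_wpol by metis+
  ultimately show ?thesis unfolding same_class_def by metis
qed

lemma linear_not_dvd: "\<not> wpol W dvd coordX - cst x" "\<not> wpol W dvd coordY - cst l * coordX - cst m"
proof -
  have "coordX - cst x = [:[:- x, 1:], 0:]" by (simp add: coordX_def cst_def)
  then show "\<not> wpol W dvd coordX - cst x" by (simp only: wpol_dvd_linear_iff) simp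
  have "coordY - cst l * coordX - cst m = [:[:- m, - l:], 1:]" by (simp add: coordX_def coordY_def cst_def)
  then show "\<not> wpol W dvd coordY - cst l * coordX - cst m" by (simp only: wpol_dvd_linear_iff) simp
qed

lemma one_not_dvd: "\<not> wpol W dvd 1"
proof -
  have *: "(1 :: 'a poly poly) = [:1, 0:]" by (simp add: one_pCons)
  show ?thesis unfolding * wpol_dvd_linear_iff by simp
qed

lemma scale_one:
  assumes "is_ideal W A"
  shows "scale W 1 A = A"
proof
  show "scale W 1 A \<subseteq> A"
    unfolding scale_def using is_idealD(1,8)[OF assms] by auto
  show "A \<subseteq> scale W 1 A"
  proof
    fix a assume "a \<in> A"
    then show "a \<in> scale W 1 A" by (rule scaleI[of _ _ _ _ 0]) simp
  qed
qed

lemma same_class_act_act: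
  assumes P: "P \<in> nonsing W" and Q: "Q \<in> nonsing W" and M: "is_ideal W M"
  shows "same_class W (act W P (act W Q M)) (act W (point_add W P Q) M)"
proof -
  have refl: "same_class W A A" for A unfolding same_class_def using one_not_dvd by blast
  show ?thesis
  proof (cases P; cases Q)
    fix x1 y1 x2 y2 assume PQ: "P = Affine x1 y1" "Q = Affine x2 y2"
    show ?thesis
    proof (cases "point_add W P Q")
      case Infinity
      then have "Q = point_neg W P" by (simp add: point_add_eq_Infinity_iff)
      then have *: "x2 = x1" "y1 + y2 + wa1 W * x1 + wa3 W = 0" by (auto simp: PQ)
      have "scale W 1 (act W P (act W Q M)) = scale W (coordX - cst x1) M"
        using act_inverse[OF _ M *(2)] P unfolding PQ *(1)
        by (metis M act_ideal scale_one)
      then show ?thesis unfolding Infinity act.simps same_class_def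
        using one_not_dvd linear_not_dvd by blast
    next
      case (Affine x3 y3)
      then show ?thesis using act_sum[OF _ _ M] P Q unfolding PQ same_class_def
        by (metis linear_not_dvd)
    qed
  qed (auto simp: refl)
qed

definition evalp :: "'a::field poly poly \<Rightarrow> 'a \<Rightarrow> 'a \<Rightarrow> 'a" where
  "evalp h x y = poly (poly h [:y:]) x"

lemma evalp_simps [simp]:
  "evalp (a + b) x y = evalp a x y + evalp b x y" "evalp (a - b) x y = evalp a x y - evalp b x y"
  "evalp (a * b) x y = evalp a x y * evalp b x y" "evalp coordX x y = x" "evalp coordY x y = y"
  "evalp (cst c) x y = c" "evalp [:f, g:] x y = poly f x + y * poly g x"
  by (simp_all add: evalp_def coordX_def coordY_def cst_def)

lemma evalp_wpol: "evalp (wpol W) x y = weierstrass_poly W x y"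
  by (simp add: evalp_def wpol_eq weierstrass_poly_def cubic_def lin_coeff_def algebra_simps
      power2_eq_square power3_eq_cube)

text \<open>A generator \<open>r = f + g * Y\<close> would divide both \<open>X - x\<close> and
  \<open>Y - y\<close>. The norm of \<open>X - x\<close> has degree 2, so
  \<open>degree_pnorm\<close> forces \<open>g = 0\<close>; comparing coefficients of
  \<open>Y\<close> in \<open>Y - y\<close> then gives \<open>1 = f * g''\<close>, although
  \<open>f\<close> vanishes at \<open>x\<close> because \<open>r\<close> vanishes at the
  point.\<close>

lemma act_Affine_not_principal:
  assumes "weierstrass_poly W x y = 0"
  shows "\<not> same_class W UNIV (act W (Affine x y) UNIV)"
proof
  assume "same_class W UNIV (act W (Affine x y) UNIV)"
  then obtain s t where st: "\<not> wpol W dvd s" "\<not> wpol W dvd t"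
    and eq: "scale W s UNIV = scale W t (act W (Affine x y) UNIV)"
    unfolding same_class_def by blast
  let ?I = "act W (Affine x y) UNIV"
  have ev: "evalp a x y = 0" if "wpol W dvd a" for a
    using that assms by (auto elim!: dvdE simp: evalp_wpol)
  have I: "evalp a x y = 0" if "a \<in> ?I" for a
    using that ev by (auto elim!: act_AffineE simp: evalp_wpol assms)
  have "s = s * 1 + 0 * wpol W" by simp
  then have "s \<in> scale W s UNIV" by (blast intro: scaleI)
  then have "s \<in> scale W t ?I" by (simp only: eq)
  then obtain r c where r: "r \<in> ?I" "s = t * r + c * wpol W" unfolding scale_def by blast
  have div: "\<exists>q. wpol W dvd a - r * q" if "a \<in> ?I" for a
  proof -
    have "t * a + 0 * wpol W \<in> scale W t ?I" using that by (blast intro: scaleI)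
    then have "t * a \<in> scale W s UNIV" by (simp add: eq)
    then obtain q d where "t * a = s * q + d * wpol W" unfolding scale_def by blast
    then have "t * (a - r * q) = wpol W * (c * q + d)" unfolding r(2) by (simp add: algebra_simps)
    then have "wpol W dvd t * (a - r * q)" by simp
    then show ?thesis using prime_wpol st by blast
  qed
  have "coordX - cst x = 1 * (coordX - cst x) + 0 * (coordY - cst y) + 0 * wpol W"
    "coordY - cst y = 0 * (coordX - cst x) + 1 * (coordY - cst y) + 0 * wpol W" by simp_all
  then have "coordX - cst x \<in> ?I" "coordY - cst y \<in> ?I" by (blast intro: act_AffineI)+
  then obtain q q' where q: "wpol W dvd (coordX - cst x) - r * q" "wpol W dvd (coordY - cst y) - r * q'"
    using div by metis
  obtain f g where fg: "wpol W dvd r - [:f, g:]" using reduce_mod_wpol by metis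
  have step: "a = f * f' + g * g' * cubic W \<and> b = f * g' + g * f' - g * g' * lin_coeff W"
    if q: "wpol W dvd [:a, b:] - r * q" and f': "wpol W dvd q - [:f', g':]" for a b q f' g'
  proof -
    let ?r = "[:f * f' + g * g' * cubic W, f * g' + g * f' - g * g' * lin_coeff W:]"
    have "wpol W dvd [:a, b:] - ?r"
      by (rule dvd_diff_trans[OF q dvd_diff_trans[OF dvd_wpol_cong[OF fg f'] wpol_dvd_mult_linear]])
    also have "[:a, b:] - ?r = [:a - (f * f' + g * g' * cubic W), b - (f * g' + g * f' - g * g' * lin_coeff W):]"
      by simp
    finally show ?thesis unfolding wpol_dvd_linear_iff by simp
  qed
  obtain f' g' where f': "wpol W dvd q - [:f', g':]" using reduce_mod_wpol by metis
  obtain f'' g'' where f'': "wpol W dvd q' - [:f'', g'':]" using reduce_mod_wpol by metis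
  have "coordX - cst x = [:[:- x, 1:], 0:]" by (simp add: coordX_def cst_def)
  note 1 = step[OF q(1)[unfolded this] f']
  have "coordY - cst y = [:[:- y:], 1:]" by (simp add: coordY_def cst_def)
  note 2 = step[OF q(2)[unfolded this] f'']
  have "pnorm W [:- x, 1:] 0 = pnorm W f g * pnorm W f' g'"
    using 1 pnorm_mult by metis
  then have N: "[:- x, 1:]^2 = pnorm W f g * pnorm W f' g'" by (simp add: pnorm_def)
  have nz: "pnorm W f g \<noteq> 0" "pnorm W f' g' \<noteq> 0" using N by auto
  have "degree ([:- x, 1:]^2) = 2" by (simp add: degree_power_eq)
  then have deg: "degree (pnorm W f g) + degree (pnorm W f' g') = 2"
    unfolding N using nz by (simp add: degree_mult_eq)
  have g0: "g = 0" "g' = 0" using deg degree_pnorm[of g W f] degree_pnorm[of g' W f'] by auto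
  have ff: "[:- x, 1:] = f * f'" using 1 g0 by simp
  have "evalp r x y = 0" using I r(1) by blast
  then have fx: "poly f x = 0" using ev[OF fg] by (simp only: evalp_simps g0) simp
  have "1 = f * g''" using 2 g0 by simp
  then have "poly (1 :: 'a poly) x = poly f x * poly g'' x" by (metis poly_mult)
  then show False using fx by simp
qed

lemma nonsing_curve: "P \<in> nonsing W \<Longrightarrow> P \<in> curve_points W"
  by (auto simp: nonsing_def curve_points_def)

text \<open>Acting by the negative of \<open>Q\<close> reduces the claim to a single point whose
  ideal is principal.\<close>

lemma same_class_points:
  assumes P: "P \<in> nonsing W" and Q: "Q \<in> nonsing W" 
    and eq: "same_class W (act W P UNIV) (act W Q UNIV)"
  shows "P = Q"
proof -
  let ?N = "point_neg W Q"
  have N: "?N \<in> nonsing W" using Q by simp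
  have "same_class W (act W (point_add W ?N P) UNIV) (act W ?N (act W P UNIV))"
    using same_class_act_act[OF N P UNIV_ideal] by (rule same_class_sym)
  also have "same_class W (act W ?N (act W P UNIV)) (act W ?N (act W Q UNIV))"
    using eq by (rule same_class_act)
  finally (same_class_trans) have "same_class W (act W (point_add W ?N P) UNIV) (act W ?N (act W Q UNIV))" .
  from same_class_trans[OF this same_class_act_act[OF N Q UNIV_ideal]]
  have "same_class W (act W (point_add W ?N P) UNIV) (act W (point_add W ?N Q) UNIV)" .
  moreover have "point_add W ?N Q = Infinity" by (simp add: point_add_eq_Infinity_iff)
  ultimately have *: "same_class W UNIV (act W (point_add W ?N P) UNIV)"
    using same_class_sym by fastforce
  have "point_add W ?N P = Infinity"
  proof (cases "point_add W ?N P")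
    case (Affine x y)
    moreover have "point_add W ?N P \<in> nonsing W" using N P by (rule point_add_nonsing)
    ultimately have "weierstrass_poly W x y = 0" by (simp add: Affine_nonsing_iff)
    then show ?thesis using * act_Affine_not_principal unfolding Affine by blast
  qed
  then show ?thesis by (simp add: point_add_eq_Infinity_iff)
qed

theorem point_add_assoc:
  assumes P: "P \<in> nonsing W" and Q: "Q \<in> nonsing W" and R: "R \<in> nonsing W"
  shows "point_add W (point_add W P Q) R = point_add W P (point_add W Q R)"
proof (rule same_class_points)
  let ?S = "point_add W P Q" and ?U = "point_add W Q R"
  have S: "?S \<in> nonsing W" and U: "?U \<in> nonsing W" by (simp_all add: assms point_add_nonsing)
  show "point_add W ?S R \<in> nonsing W" "point_add W P ?U \<in> nonsing W"
    by (simp_all add: assms S U point_add_nonsing)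
  have RI: "is_ideal W (act W R UNIV)" by (simp add: act_ideal)
  have 1: "same_class W (act W (point_add W ?S R) UNIV) (act W ?S (act W R UNIV))"
    using same_class_act_act[OF S R UNIV_ideal] by (rule same_class_sym)
  have 2: "same_class W (act W ?S (act W R UNIV)) (act W P (act W Q (act W R UNIV)))"
    using same_class_act_act[OF P Q RI] by (rule same_class_sym)
  have 3: "same_class W (act W P (act W Q (act W R UNIV))) (act W P (act W ?U UNIV))"
    using same_class_act_act[OF Q R UNIV_ideal] by (rule same_class_act)
  have 4: "same_class W (act W P (act W ?U UNIV)) (act W (point_add W P ?U) UNIV)"
    using same_class_act_act[OF P U UNIV_ideal] .
  show "same_class W (act W (point_add W ?S R) UNIV) (act W (point_add W P ?U) UNIV)"
    using 1 2 3 4 same_class_trans by blast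
qed

section \<open>Rational numbers modulo powers of a prime\<close>

text \<open>\<open>pdiv p k r\<close>: the rational number \<open>r\<close> has \<open>p\<close>-adic valuation at least \<open>k\<close>.\<close>

definition pdiv :: "int \<Rightarrow> nat \<Rightarrow> rat \<Rightarrow> bool" where
  "pdiv p k r \<longleftrightarrow> (\<exists>a b. \<not> p dvd b \<and> r * of_int b = of_int (p ^ k * a))"

lemma pdivI: "\<not> p dvd b \<Longrightarrow> r * of_int b = of_int (p ^ k * a) \<Longrightarrow> pdiv p k r"
  unfolding pdiv_def by blast

locale prime_int =
  fixes p :: int
  assumes prime: "prime p"
begin

lemma abs_not_1 [simp]: "\<bar>p\<bar> \<noteq> 1"
  using prime not_prime_unit by auto

lemma not_dvd_mult: "\<not> p dvd b \<Longrightarrow> \<not> p dvd c \<Longrightarrow> \<not> p dvd b * c"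
  using prime by (simp add: prime_dvd_mult_iff)

lemma pdiv_add: assumes "pdiv p k r" "pdiv p k s" shows "pdiv p k (r + s)"
proof -
  obtain a b a' b' where *: "\<not> p dvd b" "\<not> p dvd b'" "r * of_int b = of_int (p ^ k * a)"
    "s * of_int b' = of_int (p ^ k * a')"
    using assms unfolding pdiv_def by blast
  have "(r + s) * of_int (b * b') = (r * of_int b) * of_int b' + (s * of_int b') * of_int b"
    by (simp add: algebra_simps)
  also have "\<dots> = of_int (p ^ k * (a * b' + a' * b))" unfolding *(3,4) by (simp add: algebra_simps)
  finally show ?thesis using not_dvd_mult[OF *(1,2)] by (rule pdivI[rotated])
qed

lemma pdiv_mult: assumes "pdiv p k r" "pdiv p l s" shows "pdiv p (k + l) (r * s)"
proof -
  obtain a b a' b' where *: "\<not> p dvd b" "\<not> p dvd b'" "r * of_int b = of_int (p ^ k * a)"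
    "s * of_int b' = of_int (p ^ l * a')"
    using assms unfolding pdiv_def by blast
  have "(r * s) * of_int (b * b') = (r * of_int b) * (s * of_int b')"
    by (simp add: algebra_simps)
  also have "\<dots> = of_int (p ^ (k + l) * (a * a'))" unfolding *(3,4) by (simp add: algebra_simps power_add)
  finally show ?thesis using not_dvd_mult[OF *(1,2)] by (rule pdivI[rotated])
qed

lemma pdiv_mono: assumes "pdiv p l r" "k \<le> l" shows "pdiv p k r"
proof -
  obtain a b where *: "\<not> p dvd b" "r * of_int b = of_int (p ^ l * a)"
    using assms unfolding pdiv_def by blast
  have "p ^ l * a = p ^ k * (p ^ (l - k) * a)" using assms(2) by (simp flip: mult.assoc power_add)
  then show ?thesis using * by (metis pdivI)
qed

lemma pdiv_fraction:
  assumes "\<not> p dvd b"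
  shows "pdiv p k (of_int a / of_int b) \<longleftrightarrow> p ^ k dvd a"
proof
  have b0: "b \<noteq> 0" using assms by auto
  assume "pdiv p k (of_int a / of_int b)"
  then obtain c d where *: "\<not> p dvd d" "of_int a / of_int b * of_int d = (of_int (p ^ k * c) :: rat)"
    unfolding pdiv_def by blast
  then have "(of_int (a * d) :: rat) = of_int (p ^ k * c * b)" using b0 by (simp add: field_simps)
  then have "a * d = p ^ k * c * b" by (simp only: of_int_eq_iff)
  then have "p ^ k dvd d * a" by (simp add: mult.commute mult.assoc)
  moreover have "coprime (p ^ k) d" using *(1) prime by (simp add: prime_imp_coprime)
  ultimately show "p ^ k dvd a" using coprime_dvd_mult_right_iff by blast
next
  have b0: "b \<noteq> 0" using assms by auto
  assume "p ^ k dvd a"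
  then obtain c where "a = p ^ k * c" by blast
  then show "pdiv p k (of_int a / of_int b)" using b0 assms by (intro pdivI[of p b]) auto
qed

lemma pdiv_of_int_iff: "pdiv p k (of_int a) \<longleftrightarrow> p ^ k dvd a"
  using pdiv_fraction[of 1 k a] by simp

lemma pdiv_minus: "pdiv p k r \<Longrightarrow> pdiv p k (- r)"
  unfolding pdiv_def by (metis mult_minus_left mult_minus_right of_int_minus)

lemma pdiv_diff: "pdiv p k r \<Longrightarrow> pdiv p k s \<Longrightarrow> pdiv p k (r - s)"
  using pdiv_add[of k r "- s"] pdiv_minus by simp

lemma pdiv_zero [simp]: "pdiv p k 0"
  using pdiv_of_int_iff[of k 0] by simp

lemma integral_of_int [simp]: "pdiv p 0 (of_int a)"
  by (simp add: pdiv_of_int_iff)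

lemma integral_numeral [simp]: "pdiv p 0 (numeral n)" "pdiv p 0 1"
  using integral_of_int[of "numeral n"] integral_of_int[of 1] by simp_all

lemma pdiv_scale: "pdiv p 0 c \<Longrightarrow> pdiv p k r \<Longrightarrow> pdiv p k (c * r)"
  "pdiv p 0 c \<Longrightarrow> pdiv p k r \<Longrightarrow> pdiv p k (r * c)"
  using pdiv_mult[of 0 c k r] pdiv_mult[of k r 0 c] by simp_all

lemma integral_power: "pdiv p 0 r \<Longrightarrow> pdiv p 0 (r ^ n)"
  by (induction n) (simp_all add: pdiv_scale)

lemma quotient_pdiv_cases:
  fixes r :: rat
  obtains a b where "r = of_int a / of_int b" "\<not> p dvd b"
  | a b where "r = of_int a / of_int b" "p dvd b" "\<not> p dvd a" "b \<noteq> 0"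
proof -
  obtain a b where ab: "quotient_of r = (a, b)" by fastforce
  have r: "r = of_int a / of_int b" "coprime a b" "b > 0"
    using quotient_of_div[OF ab] quotient_of_coprime[OF ab] quotient_of_denom_pos[OF ab] by auto
  have "\<not> (p dvd a \<and> p dvd b)" using r(2) prime by (meson coprime_common_divisor not_prime_unit)
  then show ?thesis using that r by (cases "p dvd b") auto
qed

lemma pdiv_inverse:
  assumes "pdiv p 0 r" "\<not> pdiv p 1 r"
  shows "pdiv p 0 (inverse r)"
proof (cases r rule: quotient_pdiv_cases)
  case (1 a b)
  then have "\<not> p dvd a" using assms(2) pdiv_fraction[of b 1 a] by simp
  then show ?thesis using pdiv_fraction[of a 0 b] 1 by simp
next
  case (2 a b)
  then have "pdiv p 1 (of_int b / of_int a)" using pdiv_fraction[of a 1 b] by simp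
  moreover have "inverse r = of_int b / of_int a" using 2 by simp
  ultimately have "pdiv p 1 (inverse r * r)" using pdiv_scale(2) assms(1) by metis
  moreover have "a \<noteq> 0" using 2 by auto
  then have "inverse r * r = of_int 1" using 2 by simp
  ultimately have "pdiv p 1 (of_int 1)" by metis
  then show ?thesis unfolding pdiv_of_int_iff by simp
qed

lemma integral_or_inverse: "pdiv p 0 r \<or> r \<noteq> 0 \<and> pdiv p 1 (inverse r)"
proof (cases r rule: quotient_pdiv_cases)
  case (1 a b)
  then show ?thesis using pdiv_fraction[of b 0 a] by simp
next
  case (2 a b)
  then show ?thesis using pdiv_fraction[of a 1 b] by auto
qed

lemma unit_one_plus:
  assumes "pdiv p 1 r"
  shows "1 + r \<noteq> 0" "pdiv p 0 (inverse (1 + r))" "pdiv p 0 (1 + r)"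
proof -
  have n: "\<not> pdiv p 1 (1 + r)"
  proof
    assume "pdiv p 1 (1 + r)"
    then have "pdiv p 1 (1 + r - r)" using assms by (rule pdiv_diff)
    then show False using pdiv_of_int_iff[of 1 1] by simp
  qed
  then show "1 + r \<noteq> 0" by auto
  show i: "pdiv p 0 (1 + r)" by (intro pdiv_add pdiv_mono[OF assms]) auto
  show "pdiv p 0 (inverse (1 + r))" by (intro pdiv_inverse i n)
qed

text \<open>The local ring at \<open>p\<close> is integrally closed: dividing the equation by a
  nonintegral \<open>r\<close> would express \<open>r\<close> through integral quantities.\<close>

lemma integral_root:
  assumes "r^2 + b * r + c = 0" "pdiv p 0 b" "pdiv p 0 c"
  shows "pdiv p 0 r"
proof (rule ccontr)
  assume "\<not> pdiv p 0 r"
  then have r: "r \<noteq> 0" "pdiv p 0 (inverse r)" using integral_or_inverse pdiv_mono by auto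
  have "r = - b - c * inverse r" using assms(1) r(1) by (simp add: field_simps power2_eq_square)
  moreover have "pdiv p 0 (- b - c * inverse r)" by (intro pdiv_diff pdiv_minus pdiv_scale assms r)
  ultimately show False using \<open>\<not> pdiv p 0 r\<close> by simp
qed

lemma integral_iff_denominator: "pdiv p 0 r \<longleftrightarrow> \<not> p dvd snd (quotient_of r)"
proof -
  obtain a b where ab: "quotient_of r = (a, b)" by fastforce
  have r: "r = of_int a / of_int b" "coprime a b" "b > 0"
    using quotient_of_div[OF ab] quotient_of_coprime[OF ab] quotient_of_denom_pos[OF ab] by auto
  show ?thesis
  proof (cases "p dvd b")
    case True
    then have a: "\<not> p dvd a" using r(2) prime by (meson coprime_common_divisor not_prime_unit)
    have "\<not> pdiv p 0 r"
    proof
      assume "pdiv p 0 r"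
      moreover have "pdiv p 1 (of_int b / of_int a)" using pdiv_fraction[OF a] True by simp
      ultimately have "pdiv p 1 (r * (of_int b / of_int a))" using pdiv_scale(1) by blast
      moreover have "a \<noteq> 0" using a by auto
      then have "r * (of_int b / of_int a) = of_int 1" using r(3) by (simp add: r(1))
      ultimately have "pdiv p 1 (of_int 1)" by metis
      then show False unfolding pdiv_of_int_iff by simp
    qed
    then show ?thesis using True ab by simp
  next
    case False
    then show ?thesis using pdiv_fraction[of b 0 a] r ab by simp
  qed
qed

end

subsection \<open>Rational points of an integral Weierstrass equation\<close>

text \<open>
  With \<open>x = a / b\<close> and \<open>y = c / e\<close> in lowest terms, comparing denominators
  in the equation gives \<open>e\<^sup>2 = b\<^sup>3\<close>.
\<close>

lemma rational_point_shape:
  fixes W :: "int weierstrass"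
  assumes "weierstrass_poly (over_rat W) x y = 0"
  obtains a c d :: int where "d > 0" "coprime a d" "coprime c d"
    "x = of_int a / of_int d ^ 2" "y = of_int c / of_int d ^ 3"
proof -
  obtain a b where ab: "quotient_of x = (a, b)" by fastforce
  have x: "x = of_int a / of_int b" "coprime a b" "b > 0"
    using quotient_of_div[OF ab] quotient_of_coprime[OF ab] quotient_of_denom_pos[OF ab] by auto
  obtain c e where ce: "quotient_of y = (c, e)" by fastforce
  have y: "y = of_int c / of_int e" "coprime c e" "e > 0"
    using quotient_of_div[OF ce] quotient_of_coprime[OF ce] quotient_of_denom_pos[OF ce] by auto
  define G where "G = a^3 + wa2 W * a^2 * b + wa4 W * a * b^2 + wa6 W * b^3"
  have eq: "y^2 + of_int (wa1 W) * x * y + of_int (wa3 W) * y =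
      x^3 + of_int (wa2 W) * x^2 + of_int (wa4 W) * x + of_int (wa6 W)"
    using assms by (simp add: weierstrass_poly_def weierstrass.map_sel)
  have xb: "x * of_int b = of_int a" and ye: "y * of_int e = of_int c" using x y by auto
  have "(of_int (b^3 * c^2 + wa1 W * a * b^2 * c * e + wa3 W * b^3 * c * e) :: rat) =
      of_int b ^ 3 * of_int e ^ 2 * (y^2 + of_int (wa1 W) * x * y + of_int (wa3 W) * y)"
    unfolding of_int_add of_int_mult of_int_power xb[symmetric] ye[symmetric]
    by (simp add: algebra_simps power2_eq_square power3_eq_cube)
  also have "\<dots> = of_int (e^2 * G)"
    unfolding eq G_def of_int_add of_int_mult of_int_power xb[symmetric]
    by (simp add: algebra_simps power2_eq_square power3_eq_cube)
  finally have E: "b^3 * c^2 + wa1 W * a * b^2 * c * e + wa3 W * b^3 * c * e = e^2 * G"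
    by (simp only: of_int_eq_iff)
  \<comment> \<open>Modulo \<open>b\<close> the form \<open>G\<close> is \<open>a^3\<close>, a unit;
    this is what moves all powers of \<open>b\<close> over to \<open>e\<close>.\<close>
  have "G = a^3 + b * (wa2 W * a^2 + wa4 W * a * b + wa6 W * b^2)"
    by (simp add: G_def algebra_simps power2_eq_square power3_eq_cube)
  then have G: "coprime b G" using x(2)
    by (metis coprime_commute coprime_mult_self_right_iff coprime_power_right_iff gcd_add_mult coprime_iff_gcd_eq_1 add.commute mult.commute)
  have "b^2 dvd b^3 * c^2 + wa1 W * a * b^2 * c * e + wa3 W * b^3 * c * e"
    by (intro dvd_add) (auto simp: power2_eq_square power3_eq_cube)
  then have "b^2 dvd G * e^2" unfolding E by (simp add: mult.commute)
  then have "b^2 dvd e^2" using G by (metis coprime_dvd_mult_right_iff coprime_power_left_iff)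
  then have "b dvd e" by simp
  then obtain f where f: "e = b * f" by blast
  have f0: "f > 0" using f x y by (simp add: zero_less_mult_iff)
  have "b^2 * (b * (c^2 + wa1 W * a * c * f + wa3 W * c * e)) = b^2 * (f^2 * G)"
    using E unfolding f by (simp add: algebra_simps power2_eq_square power3_eq_cube)
  then have E2: "b * (c^2 + wa1 W * a * c * f + wa3 W * c * e) = f^2 * G" using x(3) by simp
  have "b dvd G * f^2" using E2 by (metis dvd_triv_left mult.commute)
  then have "b dvd f^2" using G by (metis coprime_dvd_mult_right_iff)
  then obtain g where g: "f^2 = b * g" by blast
  \<comment> \<open>From \<open>f^2 = b * g\<close>, a prime factor of \<open>g\<close> divides
    \<open>f\<close> and hence \<open>e\<close>, and then also \<open>c\<close>, contrary to lowest
    terms.\<close>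
  have "g = 1"
  proof (rule ccontr)
    assume "g \<noteq> 1"
    have "g > 0" using g f0 x(3) by (metis zero_less_mult_pos zero_less_power)
    then obtain q where q: "prime q" "q dvd g" using \<open>g \<noteq> 1\<close> prime_factor_int[of g] by auto
    have "b * (c^2 + wa1 W * a * c * f + wa3 W * c * e) = b * (g * G)" using E2 g by simp
    then have E3: "c^2 + wa1 W * a * c * f + wa3 W * c * e = g * G" using x(3) by simp
    have "q dvd f^2" using q(2) g by simp
    then have qf: "q dvd f" using q(1) prime_dvd_power by blast
    then have qe: "q dvd e" using f by simp
    have "c^2 = g * G - wa1 W * a * c * f - wa3 W * c * e" using E3 by simp
    then have "q dvd c^2" using qf qe q(2) by simp
    then have "q dvd c" using q(1) prime_dvd_power by blast
    then show False using qe y(2) q(1) by (meson coprime_common_divisor not_prime_unit)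
  qed
  then have b: "b = f^2" using g by simp
  then have e: "e = f^3" using f by (simp add: power2_eq_square power3_eq_cube)
  show ?thesis
  proof
    show "f > 0" by (rule f0)
    show "coprime a f" using x(2) b by simp
    show "coprime c f" using y(2) e by simp
  qed (simp_all add: x y b e)
qed

subsection \<open>Reduction to the prime field\<close>

definition red :: "rat \<Rightarrow> 'a::prime_card mod_ring" where
  "red r = (case quotient_of r of (a, b) \<Rightarrow> of_int a / of_int b)"

lemma of_int_mod_ring_eq_0_iff: "(of_int b :: 'a::prime_card mod_ring) = 0 \<longleftrightarrow> int CARD('a) dvd b"
  unfolding of_int_of_int_mod_ring by transfer (simp add: dvd_eq_mod_eq_0)

text \<open>\<open>rd\<close> is a parameter, though equal to \<open>red\<close>, in order to fix
  the residue type \<open>'a\<close> for the whole locale.\<close>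

locale prime_field = prime_int +
  fixes rd :: "rat \<Rightarrow> 'a::prime_card mod_ring"
  assumes p_eq: "p = int CARD('a)" and rd_eq: "rd = red"
begin

lemma of_int_eq_0_iff': "(of_int b :: 'a mod_ring) = 0 \<longleftrightarrow> p dvd b"
  by (simp add: of_int_mod_ring_eq_0_iff p_eq)

lemma red_eq:
  assumes "\<not> p dvd b" "r * of_int b = of_int a"
  shows "rd r = of_int a / of_int b"
proof -
  obtain c d where cd: "quotient_of r = (c, d)" by fastforce
  have r: "r = of_int c / of_int d" "d > 0"
    using quotient_of_div[OF cd] quotient_of_denom_pos[OF cd] by auto
  have "b \<noteq> 0" using assms by auto
  then have "r = of_int a / of_int b" using assms(2) by (simp add: eq_divide_eq)
  then have "pdiv p 0 r" using assms(1) pdiv_fraction[of b 0 a] by simp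
  then have d: "\<not> p dvd d" unfolding integral_iff_denominator cd by simp
  have "of_int (c * b) = (of_int (a * d) :: rat)" using assms(2) r by (simp add: field_simps)
  then have "c * b = a * d" by (simp only: of_int_eq_iff)
  then have "(of_int c :: 'a mod_ring) * of_int b = of_int a * of_int d" by (metis of_int_mult)
  then show ?thesis unfolding rd_eq red_def cd using assms(1) d
    by (simp add: of_int_eq_0_iff' field_simps)
qed

lemma integral_obtain:
  assumes "pdiv p 0 r"
  obtains a b where "\<not> p dvd b" "r * of_int b = of_int a" "rd r = of_int a / of_int b" "rd r * of_int b = of_int a" "(of_int b :: 'a mod_ring) \<noteq> 0"
proof -
  obtain a b where "\<not> p dvd b" "r * of_int b = of_int a" using assms unfolding pdiv_def by auto
  then show ?thesis using that red_eq[of b r a] by (simp add: of_int_eq_0_iff')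
qed

lemma red_of_int [simp]: "rd (of_int a) = of_int a"
  using red_eq[of 1 "of_int a" a] by simp

lemma red_simps [simp]: "rd 0 = 0" "rd 1 = 1" "rd (numeral n) = numeral n"
  using red_of_int[of 0] red_of_int[of 1] red_of_int[of "numeral n"] by simp_all

lemma red_add: assumes "pdiv p 0 r" "pdiv p 0 s" shows "rd (r + s) = rd r + rd s"
proof -
  from assms(1) obtain a b where 1: "\<not> p dvd b" "r * of_int b = of_int a" "rd r = of_int a / of_int b" "rd r * of_int b = of_int a"  "(of_int b :: 'a mod_ring) \<noteq> 0"
    by (rule integral_obtain)
  from assms(2) obtain c d where 2: "\<not> p dvd d" "s * of_int d = of_int c" "rd s = of_int c / of_int d" "rd s * of_int d = of_int c"  "(of_int d :: 'a mod_ring) \<noteq> 0"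
    by (rule integral_obtain)
  have "(r + s) * of_int (b * d) = (r * of_int b) * of_int d + (s * of_int d) * of_int b"
    by (simp add: algebra_simps)
  also have "\<dots> = of_int (a * d + c * b)" unfolding 1(2) 2(2) by simp
  finally have "rd (r + s) = of_int (a * d + c * b) / of_int (b * d)"
    using not_dvd_mult[OF 1(1) 2(1)] by (rule red_eq[rotated])
  then show ?thesis unfolding 1(3) 2(3) by (simp add: add_frac_eq[OF 1(5) 2(5)])
qed

lemma red_mult: assumes "pdiv p 0 r" "pdiv p 0 s" shows "rd (r * s) = rd r * rd s"
proof -
  from assms(1) obtain a b where 1: "\<not> p dvd b" "r * of_int b = of_int a" "rd r = of_int a / of_int b" "rd r * of_int b = of_int a"  "(of_int b :: 'a mod_ring) \<noteq> 0"
    by (rule integral_obtain)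
  from assms(2) obtain c d where 2: "\<not> p dvd d" "s * of_int d = of_int c" "rd s = of_int c / of_int d" "rd s * of_int d = of_int c"  "(of_int d :: 'a mod_ring) \<noteq> 0"
    by (rule integral_obtain)
  have "(r * s) * of_int (b * d) = (r * of_int b) * (s * of_int d)"
    by (simp add: algebra_simps)
  also have "\<dots> = of_int (a * c)" unfolding 1(2) 2(2) by simp
  finally have "rd (r * s) = of_int (a * c) / of_int (b * d)"
    using not_dvd_mult[OF 1(1) 2(1)] by (rule red_eq[rotated])
  then show ?thesis unfolding 1(3) 2(3) by simp
qed

lemma red_minus: assumes "pdiv p 0 r" shows "rd (- r) = - rd r"
  using red_mult[OF integral_of_int[of "- 1"] assms] red_of_int[of "- 1"] by simp

lemma red_diff: assumes "pdiv p 0 r" "pdiv p 0 s" shows "rd (r - s) = rd r - rd s"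
  using red_add[of r "- s"] assms red_minus pdiv_minus by simp

lemma red_power: assumes "pdiv p 0 r" shows "rd (r ^ n) = rd r ^ n"
  using assms by (induction n) (simp_all add: red_mult integral_power)

lemma red_eq_0_iff: assumes "pdiv p 0 r" shows "rd r = 0 \<longleftrightarrow> pdiv p 1 r"
proof -
  from assms obtain a b where 1: "\<not> p dvd b" "r * of_int b = of_int a" "rd r = of_int a / of_int b" "(of_int b :: 'a mod_ring) \<noteq> 0"
    by (rule integral_obtain)
  have "b \<noteq> 0" using 1(1) by auto
  then have "r = of_int a / of_int b" using 1(2) by (simp add: eq_divide_eq)
  then have "pdiv p 1 r \<longleftrightarrow> p dvd a" using pdiv_fraction[OF 1(1), of 1 a] by simp
  then show ?thesis using 1 by (simp add: of_int_eq_0_iff')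
qed

end

subsection \<open>The formal group\<close>

text \<open>
  Near the point at infinity the coordinates \<open>z = - x / y\<close> and \<open>w = - 1 / y\<close> are used;
  the line \<open>y = l x + m\<close> becomes \<open>w = \<lambda> z + \<nu>\<close> with
  \<open>\<lambda> = - l / m\<close> and \<open>\<nu> = - 1 / m\<close>.
\<close>

lemma weierstrass_at_infinity:
  fixes V :: "'a::field_char_0 weierstrass"
  assumes "weierstrass_poly V x y = 0" "y \<noteq> 0" "z = - x / y" "w = - 1 / y"
  shows "w = z^3 + wa1 V * z * w + wa2 V * z^2 * w + wa3 V * w^2 + wa4 V * z * w^2 + wa6 V * w^3"
proof -
  have xw: "x * w = z" and yw: "y * w = - 1" using assms(2-4) by auto
  have "w^3 * (y^2 + wa1 V * x * y + wa3 V * y) = w^3 * (x^3 + wa2 V * x^2 + wa4 V * x + wa6 V)"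
    using assms(1) by (simp add: weierstrass_poly_def)
  moreover have "w^3 * (y^2 + wa1 V * x * y + wa3 V * y) = w * (y * w)^2 + wa1 V * (x * w) * (y * w) * w + wa3 V * (y * w) * w^2"
    by Groebner_Basis.algebra
  moreover have "w^3 * (x^3 + wa2 V * x^2 + wa4 V * x + wa6 V) = 
    (x * w)^3 + wa2 V * (x * w)^2 * w + wa4 V * (x * w) * w^2 + wa6 V * w^3"
    by Groebner_Basis.algebra
  ultimately show ?thesis unfolding xw yw by Groebner_Basis.algebra
qed

text \<open>Subtracting the two equations in \<open>z\<close> and \<open>w\<close> gives
  \<open>(w1 - w2) * den = (z1 - z2) * num\<close>, so \<open>num / den\<close> is the slope in
  these coordinates. For equal points this is vacuous, and the tangent slope is compared with the
  partial derivatives instead. The form without quotients later yields \<open>m \<noteq> 0\<close>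
  as well.\<close>

lemma slope_at_infinity:
  fixes V :: "'a::field_char_0 weierstrass"
  assumes P: "weierstrass_poly V x1 y1 = 0" "y1 \<noteq> 0" and Q: "weierstrass_poly V x2 y2 = 0" "y2 \<noteq> 0"
    and y: "y1 = l * x1 + m" "y2 = l * x2 + m"
    and alt: "x1 \<noteq> x2 \<and> l * (x2 - x1) = y2 - y1 \<or>
     x1 = x2 \<and> y1 = y2 \<and> weierstrass_poly_dy V x1 y1 \<noteq> 0 \<and>
     weierstrass_poly_dy V x1 y1 * l = - weierstrass_poly_dx V x1 y1"
    and z: "z1 = - x1 / y1" "z2 = - x2 / y2" and w: "w1 = - 1 / y1" "w2 = - 1 / y2"
    and den: "den = 1 - (wa1 V * z2 + wa2 V * z2^2 + wa3 V * (w1 + w2) + wa4 V * z2 * (w1 + w2)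
       + wa6 V * (w1^2 + w1 * w2 + w2^2))" "den \<noteq> 0"
    and num: "num = z1^2 + z1 * z2 + z2^2 + wa1 V * w1 + wa2 V * (z1 + z2) * w1 + wa4 V * w1^2"
  shows "l * den + m * num = 0"
  using alt
proof
  assume a: "x1 \<noteq> x2 \<and> l * (x2 - x1) = y2 - y1"
  have e1: "w1 = z1^3 + wa1 V * z1 * w1 + wa2 V * z1^2 * w1 + wa3 V * w1^2 + wa4 V * z1 * w1^2 + wa6 V * w1^3"
    by (rule weierstrass_at_infinity[OF P z(1) w(1)])
  have e2: "w2 = z2^3 + wa1 V * z2 * w2 + wa2 V * z2^2 * w2 + wa3 V * w2^2 + wa4 V * z2 * w2^2 + wa6 V * w2^3"
    by (rule weierstrass_at_infinity[OF Q z(2) w(2)])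
  have d: "(w1 - w2) * den = (z1 - z2) * num"
  proof -
    have "(w1 - w2) * den - (z1 - z2) * num = 
      (w1 - (z1^3 + wa1 V * z1 * w1 + wa2 V * z1^2 * w1 + wa3 V * w1^2 + wa4 V * z1 * w1^2 + wa6 V * w1^3))
      - (w2 - (z2^3 + wa1 V * z2 * w2 + wa2 V * z2^2 * w2 + wa3 V * w2^2 + wa4 V * z2 * w2^2 + wa6 V * w2^3))"
      unfolding den num by Groebner_Basis.algebra
    then show ?thesis using e1 e2 by simp
  qed
  have mw: "m * w1 = - 1 - l * z1" "m * w2 = - 1 - l * z2"
    using P(2) Q(2) unfolding z w by (auto simp: y field_simps)
  have "z1 \<noteq> z2"
  proof
    assume "z1 = z2"
    then have "w1 = w2" using d den(2) by simp
    then have "y1 = y2" using w P(2) Q(2) by simp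
    then show False using \<open>z1 = z2\<close> z P(2) a by simp
  qed
  moreover have "(z1 - z2) * (l * den + m * num) = 0"
  proof -
    have "m * (w1 - w2) = - l * (z1 - z2)" using mw by (simp add: algebra_simps)
    then have "- l * (z1 - z2) * den = m * ((z1 - z2) * num)" using d by (metis mult.assoc)
    then show ?thesis by Groebner_Basis.algebra
  qed
  ultimately show ?thesis by simp
next
  assume a: "x1 = x2 \<and> y1 = y2 \<and> weierstrass_poly_dy V x1 y1 \<noteq> 0 \<and>
     weierstrass_poly_dy V x1 y1 * l = - weierstrass_poly_dx V x1 y1"
  have zw: "x1 = - (z1 * y1)" "w1 * y1 = - 1" using z w P(2) by auto
  have e: "z2 = z1" "w2 = w1" using a z w by auto
  have num': "num * y1^2 = - weierstrass_poly_dx V x1 y1"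
  proof -
    have "num * y1^2 = 3 * (z1 * y1)^2 + wa1 V * (w1 * y1) * y1 + 2 * wa2 V * (z1 * y1) * (w1 * y1) + wa4 V * (w1 * y1)^2"
      unfolding num e by Groebner_Basis.algebra
    also have "z1 * y1 = - x1" using zw(1) by simp
    finally show ?thesis unfolding zw(2) weierstrass_poly_dx_def by Groebner_Basis.algebra
  qed
  have den': "den * y1^2 + x1 * weierstrass_poly_dx V x1 y1 = - (y1 * weierstrass_poly_dy V x1 y1)"
  proof -
    have "den * y1^2 = y1^2 - (wa1 V * (z1 * y1) * y1 + wa2 V * (z1 * y1)^2 + 2 * wa3 V * (w1 * y1) * y1
       + 2 * wa4 V * (z1 * y1) * (w1 * y1) + 3 * wa6 V * (w1 * y1)^2)"
      unfolding den e by Groebner_Basis.algebra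
    also have "z1 * y1 = - x1" using zw(1) by simp
    finally show ?thesis using P(1)
      unfolding zw(2) weierstrass_poly_dx_def weierstrass_poly_dy_def weierstrass_poly_def
      by Groebner_Basis.algebra
  qed
  have m: "m = y1 - l * x1" using y by simp
  have "(l * den + m * num) * y1^2 = l * (den * y1^2) + m * (num * y1^2)" by Groebner_Basis.algebra
  also have "\<dots> = l * (den * y1^2 + x1 * weierstrass_poly_dx V x1 y1) - y1 * weierstrass_poly_dx V x1 y1"
    unfolding num' m by Groebner_Basis.algebra
  also have "\<dots> = - y1 * (weierstrass_poly_dy V x1 y1 * l) - y1 * weierstrass_poly_dx V x1 y1"
    unfolding den' by Groebner_Basis.algebra
  also have "weierstrass_poly_dy V x1 y1 * l = - weierstrass_poly_dx V x1 y1" using a by blast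
  finally show ?thesis using P(2) by simp
qed

text \<open>Vieta for the cubic in \<open>z\<close> obtained by inserting
  \<open>w = lam * z + nu\<close> into the equation at infinity: \<open>c\<close> is its leading
  coefficient and the bracket its coefficient of \<open>z^2\<close>.\<close>

lemma sum_at_infinity:
  fixes V :: "'a::field_char_0 weierstrass"
  assumes line: "line_through V l m x1 x2 x3" and m: "m \<noteq> 0" 
    and lam: "lam = - l / m" and nu: "nu = - 1 / m"
    and c: "c = 1 + wa2 V * lam + wa4 V * lam^2 + wa6 V * lam^3" "c \<noteq> 0"
    and y: "y1 = l * x1 + m" "y2 = l * x2 + m" "y3 = l * x3 + m"
  shows "y3 \<noteq> 0" and
    "(- x1 / y1) + (- x2 / y2) + (- x3 / y3) = 
      - (wa1 V * lam + wa2 V * nu + wa3 V * lam^2 + 2 * wa4 V * lam * nu + 3 * wa6 V * lam^2 * nu) / c"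
proof -
  have a: "wa2 V = l^2 + wa1 V * l - (x1 + x2 + x3)"
    "wa4 V = x1 * x2 + x1 * x3 + x2 * x3 + 2 * l * m + wa1 V * m + wa3 V * l"
    "wa6 V = m^2 + wa3 V * m - x1 * x2 * x3"
    using line unfolding line_through_def by (auto simp: algebra_simps)
  have lm: "l = - (lam * m)" using lam m by simp
  have nm: "nu * m = - 1" using nu m by simp
  have 1: "y1 * y2 * y3 = m^3 * c"
  proof -
    have "m^3 * c = m^3 + wa2 V * m^2 * (lam * m) + wa4 V * m * (lam * m)^2 + wa6 V * (lam * m)^3"
      unfolding c by Groebner_Basis.algebra
    also have "lam * m = - l" using lm by simp
    finally show ?thesis unfolding y a by Groebner_Basis.algebra
  qed
  then have n: "y1 \<noteq> 0" "y2 \<noteq> 0" "y3 \<noteq> 0" using m c(2) by (metis mult_eq_0_iff power_not_zero)+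
  then show "y3 \<noteq> 0" by blast
  define t where "t = wa1 V * lam + wa2 V * nu + wa3 V * lam^2 + 2 * wa4 V * lam * nu + 3 * wa6 V * lam^2 * nu"
  have 2: "x1 * y2 * y3 + x2 * y1 * y3 + x3 * y1 * y2 = m^3 * t"
  proof -
    have "m^3 * t = wa1 V * (lam * m) * m^2 + wa2 V * (nu * m) * m^2 + wa3 V * (lam * m)^2 * m
      + 2 * wa4 V * (lam * m) * (nu * m) * m + 3 * wa6 V * (lam * m)^2 * (nu * m)"
      unfolding t_def by Groebner_Basis.algebra
    also have "lam * m = - l" using lm by simp
    finally show ?thesis unfolding nm y a by Groebner_Basis.algebra
  qed
  have "(- x1 / y1) + (- x2 / y2) + (- x3 / y3) = - (x1 * y2 * y3 + x2 * y1 * y3 + x3 * y1 * y2) / (y1 * y2 * y3)"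
    using n by (simp add: field_simps)
  also have "\<dots> = - t / c" unfolding 1 2 using m by simp
  finally show "(- x1 / y1) + (- x2 / y2) + (- x3 / y3) = - (wa1 V * lam + wa2 V * nu + wa3 V * lam^2 + 2 * wa4 V * lam * nu + 3 * wa6 V * lam^2 * nu) / c"
    unfolding t_def .
qed

section \<open>The filtration by powers of p near the point at infinity\<close>

fun zcoord :: "rat point \<Rightarrow> rat" where
  "zcoord Infinity = 0"
| "zcoord (Affine x y) = - x / y"

text \<open>A small \<open>z\<close> alone would also admit points such as those with
  \<open>x = 0\<close>; the condition on \<open>w = - 1 / y\<close> restricts to the neighbourhood
  of infinity, where \<open>w\<close> has the order of \<open>z^3\<close>.\<close>

definition kernel_level :: "int \<Rightarrow> nat \<Rightarrow> rat point set" where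
  "kernel_level p k = insert Infinity {Affine x y | x y. y \<noteq> 0 \<and> pdiv p k (- x / y) \<and> pdiv p (3 * k) (- 1 / y)}"

lemma Affine_kernel_level: "Affine x y \<in> kernel_level p k \<longleftrightarrow> y \<noteq> 0 \<and> pdiv p k (- x / y) \<and> pdiv p (3 * k) (- 1 / y)"
  by (auto simp: kernel_level_def)

lemma Infinity_kernel_level [simp]: "Infinity \<in> kernel_level p k"
  by (simp add: kernel_level_def)

context prime_int
begin

lemma pdiv_mult2: "pdiv p k r \<Longrightarrow> pdiv p k s \<Longrightarrow> pdiv p (2 * k) (r * s)"
  using pdiv_mult[of k r k s] by (simp add: mult_2)

lemma pdiv_scale_mono: 
  "l \<le> k \<Longrightarrow> pdiv p 0 c \<Longrightarrow> pdiv p k r \<Longrightarrow> pdiv p l (c * r)"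
  "l \<le> k \<Longrightarrow> pdiv p 0 c \<Longrightarrow> pdiv p k r \<Longrightarrow> pdiv p l (r * c)"
  using pdiv_scale pdiv_mono by blast+

context
  fixes W :: "int weierstrass" and k :: nat
  assumes k: "k \<ge> 1"
begin

lemma wa_over_rat [simp]:
  "wa1 (over_rat W) = of_int (wa1 W)" "wa2 (over_rat W) = of_int (wa2 W)" "wa3 (over_rat W) = of_int (wa3 W)"
  "wa4 (over_rat W) = of_int (wa4 W)" "wa6 (over_rat W) = of_int (wa6 W)"
  by (simp_all add: weierstrass.map_sel)

lemma kernel_level_neg:
  assumes "P \<in> kernel_level p k"
  shows "point_neg (over_rat W) P \<in> kernel_level p k"
    "pdiv p (2 * k) (zcoord (point_neg (over_rat W) P) + zcoord P)"
proof -
  have "point_neg (over_rat W) P \<in> kernel_level p k \<and>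
    pdiv p (2 * k) (zcoord (point_neg (over_rat W) P) + zcoord P)"
  proof (cases P)
    case (Affine x y)
    define z w where "z = - x / y" and "w = - 1 / y"
    have y: "y \<noteq> 0" and z: "pdiv p k z" and w: "pdiv p (3 * k) w"
      using assms by (auto simp: Affine Affine_kernel_level z_def w_def)
    \<comment> \<open>Chosen so that the negative has ordinate \<open>- y * (1 + r)\<close>; as
      \<open>r\<close> is divisible by \<open>p\<close>, the factor \<open>1 + r\<close> is a
      unit.\<close>
    define r where "r = - of_int (wa1 W) * z - of_int (wa3 W) * w"
    have r: "pdiv p k r" unfolding r_def
      by (intro pdiv_diff pdiv_scale_mono(1)[OF _ _ w] pdiv_scale_mono(1)[OF _ _ z] pdiv_minus) auto
    have r1: "pdiv p 1 r" using pdiv_mono[OF r k] .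
    note u = unit_one_plus[OF r1]
    define y' where "y' = - y - of_int (wa1 W) * x - of_int (wa3 W)"
    have y': "y' = - y * (1 + r)" using y by (simp add: y'_def r_def z_def w_def field_simps)
    have neg: "point_neg (over_rat W) P = Affine x y'" by (simp add: Affine y'_def)
    have z': "- x / y' = - (z * inverse (1 + r))" and w': "- 1 / y' = - (w * inverse (1 + r))"
      unfolding y' z_def w_def divide_inverse inverse_mult_distrib by simp_all
    have "pdiv p (2 * k) (z * r * inverse (1 + r))"
      by (intro pdiv_scale(2) u pdiv_mult2 z r)
    moreover have "- x / y' + z = z * r * inverse (1 + r)" unfolding z' using u(1) by (simp add: field_simps)
    moreover have "pdiv p k (- x / y')" unfolding z' by (intro pdiv_minus pdiv_scale(2) u z)
    moreover have "pdiv p (3 * k) (- 1 / y')" unfolding w' by (intro pdiv_minus pdiv_scale(2) u w)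
    moreover have "y' \<noteq> 0" using y' u(1) y by simp
    moreover have "zcoord (point_neg (over_rat W) P) + zcoord P = - x / y' + z"
      unfolding neg by (simp add: Affine z_def)
    ultimately show ?thesis unfolding neg Affine_kernel_level by simp
  qed auto
  then show "point_neg (over_rat W) P \<in> kernel_level p k"
    "pdiv p (2 * k) (zcoord (point_neg (over_rat W) P) + zcoord P)" by auto
qed

text \<open>The slope \<open>lam\<close> is \<open>num / den\<close> with \<open>den\<close> a unit
  and \<open>num\<close> of order \<open>2 * k\<close>, so the intercept
  \<open>nu = w1 - lam * z1\<close> has order \<open>3 * k\<close>. Vieta then gives order
  \<open>2 * k\<close> to the sum of the three \<open>z\<close> on the line, and negating the third
  point turns its \<open>z\<close> into \<open>- z\<close> up to the same order.\<close>

lemma kernel_level_add: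
  assumes P: "P \<in> curve_points (over_rat W)" "P \<in> kernel_level p k" 
    and Q: "Q \<in> curve_points (over_rat W)" "Q \<in> kernel_level p k"
  shows "point_add (over_rat W) P Q \<in> kernel_level p k \<and>
    pdiv p (2 * k) (zcoord (point_add (over_rat W) P Q) - zcoord P - zcoord Q)"
proof (cases P; cases Q)
  fix x1 y1 x2 y2 assume PQ: "P = Affine x1 y1" "Q = Affine x2 y2"
  let ?V = "over_rat W"
  show ?thesis
  proof (cases "point_add ?V P Q")
    case Infinity
    then have "Q = point_neg ?V P" by (simp add: point_add_eq_Infinity_iff)
    then have "pdiv p (2 * k) (- (zcoord Q + zcoord P))" using kernel_level_neg(2)[OF P(2)] pdiv_minus by blast
    then show ?thesis using Infinity by (simp add: algebra_simps)
  next
    case (Affine x3 y3)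
    have wp: "weierstrass_poly ?V x1 y1 = 0" "weierstrass_poly ?V x2 y2 = 0"
      using P Q PQ by (auto simp: curve_points_def)
    obtain l m where y: "y1 = l * x1 + m" "y2 = l * x2 + m" "y3 = - (l * x3 + m) - wa1 ?V * x3 - wa3 ?V"
      and line: "line_through ?V l m x1 x2 x3" and
      alt: "x1 \<noteq> x2 \<and> l * (x2 - x1) = y2 - y1 \<or>
       x1 = x2 \<and> y1 = y2 \<and> weierstrass_poly_dy ?V x1 y1 \<noteq> 0 \<and>
       weierstrass_poly_dy ?V x1 y1 * l = - weierstrass_poly_dx ?V x1 y1"
      using point_add_line[OF wp Affine[unfolded PQ]] .
    define z1 z2 w1 w2 where z: "z1 = - x1 / y1" "z2 = - x2 / y2" and w: "w1 = - 1 / y1" "w2 = - 1 / y2"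
    have y0: "y1 \<noteq> 0" "y2 \<noteq> 0" and zk: "pdiv p k z1" "pdiv p k z2" and wk: "pdiv p (3 * k) w1" "pdiv p (3 * k) w2"
      using P(2) Q(2) by (auto simp: PQ Affine_kernel_level z w)
    have z0: "pdiv p 0 z1" "pdiv p 0 z2" "pdiv p 0 w1" "pdiv p 0 w2"
      using zk wk pdiv_mono[of _ _ 0] by blast+
    have zz: "pdiv p 1 z1" "pdiv p 1 z2" "pdiv p 1 w1" "pdiv p 1 w2"
      using pdiv_mono[OF _ k] zk pdiv_mono[OF wk(1), of 1] pdiv_mono[OF wk(2), of 1] k by auto
    have w2k: "pdiv p (2 * k) w1" "pdiv p (2 * k) w2" using pdiv_mono[OF wk(1)] pdiv_mono[OF wk(2)] by auto
    define e where "e = - (wa1 ?V * z2 + wa2 ?V * z2^2 + wa3 ?V * (w1 + w2) + wa4 ?V * z2 * (w1 + w2)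
       + wa6 ?V * (w1^2 + w1 * w2 + w2^2))"
    define den where "den = 1 + e"
    define num where "num = z1^2 + z1 * z2 + z2^2 + wa1 ?V * w1 + wa2 ?V * (z1 + z2) * w1 + wa4 ?V * w1^2"
    have e: "pdiv p 1 e" unfolding e_def wa_over_rat power2_eq_square
      by (intro pdiv_minus pdiv_add pdiv_scale zz z0 integral_of_int)
    note u = unit_one_plus[OF e, folded den_def]
    have num: "pdiv p (2 * k) num" unfolding num_def wa_over_rat power2_eq_square
      by (intro pdiv_add pdiv_mult2 zk pdiv_scale(1)[OF _ w2k(1)] pdiv_scale(1)[OF _ pdiv_scale(1)[OF _ w2k(1)]] pdiv_scale(1)[OF integral_of_int] z0 integral_of_int)
    have key: "l * den + m * num = 0"
      by (rule slope_at_infinity[OF wp(1) y0(1) wp(2) y0(2) y(1,2) alt z w _ _ num_def])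
        (use u in \<open>simp_all add: den_def e_def\<close>)
    have m: "m \<noteq> 0"
    proof
      assume "m = 0"
      then have "l = 0" using key u by simp
      then show False using y(1) y0 \<open>m = 0\<close> by simp
    qed
    define lam nu where "lam = - l / m" and "nu = - 1 / m"
    have "lam = num * inverse den" using key m u(1) unfolding lam_def by (simp add: field_simps eq_neg_iff_add_eq_0)
    then have lam: "pdiv p (2 * k) lam" using num u pdiv_scale by simp
    have "m * w1 = - 1 - l * z1" using y0(1) unfolding w z by (auto simp: y field_simps)
    then have "w1 = lam * z1 + nu" unfolding lam_def nu_def using m by (simp add: field_simps)
    then have "nu = w1 - lam * z1" by simp
    moreover have "pdiv p (3 * k) (lam * z1)" using pdiv_mult[OF lam zk(1)] by simp
    ultimately have nu: "pdiv p (3 * k) nu" using wk pdiv_diff by simp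
    have lam0: "pdiv p 0 lam" and lam1: "pdiv p 1 lam" using pdiv_mono[OF lam] k by auto
    have nu2: "pdiv p (2 * k) nu" using pdiv_mono[OF nu] by auto
    define f where "f = wa2 ?V * lam + wa4 ?V * lam^2 + wa6 ?V * lam^3"
    define c where "c = 1 + wa2 ?V * lam + wa4 ?V * lam^2 + wa6 ?V * lam^3"
    have f: "pdiv p 1 f" unfolding f_def wa_over_rat power2_eq_square power3_eq_cube
      by (intro pdiv_add pdiv_scale(1) lam1 lam0 integral_of_int)
    have cf: "c = 1 + f" by (simp add: c_def f_def)
    note uc = unit_one_plus[OF f, folded cf]
    define y3' where "y3' = l * x3 + m"
    note S = sum_at_infinity[OF line m lam_def nu_def c_def uc(1) y(1,2) y3'_def]
    define t where "t = wa1 ?V * lam + wa2 ?V * nu + wa3 ?V * lam^2 + 2 * wa4 ?V * lam * nu + 3 * wa6 ?V * lam^2 * nu"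
    have t: "pdiv p (2 * k) t" unfolding t_def wa_over_rat power2_eq_square
      by (intro pdiv_add pdiv_scale(1) lam nu2 lam0 integral_of_int integral_numeral pdiv_scale(1)[OF _ nu2])
    define z3 where "z3 = - x3 / y3'"
    have zs: "z3 = - (t * inverse c) - z1 - z2" using S(2)[folded t_def z z3_def] by (simp add: divide_inverse)
    have tc: "pdiv p (2 * k) (t * inverse c)" using t uc pdiv_scale by blast
    have z3: "pdiv p k z3" unfolding zs by (intro pdiv_diff pdiv_minus zk pdiv_mono[OF tc]) simp
    have "m * (- 1 / y3') = - 1 - l * z3" using S(1) unfolding z3_def by (auto simp: y3'_def field_simps)
    then have "- 1 / y3' = lam * z3 + nu" unfolding lam_def nu_def using m by (simp add: field_simps)
    moreover have "pdiv p (3 * k) (lam * z3)" using pdiv_mult[OF lam z3] by simp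
    ultimately have "pdiv p (3 * k) (- 1 / y3')" using nu pdiv_add by simp
    then have K: "Affine x3 y3' \<in> kernel_level p k" using S(1) z3 by (simp add: Affine_kernel_level z3_def)
    have neg: "point_neg ?V (Affine x3 y3') = Affine x3 y3" using y(3) by (simp add: y3'_def)
    have "zcoord (Affine x3 y3) - z1 - z2 = (zcoord (Affine x3 y3) + zcoord (Affine x3 y3')) + t * inverse c"
      using zs by (simp add: z3_def)
    moreover have D: "pdiv p (2 * k) ((zcoord (Affine x3 y3) + zcoord (Affine x3 y3')) + t * inverse c)"
      using kernel_level_neg(2)[OF K] tc unfolding neg by (rule pdiv_add)
    ultimately have "pdiv p (2 * k) (zcoord (Affine x3 y3) - z1 - z2)" by metis
    moreover have "zcoord P = z1" "zcoord Q = z2" by (simp_all add: PQ z)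
    ultimately show ?thesis using kernel_level_neg(1)[OF K] unfolding neg Affine by metis
  qed
qed (use assms in auto)

end

end

subsection \<open>The Mordell--Weil group and the ranks of apparition\<close>

lemma discriminant_singular:
  fixes V :: "'a::idom weierstrass"
  assumes "weierstrass_poly V x y = 0" "weierstrass_poly_dx V x y = 0" "weierstrass_poly_dy V x y = 0"
  shows "discriminant V = 0"
proof -
  have a3: "wa3 V = - 2 * y - wa1 V * x"
    using assms(3) unfolding weierstrass_poly_dy_def by Groebner_Basis.algebra
  have a4: "wa4 V = wa1 V * y - 3 * x^2 - 2 * wa2 V * x"
    using assms(2) unfolding weierstrass_poly_dx_def by Groebner_Basis.algebra
  have a6: "wa6 V = 2 * x^3 + wa2 V * x^2 - wa1 V * x * y - y^2"
    using assms(1) unfolding weierstrass_poly_def a3 a4 by Groebner_Basis.algebra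
  show ?thesis unfolding discriminant_def Let_def a3 a4 a6 by Groebner_Basis.algebra
qed

lemma discriminant_of_int:
  "discriminant (map_weierstrass of_int W) = (of_int (discriminant W) :: 'a::comm_ring_1)"
  by (simp add: discriminant_def Let_def weierstrass.map_sel)

lemma nonsing_eq_curve_points:
  assumes "discriminant V \<noteq> 0"
  shows "nonsing V = curve_points V"
  using assms discriminant_singular[of V] by (auto simp: nonsing_def curve_points_def)

definition ec_group :: "'a::field weierstrass \<Rightarrow> 'a point monoid" where
  "ec_group V = \<lparr>carrier = nonsing V, monoid.mult = point_add V, one = Infinity\<rparr>"

lemma ec_group_simps [simp]:
  "carrier (ec_group V) = nonsing V" "x \<otimes>\<^bsub>ec_group V\<^esub> y = point_add V x y" "\<one>\<^bsub>ec_group V\<^esub> = Infinity"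
  by (simp_all add: ec_group_def)

lemma comm_group_ec_group: "comm_group (ec_group V)"
proof (rule comm_groupI)
  fix x assume "x \<in> carrier (ec_group V)"
  then show "\<exists>y\<in>carrier (ec_group V). y \<otimes>\<^bsub>ec_group V\<^esub> x = \<one>\<^bsub>ec_group V\<^esub>"
    by (intro bexI[of _ "point_neg V x"]) (auto simp: point_add_eq_Infinity_iff)
qed (auto simp: point_add_nonsing point_add_assoc intro: point_add_commute nonsing_curve)

lemma point_mult_eq_pow:
  assumes "P \<in> nonsing V"
  shows "point_mult V n P = P [^]\<^bsub>ec_group V\<^esub> n"
proof -
  interpret comm_group "ec_group V" by (rule comm_group_ec_group)
  show ?thesis using assms nat_pow_Suc2[of P] by (induction n) simp_all
qed

lemma point_mult_add:
  assumes "P \<in> nonsing V"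
  shows "point_mult V (m + n) P = point_add V (point_mult V m P) (point_mult V n P)"
proof -
  interpret comm_group "ec_group V" by (rule comm_group_ec_group)
  show ?thesis unfolding point_mult_eq_pow[OF assms] using assms nat_pow_mult[of P m n] by simp
qed

lemma point_mult_nonsing:
  assumes "P \<in> nonsing V"
  shows "point_mult V n P \<in> nonsing V"
  using assms by (induction n) (simp_all add: point_add_nonsing)

lemma point_add_cancel_neg:
  assumes "P \<in> nonsing V" "Q \<in> nonsing V"
  shows "point_add V (point_neg V P) (point_add V P Q) = Q"
    "point_add V (point_add V Q P) (point_neg V P) = Q"
proof -
  have "point_add V (point_neg V P) P = Infinity" "point_add V P (point_neg V P) = Infinity"
    by (simp_all add: point_add_eq_Infinity_iff)
  then show "point_add V (point_neg V P) (point_add V P Q) = Q"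
    "point_add V (point_add V Q P) (point_neg V P) = Q"
    using point_add_assoc[of "point_neg V P" V P Q] point_add_assoc[of Q V P "point_neg V P"] assms
    by simp_all
qed

text \<open>Subgroups of the integers are cyclic; on the naturals, closure under subtraction takes
  the form \<open>cancel\<close>.\<close>

lemma nat_subgroup_dvd:
  fixes A :: "nat set"
  assumes zero: "0 \<in> A" and add: "\<And>m n. m \<in> A \<Longrightarrow> n \<in> A \<Longrightarrow> m + n \<in> A"
    and cancel: "\<And>m n. m + n \<in> A \<Longrightarrow> m \<in> A \<Longrightarrow> n \<in> A"
    and r: "r \<ge> 1" "r \<in> A" "\<And>s. s \<ge> 1 \<Longrightarrow> s \<in> A \<Longrightarrow> r \<le> s"
  shows "n \<in> A \<longleftrightarrow> r dvd n"
proof -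
  have mult: "r * q \<in> A" for q by (induction q) (use zero add r in auto)
  have "n \<in> A \<longleftrightarrow> n mod r \<in> A"
    using add[OF mult, of "n mod r" "n div r"] cancel[of "r * (n div r)" "n mod r"] mult by auto
  also have "\<dots> \<longleftrightarrow> n mod r = 0"
    using r(3)[of "n mod r"] zero r(1) mod_less_divisor[of r n] by fastforce
  finally show ?thesis by (simp add: dvd_eq_mod_eq_0)
qed

section \<open>Divisibility of the terms by prime powers\<close>

locale eds_curve =
  fixes W :: "int weierstrass" and P :: "rat point" and D :: "nat \<Rightarrow> nat"
  assumes elliptic: "elliptic_curve W"
    and P_curve: "P \<in> curve_points (over_rat W)"
    and inf: "infinite_order (over_rat W) P"
    and D_eq: "D = eds W P"
begin

abbreviation "V \<equiv> over_rat W"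

lemma nonsing_V: "nonsing V = curve_points V"
  using elliptic by (intro nonsing_eq_curve_points) (simp add: discriminant_of_int elliptic_curve_def)

lemma P_nonsing: "P \<in> nonsing V"
  using P_curve nonsing_V by simp

abbreviation mul :: "nat \<Rightarrow> rat point" where "mul n \<equiv> point_mult V n P"

lemma mul_nonsing: "mul n \<in> nonsing V" by (intro point_mult_nonsing P_nonsing)

lemma mul_curve: "mul n \<in> curve_points V" using mul_nonsing nonsing_V by simp

lemma eds_shape:
  assumes "n \<ge> 1"
  obtains a c :: int where "D n > 0" "coprime a (int (D n))" "coprime c (int (D n))"
    "mul n = Affine (of_int a / of_nat (D n) ^ 2) (of_int c / of_nat (D n) ^ 3)"
proof -
  have "mul n \<noteq> Infinity" using inf assms unfolding infinite_order_def by blast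
  then obtain x y where xy: "mul n = Affine x y" by (cases "mul n") auto
  then have "weierstrass_poly V x y = 0" using mul_curve[of n] by (auto simp: curve_points_def)
  then obtain a c d :: int where d: "d > 0" "coprime a d" "coprime c d"
    "x = of_int a / of_int d ^ 2" "y = of_int c / of_int d ^ 3" by (rule rational_point_shape)
  have "eds W P n = nat d"
    by (rule eds_eqI[of _ a _ _ _ y]) (use d xy in auto)
  then have "int (D n) = d" using d(1) by (simp add: D_eq)
  then have "of_nat (D n) = (of_int d :: rat)" by (metis of_int_of_nat_eq)
  then show ?thesis using that[of a c] d xy \<open>int (D n) = d\<close> by auto
qed

lemma D_pos: "n \<ge> 1 \<Longrightarrow> D n > 0" using eds_shape by blast

context
  fixes p :: nat
  assumes p: "prime p"
begin

interpretation prime_int "int p" by unfold_locales (use p in simp)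

lemma p_not_1: "p \<noteq> Suc 0" using p by auto

text \<open>If \<open>p\<close> divides \<open>D n\<close>, it divides neither numerator, so
  \<open>z = - a * D n / c\<close> has exactly the valuation of \<open>D n\<close>, and
  \<open>w = - (D n)^3 / c\<close> three times that valuation.\<close>

lemma pdiv_zcoord_iff:
  assumes "n \<ge> 1" "p dvd D n"
  shows "pdiv (int p) k (zcoord (mul n)) \<longleftrightarrow> p ^ k dvd D n"
    "pdiv (int p) (3 * k) (- 1 / (case mul n of Affine x y \<Rightarrow> y)) \<longleftrightarrow> p ^ k dvd D n"
    "\<exists>x y. mul n = Affine x y \<and> y \<noteq> 0"
proof -
  from assms(1) obtain a c :: int where d: "D n > 0" "coprime a (int (D n))" "coprime c (int (D n))"
    "mul n = Affine (of_int a / of_nat (D n) ^ 2) (of_int c / of_nat (D n) ^ 3)" by (rule eds_shape)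
  have nu: "\<not> is_unit (int p)" using p by (simp add: prime_nat_iff)
  have pD: "int p dvd int (D n)" using assms(2) by simp
  have c: "\<not> int p dvd c" and a: "\<not> int p dvd a"
    using d(2,3) pD nu coprime_common_divisor by blast+
  have c0: "c \<noteq> 0" using c by auto
  have z: "zcoord (mul n) = of_int (- a * int (D n)) / of_int c"
    using d(1) c0 unfolding d(4) by (simp add: field_simps power2_eq_square power3_eq_cube)
  have "pdiv (int p) k (zcoord (mul n)) \<longleftrightarrow> int p ^ k dvd - a * int (D n)"
    unfolding z by (rule pdiv_fraction[OF c])
  also have "\<dots> \<longleftrightarrow> int p ^ k dvd int (D n)"
  proof -
    have "coprime (int p ^ k) a" using a p by (simp add: prime_imp_coprime)
    then show ?thesis by (simp add: coprime_dvd_mult_right_iff)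
  qed
  also have "\<dots> \<longleftrightarrow> p ^ k dvd D n" by (metis int_dvd_int_iff of_nat_power)
  finally show "pdiv (int p) k (zcoord (mul n)) \<longleftrightarrow> p ^ k dvd D n" .
  have w: "- 1 / (case mul n of Affine x y \<Rightarrow> y) = of_int (- (int (D n) ^ 3)) / of_int c"
    using d(1) c0 unfolding d(4) by (simp add: field_simps)
  have "pdiv (int p) (3 * k) (- 1 / (case mul n of Affine x y \<Rightarrow> y)) \<longleftrightarrow> int p ^ (3 * k) dvd - (int (D n) ^ 3)"
    unfolding w by (rule pdiv_fraction[OF c])
  also have "int p ^ (3 * k) = int (p ^ k) ^ 3" by (simp add: power_mult mult.commute flip: of_nat_power)
  also have "int (p ^ k) ^ 3 dvd - (int (D n) ^ 3) \<longleftrightarrow> p ^ k dvd D n"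
    by (simp flip: of_nat_power)
  finally show "pdiv (int p) (3 * k) (- 1 / (case mul n of Affine x y \<Rightarrow> y)) \<longleftrightarrow> p ^ k dvd D n" .
  show "\<exists>x y. mul n = Affine x y \<and> y \<noteq> 0" using d(1,4) c0 by simp
qed

lemma integral_iff_not_dvd:
  assumes "n \<ge> 1" "mul n = Affine x y"
  shows "pdiv (int p) 0 x \<longleftrightarrow> \<not> p dvd D n"
proof -
  from assms(1) obtain a c :: int where d: "D n > 0" "coprime a (int (D n))" "coprime c (int (D n))"
    "mul n = Affine (of_int a / of_nat (D n) ^ 2) (of_int c / of_nat (D n) ^ 3)" by (rule eds_shape)
  have x: "x = of_int a / of_int (int (D n) ^ 2)" using d(4) assms(2) by simp
  show ?thesis
  proof (cases "p dvd D n")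
    case False
    then have "\<not> int p dvd int (D n) ^ 2" using p by (meson int_dvd_int_iff prime_dvd_power prime_nat_int_transfer)
    from pdiv_fraction[OF this, of 0 a] show ?thesis unfolding x using False by simp
  next
    case True
    have nu: "\<not> is_unit (int p)" using p by (simp add: prime_nat_iff)
    have pD: "int p dvd int (D n)" using True by simp
    have a: "\<not> int p dvd a" using d(2) pD nu coprime_common_divisor by blast
    have "a \<noteq> 0" using a by auto
    have "pdiv (int p) 1 (of_int (int (D n) ^ 2) / of_int a)"
      unfolding pdiv_fraction[OF a] using pD by (simp add: power2_eq_square)
    moreover have "of_int (int (D n) ^ 2) / of_int a * x = of_int 1"
      using \<open>a \<noteq> 0\<close> d(1) unfolding x by simp
    ultimately have "pdiv (int p) 0 x \<Longrightarrow> pdiv (int p) 1 (of_int 1)"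
      using pdiv_scale(2)[of x 1] by metis
    then show ?thesis using True p_not_1 unfolding pdiv_of_int_iff by auto
  qed
qed

lemma mul_kernel_level_iff:
  assumes "n \<ge> 1" "k \<ge> 1"
  shows "mul n \<in> kernel_level (int p) k \<longleftrightarrow> p ^ k dvd D n"
proof
  assume K: "mul n \<in> kernel_level (int p) k"
  obtain x y where xy: "mul n = Affine x y"
    using inf assms unfolding infinite_order_def by (cases "mul n") auto
  have K': "y \<noteq> 0" "pdiv (int p) k (- x / y)" "pdiv (int p) (3 * k) (- 1 / y)"
    using K xy by (auto simp: Affine_kernel_level)
  have "p dvd D n"
  proof (rule ccontr)
    assume n: "\<not> p dvd D n"
    from assms(1) obtain a c :: int where d: "D n > 0" "coprime a (int (D n))" "coprime c (int (D n))"
      "mul n = Affine (of_int a / of_nat (D n) ^ 2) (of_int c / of_nat (D n) ^ 3)" by (rule eds_shape)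
    have y: "y = of_int c / of_int (int (D n) ^ 3)" using d(4) xy by simp
    have "\<not> int p dvd int (D n) ^ 3" using p n by (meson int_dvd_int_iff prime_dvd_power prime_nat_int_transfer)
    then have "pdiv (int p) 0 y" unfolding y using pdiv_fraction[of _ 0] one_dvd power_0 by metis
    moreover have "pdiv (int p) 1 (- 1 / y)" using pdiv_mono[OF K'(3)] assms(2) by simp
    ultimately have "pdiv (int p) 1 (- 1 / y * y)" by (rule pdiv_scale(2))
    then have "pdiv (int p) 1 (of_int (- 1))" using K'(1) by simp
    then show False using p_not_1 unfolding pdiv_of_int_iff by simp
  qed
  then show "p ^ k dvd D n" using pdiv_zcoord_iff(1)[OF assms(1)] K' xy by simp
next
  assume pk: "p ^ k dvd D n"
  then have "p dvd D n" using assms(2) by (metis dvd_trans dvd_power_le dvd_refl power_one_right)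
  from pdiv_zcoord_iff[OF assms(1) this] pk show "mul n \<in> kernel_level (int p) k"
    by (auto simp: Affine_kernel_level)
qed

lemma eds_prime_power_dvd_iff:
  assumes "n \<ge> 1" "k \<ge> 1"
  shows "p ^ k dvd D n \<longleftrightarrow> rank_app D (p ^ k) dvd n"
proof -
  define A where "A = {n. mul n \<in> kernel_level (int p) k}"
  have A: "n \<in> A \<longleftrightarrow> p ^ k dvd D n" if "n \<ge> 1" for n
    using mul_kernel_level_iff[OF that assms(2)] by (simp add: A_def)
  have zero: "0 \<in> A" by (simp add: A_def)
  have add: "m + n \<in> A" if "m \<in> A" "n \<in> A" for m n
    using kernel_level_add[OF assms(2) mul_curve[of m] _ mul_curve[of n]] that
    by (auto simp: A_def point_mult_add[OF P_nonsing])
  have cancel: "n \<in> A" if "m + n \<in> A" "m \<in> A" for m n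
  proof -
    have "point_neg V (mul m) \<in> kernel_level (int p) k" 
      using that(2) kernel_level_neg(1)[OF assms(2)] by (simp add: A_def)
    moreover have "point_neg V (mul m) \<in> curve_points V" using mul_nonsing nonsing_V point_neg_nonsing by metis
    moreover have "mul n = point_add V (point_neg V (mul m)) (mul (m + n))"
      unfolding point_mult_add[OF P_nonsing] by (simp add: point_add_cancel_neg mul_nonsing)
    ultimately show ?thesis using kernel_level_add[OF assms(2)] that(1) mul_curve unfolding A_def by simp
  qed
  show ?thesis
  proof (cases "\<exists>r\<ge>1. p ^ k dvd D r")
    \<comment> \<open>\<open>rank_app\<close> takes its default value 0 here, which divides no
      positive \<open>n\<close>.\<close>
    case False
    then show ?thesis using assms(1) by (auto simp: rank_app_def)
  next
    case True
    define r where "r = (LEAST r. r \<ge> 1 \<and> p ^ k dvd D r)"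
    have r: "r \<ge> 1 \<and> p ^ k dvd D r" unfolding r_def by (rule LeastI_ex) (use True in blast)
    have le: "r \<le> s" if "s \<ge> 1" "p ^ k dvd D s" for s unfolding r_def by (rule Least_le) (use that in blast)
    have "n \<in> A \<longleftrightarrow> r dvd n"
      by (rule nat_subgroup_dvd[OF zero add cancel]) (use r le A in blast)+
    moreover have "rank_app D (p ^ k) = r" using True by (simp add: rank_app_def r_def)
    ultimately show ?thesis using A assms(1) by simp
  qed
qed

lemma zcoord_multiple:
  assumes n: "n \<ge> 1" and k: "k \<ge> 1" "p ^ k dvd D n"
  shows "mul (j * n) \<in> kernel_level (int p) k \<and>
    pdiv (int p) (2 * k) (zcoord (mul (j * n)) - of_nat j * zcoord (mul n))"
proof (induction j)
  case (Suc j)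
  have K: "mul n \<in> kernel_level (int p) k" using mul_kernel_level_iff n k by simp
  have s: "mul (Suc j * n) = point_add V (mul n) (mul (j * n))"
    using point_mult_add[OF P_nonsing, of n "j * n"] by simp
  note a = kernel_level_add[OF k(1) mul_curve K mul_curve conjunct1[OF Suc.IH]]
  have "zcoord (mul (Suc j * n)) - of_nat (Suc j) * zcoord (mul n) =
    (zcoord (mul (Suc j * n)) - zcoord (mul n) - zcoord (mul (j * n))) + (zcoord (mul (j * n)) - of_nat j * zcoord (mul n))"
    by (simp add: algebra_simps)
  moreover have "pdiv (int p) (2 * k) \<dots>"
    by (rule pdiv_add[OF conjunct2[OF a, folded s] conjunct2[OF Suc.IH]])
  ultimately show ?case using conjunct1[OF a, folded s] by metis
qed simp

text \<open>Modulo \<open>p^(2 * k)\<close> multiplication by \<open>p\<close> on the curve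
  multiplies \<open>z\<close> by \<open>p\<close>, and \<open>2 * k \<ge> k + 1\<close>.\<close>

lemma eds_lift:
  assumes n: "n \<ge> 1" and k: "k \<ge> 1" "p ^ k dvd D n"
  shows "p ^ (k + 1) dvd D (p * n)"
proof -
  have p1: "p \<ge> 1" using p prime_gt_0_nat by (simp add: Suc_leI)
  have pn: "p * n \<ge> 1" using n p1 by (metis mult_le_mono nat_mult_1)
  have pD: "p dvd D n" using k by (metis dvd_trans dvd_power_le dvd_refl power_one_right)
  have z: "pdiv (int p) k (zcoord (mul n))" using pdiv_zcoord_iff(1)[OF n pD] k by simp
  note m = zcoord_multiple[OF n k, of p]
  have "pdiv (int p) 1 (of_int (int p))" unfolding pdiv_of_int_iff by simp
  from pdiv_mult[OF this z] have "pdiv (int p) (k + 1) (of_nat p * zcoord (mul n))" by simp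
  moreover have "pdiv (int p) (k + 1) (zcoord (mul (p * n)) - of_nat p * zcoord (mul n))"
    using m k(1) by (auto intro: pdiv_mono)
  ultimately have "pdiv (int p) (k + 1) ((zcoord (mul (p * n)) - of_nat p * zcoord (mul n)) + of_nat p * zcoord (mul n))"
    by (rule pdiv_add[rotated])
  then have z': "pdiv (int p) (k + 1) (zcoord (mul (p * n)))" by simp
  have "p ^ k dvd D (p * n)" using m mul_kernel_level_iff[OF pn k(1)] by simp
  then have "p dvd D (p * n)" using k by (metis dvd_trans dvd_power_le dvd_refl power_one_right)
  then show ?thesis using pdiv_zcoord_iff(1)[OF pn] z' by simp
qed

end

end

subsection \<open>The reduction homomorphism\<close>

context prime_field
begin

context
  fixes W :: "int weierstrass"
begin

abbreviation "VQ \<equiv> over_rat W"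
abbreviation VF :: "'a mod_ring weierstrass" where "VF \<equiv> map_weierstrass of_int W"

lemma wa_VF:
  "wa1 VF = of_int (wa1 W)" "wa2 VF = of_int (wa2 W)" "wa3 VF = of_int (wa3 W)"
  "wa4 VF = of_int (wa4 W)" "wa6 VF = of_int (wa6 W)"
  by (simp_all add: weierstrass.map_sel)

lemma wa_VQ:
  "wa1 VQ = of_int (wa1 W)" "wa2 VQ = of_int (wa2 W)" "wa3 VQ = of_int (wa3 W)"
  "wa4 VQ = of_int (wa4 W)" "wa6 VQ = of_int (wa6 W)"
  by (simp_all add: weierstrass.map_sel)

fun redpt :: "rat point \<Rightarrow> 'a mod_ring point" where
  "redpt Infinity = Infinity"
| "redpt (Affine x y) = (if pdiv p 0 x then Affine (rd x) (rd y) else Infinity)"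

lemmas red_hom = red_add red_diff red_mult red_power red_minus
lemmas integral_intros = pdiv_add pdiv_diff pdiv_scale integral_power pdiv_minus integral_of_int integral_numeral

lemma integral_ordinate:
  assumes "weierstrass_poly VQ x y = 0" "pdiv p 0 x"
  shows "pdiv p 0 y"
proof (rule integral_root)
  show "y^2 + (wa1 VQ * x + wa3 VQ) * y + (- (x^3 + wa2 VQ * x^2 + wa4 VQ * x + wa6 VQ)) = 0"
    using assms(1) by (simp add: weierstrass_poly_def algebra_simps)
qed (unfold wa_VQ, (intro integral_intros assms(2))+)

lemma red_weierstrass_poly:
  assumes "weierstrass_poly VQ x y = 0" "pdiv p 0 x"
  shows "weierstrass_poly VF (rd x) (rd y) = 0"
proof -
  note i = assms(2) integral_ordinate[OF assms]
  have "rd (weierstrass_poly VQ x y) = weierstrass_poly VF (rd x) (rd y)"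
    unfolding weierstrass_poly_def wa_VQ wa_VF
    by (simp add: red_hom integral_intros i)
  then show ?thesis using assms(1) by simp
qed

lemma redpt_curve:
  assumes "Q \<in> curve_points VQ"
  shows "redpt Q \<in> curve_points VF"
  using assms red_weierstrass_poly by (cases Q) (auto simp: curve_points_def)

lemma redpt_neg:
  assumes "Q \<in> curve_points VQ"
  shows "redpt (point_neg VQ Q) = point_neg VF (redpt Q)"
proof (cases Q)
  case (Affine x y)
  then have "weierstrass_poly VQ x y = 0" using assms by (auto simp: curve_points_def)
  from integral_ordinate[OF this] show ?thesis unfolding Affine
    by (auto simp: wa_VF wa_VQ red_hom integral_intros)
qed simp

lemma divide_integral:
  assumes "l * u = v" "pdiv p 0 u" "pdiv p 0 v" "rd u \<noteq> 0"
  shows "pdiv p 0 l" "rd l = rd v / rd u"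
proof -
  have u: "\<not> pdiv p 1 u" using assms red_eq_0_iff by simp
  then have "u \<noteq> 0" by auto
  then have "l = v * inverse u" using assms(1) by (auto simp: field_simps)
  then show l: "pdiv p 0 l" using pdiv_inverse[OF assms(2) u] assms(3) pdiv_scale by simp
  have "rd l * rd u = rd v" using assms(1,2) l red_mult by metis
  then show "rd l = rd v / rd u" using assms(4) by (simp add: field_simps)
qed

text \<open>For distinct points with equal reductions the chord quotient becomes 0/0 modulo
  \<open>p\<close>. Factoring the difference of the two curve equations gives this second expression
  for the slope, whose denominator stays a unit as long as the reductions are not opposite.\<close>

lemma slope_alternative:
  assumes "line_through VQ l m x1 x2 x3" "y1 = l * x1 + m" "y2 = l * x2 + m"
  shows "l * (y1 + y2 + wa1 VQ * x2 + wa3 VQ) =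
    x1^2 + x1 * x2 + x2^2 + wa2 VQ * (x1 + x2) + wa4 VQ - wa1 VQ * y1"
  using assms unfolding line_through_def by Groebner_Basis.algebra

lemma redpt_add_affine:
  assumes P: "P \<in> curve_points VQ" and Q: "Q \<in> curve_points VQ"
    and rP: "redpt P \<noteq> Infinity" and rQ: "redpt Q \<noteq> Infinity"
    and n: "point_add VF (redpt P) (redpt Q) \<noteq> Infinity"
  shows "redpt (point_add VQ P Q) = point_add VF (redpt P) (redpt Q)"
proof -
  obtain x1 y1 where P': "P = Affine x1 y1" "pdiv p 0 x1" "redpt P = Affine (rd x1) (rd y1)"
    using rP by (cases P) (auto split: if_splits)
  obtain x2 y2 where Q': "Q = Affine x2 y2" "pdiv p 0 x2" "redpt Q = Affine (rd x2) (rd y2)"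
    using rQ by (cases Q) (auto split: if_splits)
  have wp: "weierstrass_poly VQ x1 y1 = 0" "weierstrass_poly VQ x2 y2 = 0"
    using P Q P' Q' by (auto simp: curve_points_def)
  note i = P'(2) Q'(2) integral_ordinate[OF wp(1) P'(2)] integral_ordinate[OF wp(2) Q'(2)]
  note wpF = red_weierstrass_poly[OF wp(1) P'(2)] red_weierstrass_poly[OF wp(2) Q'(2)]
  have n': "\<not> (rd x1 = rd x2 \<and> rd y1 + rd y2 + wa1 VF * rd x2 + wa3 VF = 0)"
    using n P' Q' by auto
  have "point_add VQ P Q \<noteq> Infinity"
  proof
    assume "point_add VQ P Q = Infinity"
    then have "Q = point_neg VQ P" by (simp add: point_add_eq_Infinity_iff)
    then have "redpt Q = point_neg VF (redpt P)" using redpt_neg[OF P] by simp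
    then show False using n by (simp add: point_add_eq_Infinity_iff)
  qed
  then obtain x3 y3 where S: "point_add VQ (Affine x1 y1) (Affine x2 y2) = Affine x3 y3"
    unfolding P' Q' by (cases "point_add VQ (Affine x1 y1) (Affine x2 y2)") auto
  obtain l m where y: "y1 = l * x1 + m" "y2 = l * x2 + m" "y3 = - (l * x3 + m) - wa1 VQ * x3 - wa3 VQ"
    and line: "line_through VQ l m x1 x2 x3"
    using point_add_line[OF wp S] by metis
  define sl where "sl = (if rd x1 = rd x2
       then (3 * rd x1^2 + 2 * wa2 VF * rd x1 + wa4 VF - wa1 VF * rd y1) / (2 * rd y1 + wa1 VF * rd x1 + wa3 VF)
       else (rd y2 - rd y1) / (rd x2 - rd x1))"
  have l: "pdiv p 0 l \<and> rd l = sl"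
  proof (cases "rd x1 = rd x2")
    case False
    have "l * (x2 - x1) = y2 - y1" unfolding y by (simp add: algebra_simps)
    moreover have "rd (x2 - x1) \<noteq> 0" using False i by (simp add: red_hom)
    ultimately show ?thesis
      using divide_integral[of l "x2 - x1" "y2 - y1"] i False
      by (simp add: sl_def red_hom integral_intros)
  next
    case True
    have e: "rd y1 = rd y2"
    proof -
      have "(rd y1 - rd y2) * (rd y1 + rd y2 + wa1 VF * rd x2 + wa3 VF) = 0"
        using wpF True same_abscissa by metis
      then show ?thesis using n' True by auto
    qed
    let ?u = "y1 + y2 + wa1 VQ * x2 + wa3 VQ"
    let ?v = "x1^2 + x1 * x2 + x2^2 + wa2 VQ * (x1 + x2) + wa4 VQ - wa1 VQ * y1"
    have u: "rd ?u = rd y1 + rd y2 + wa1 VF * rd x2 + wa3 VF" "pdiv p 0 ?u"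
      unfolding wa_VQ wa_VF by (simp_all add: red_hom integral_intros i)
    have v: "rd ?v = rd x1^2 + rd x1 * rd x2 + rd x2^2 + wa2 VF * (rd x1 + rd x2) + wa4 VF - wa1 VF * rd y1" "pdiv p 0 ?v"
      unfolding wa_VQ wa_VF by (simp_all add: red_hom integral_intros i)
    have "rd ?u \<noteq> 0" unfolding u(1) using n' True by simp
    from divide_integral[OF slope_alternative[OF line y(1,2)] u(2) v(2) this]
    have "pdiv p 0 l" "rd l = rd ?v / rd ?u" .
    moreover have "rd ?v = 3 * rd x1^2 + 2 * wa2 VF * rd x1 + wa4 VF - wa1 VF * rd y1"
      unfolding v(1) True by (simp add: power2_eq_square algebra_simps)
    moreover have "rd ?u = 2 * rd y1 + wa1 VF * rd x1 + wa3 VF" unfolding u(1) True e by simp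
    ultimately show ?thesis using True by (simp add: sl_def)
  qed
  have x3: "x3 = l^2 + of_int (wa1 W) * l - of_int (wa2 W) - x1 - x2"
    using line unfolding line_through_def wa_VQ by (simp add: algebra_simps)
  have x3i: "pdiv p 0 x3" unfolding x3 by (intro integral_intros l[THEN conjunct1] i)
  have rx3: "rd x3 = sl^2 + wa1 VF * sl - wa2 VF - rd x1 - rd x2"
    unfolding x3 wa_VF using l by (simp add: red_hom integral_intros i)
  have y3: "y3 = - (l + of_int (wa1 W)) * x3 - (y1 - l * x1) - of_int (wa3 W)"
    unfolding y wa_VQ by (simp add: algebra_simps)
  have ry3: "rd y3 = - (sl + wa1 VF) * rd x3 - (rd y1 - sl * rd x1) - wa3 VF"
    unfolding y3 wa_VF using l by (simp add: red_hom integral_intros i x3i)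
  have "redpt (point_add VQ P Q) = Affine (rd x3) (rd y3)" using S P' Q' x3i by simp
  also have "\<dots> = point_add VF (redpt P) (redpt Q)"
    unfolding P'(3) Q'(3) ry3 by (rule point_add_Affine[OF n' sl_def rx3, symmetric])
  finally show ?thesis .
qed

text \<open>If the sum had integral coordinates, \<open>l\<close> would satisfy a monic quadratic
  equation with integral coefficients and be integral. Reducing both slope equations then makes the
  two partial derivatives vanish at the reduction of \<open>P\<close>, which is nonsingular.\<close>

lemma redpt_add_opposite:
  assumes P: "P \<in> curve_points VQ" and Q: "Q \<in> curve_points VQ"
    and rP: "redpt P \<noteq> Infinity" and rQ: "redpt Q \<noteq> Infinity" and ns: "redpt P \<in> nonsing VF"
    and n: "point_add VF (redpt P) (redpt Q) = Infinity"
  shows "redpt (point_add VQ P Q) = Infinity"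
proof (rule ccontr)
  assume a: "redpt (point_add VQ P Q) \<noteq> Infinity"
  obtain x1 y1 where P': "P = Affine x1 y1" "pdiv p 0 x1" "redpt P = Affine (rd x1) (rd y1)"
    using rP by (cases P) (auto split: if_splits)
  obtain x2 y2 where Q': "Q = Affine x2 y2" "pdiv p 0 x2" "redpt Q = Affine (rd x2) (rd y2)"
    using rQ by (cases Q) (auto split: if_splits)
  have wp: "weierstrass_poly VQ x1 y1 = 0" "weierstrass_poly VQ x2 y2 = 0"
    using P Q P' Q' by (auto simp: curve_points_def)
  note i = P'(2) Q'(2) integral_ordinate[OF wp(1) P'(2)] integral_ordinate[OF wp(2) Q'(2)]
  have rx: "rd x2 = rd x1" and ry: "rd y1 + rd y2 + wa1 VF * rd x2 + wa3 VF = 0"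
    using n unfolding P'(3) Q'(3) point_add_eq_Infinity_iff by auto
  obtain x3 y3 where S: "point_add VQ (Affine x1 y1) (Affine x2 y2) = Affine x3 y3" and x3i: "pdiv p 0 x3"
    using a unfolding P'(1) Q'(1) by (cases "point_add VQ (Affine x1 y1) (Affine x2 y2)") (auto split: if_splits)
  obtain l m where y: "y1 = l * x1 + m" "y2 = l * x2 + m" 
    and line: "line_through VQ l m x1 x2 x3"
    using point_add_line[OF wp S] by metis
  have "l^2 + wa1 VQ * l + (- wa2 VQ - x1 - x2 - x3) = 0"
    using line unfolding line_through_def by (simp add: algebra_simps)
  then have l: "pdiv p 0 l"
    by (rule integral_root) (unfold wa_VQ, (intro integral_intros i x3i)+)
  have "l * (x2 - x1) = y2 - y1" unfolding y by (simp add: algebra_simps)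
  then have "rd (l * (x2 - x1)) = rd (y2 - y1)" by (simp only:)
  moreover have "rd (l * (x2 - x1)) = rd l * (rd x2 - rd x1)" "rd (y2 - y1) = rd y2 - rd y1"
    using l i by (simp_all add: red_hom integral_intros)
  ultimately have "rd l * (rd x2 - rd x1) = rd y2 - rd y1" by metis
  then have e: "rd y2 = rd y1" using rx by simp
  have "rd (l * (y1 + y2 + wa1 VQ * x2 + wa3 VQ)) = 
    rd (x1^2 + x1 * x2 + x2^2 + wa2 VQ * (x1 + x2) + wa4 VQ - wa1 VQ * y1)"
    by (rule arg_cong[OF slope_alternative[OF line y]])
  then have "rd l * (rd y1 + rd y2 + wa1 VF * rd x2 + wa3 VF) = 
      rd x1^2 + rd x1 * rd x2 + rd x2^2 + wa2 VF * (rd x1 + rd x2) + wa4 VF - wa1 VF * rd y1"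
    unfolding wa_VQ wa_VF by (simp add: red_hom integral_intros i l)
  then have "weierstrass_poly_dx VF (rd x1) (rd y1) = 0"
    unfolding ry unfolding rx by (simp add: weierstrass_poly_dx_def power2_eq_square algebra_simps)
  moreover have "weierstrass_poly_dy VF (rd x1) (rd y1) = 0"
    using ry unfolding rx e weierstrass_poly_dy_def mult_2 .
  ultimately show False using ns unfolding P'(3) by (simp add: Affine_nonsing_iff)
qed

lemma redpt_Infinity_iff:
  assumes "Q \<in> curve_points VQ"
  shows "redpt Q = Infinity \<longleftrightarrow> Q \<in> kernel_level p 1"
proof (cases Q)
  case (Affine x y)
  then have wp: "weierstrass_poly VQ x y = 0" using assms by (auto simp: curve_points_def)
  show ?thesis
  proof (cases "pdiv p 0 x")
    case True
    have "Q \<notin> kernel_level p 1"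
    proof
      assume "Q \<in> kernel_level p 1"
      then have "y \<noteq> 0" "pdiv p 3 (- 1 / y)" by (auto simp: Affine Affine_kernel_level)
      then have "pdiv p 1 (- 1 / y * y)"
        using integral_ordinate[OF wp True] pdiv_mono[of 3 "- 1 / y" 1] by (intro pdiv_scale) auto
      then have "pdiv p 1 (of_int (- 1))" using \<open>y \<noteq> 0\<close> by simp
      then show False unfolding pdiv_of_int_iff by simp
    qed
    then show ?thesis using True Affine by simp
  next
    case False
    obtain a c d :: int where d: "d > 0" "coprime a d" "coprime c d"
      "x = of_int a / of_int d ^ 2" "y = of_int c / of_int d ^ 3"
      using wp by (rule rational_point_shape)
    have pd: "p dvd d"
    proof (rule ccontr)
      assume "\<not> p dvd d"
      then have "\<not> p dvd d^2" using prime prime_dvd_power by blast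
      from pdiv_fraction[OF this, of 0 a] show False using False d(4) by simp
    qed
    have nu: "\<not> is_unit p" using prime not_prime_unit by blast
    have c: "\<not> p dvd c" using d(3) pd nu coprime_common_divisor by blast
    then have c0: "c \<noteq> 0" by auto
    have "- x / y = of_int (- a * d) / of_int c" "- 1 / y = of_int (- (d ^ 3)) / of_int c"
      using d(1) c0 unfolding d(4,5) by (simp_all add: field_simps power2_eq_square power3_eq_cube)
    then have "pdiv p 1 (- x / y)" "pdiv p 3 (- 1 / y)"
      unfolding pdiv_fraction[OF c] using pd by (auto simp: pdiv_fraction[OF c] simp del: of_int_minus of_int_mult of_int_power)
    moreover have "y \<noteq> 0" using d c0 by simp
    ultimately have "Q \<in> kernel_level p 1" unfolding Affine Affine_kernel_level by simp
    then show ?thesis using False Affine by simp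
  qed
qed simp

text \<open>Reduced to the affine case by writing \<open>Q\<close> as \<open>- P\<close> plus
  \<open>S\<close>: if \<open>S\<close>, the sum of \<open>P\<close> and \<open>Q\<close>, did not
  reduce like \<open>P\<close>, then \<open>- P\<close> plus \<open>S\<close> would have an affine
  reduction, but \<open>Q\<close> reduces to infinity.\<close>

lemma redpt_add_kernel:
  assumes disc: "discriminant VQ \<noteq> 0" 
    and P: "P \<in> curve_points VQ" and Q: "Q \<in> curve_points VQ"
    and rP: "redpt P \<noteq> Infinity" and rQ: "redpt Q = Infinity"
  shows "redpt (point_add VQ P Q) = redpt P"
proof -
  note ns = nonsing_eq_curve_points[OF disc]
  define S where "S = point_add VQ P Q"
  have P': "P \<in> nonsing VQ" and Q': "Q \<in> nonsing VQ" using P Q ns by simp_all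
  have S': "S \<in> nonsing VQ" unfolding S_def using P' Q' by (rule point_add_nonsing)
  have PS: "P = point_add VQ S (point_neg VQ Q)" unfolding S_def using P' Q' by (simp add: point_add_cancel_neg)
  have QS: "Q = point_add VQ (point_neg VQ P) S" unfolding S_def using P' Q' by (simp add: point_add_cancel_neg)
  have rS: "redpt S \<noteq> Infinity"
  proof
    assume "redpt S = Infinity"
    then have "S \<in> kernel_level p 1" using redpt_Infinity_iff S' ns by simp
    moreover have "point_neg VQ Q \<in> kernel_level p 1"
      using rQ redpt_Infinity_iff[OF Q] kernel_level_neg(1)[of 1] by simp
    moreover have "point_neg VQ Q \<in> curve_points VQ" using Q' ns point_neg_nonsing by metis
    ultimately have "P \<in> kernel_level p 1" unfolding PS
      using kernel_level_add[of 1 S W] S' ns by simp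
    then show False using rP redpt_Infinity_iff[OF P] by simp
  qed
  show ?thesis
  proof (rule ccontr)
    assume ne: "redpt (point_add VQ P Q) \<noteq> redpt P"
    let ?N = "point_neg VQ P"
    have N: "?N \<in> curve_points VQ" using P' ns point_neg_nonsing by metis
    have rN: "redpt ?N = point_neg VF (redpt P)" by (rule redpt_neg[OF P])
    have "point_add VF (redpt ?N) (redpt S) \<noteq> Infinity"
      using ne unfolding rN point_add_eq_Infinity_iff S_def by simp
    moreover have "redpt ?N \<noteq> Infinity" unfolding rN using rP by (cases "redpt P") auto
    ultimately have "redpt (point_add VQ ?N S) = point_add VF (redpt ?N) (redpt S)"
      using N S' ns rS by (intro redpt_add_affine) auto
    then show False using \<open>point_add VF (redpt ?N) (redpt S) \<noteq> Infinity\<close> rQ QS by simp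
  qed
qed

lemma redpt_add:
  assumes disc: "discriminant VQ \<noteq> 0" 
    and P: "P \<in> curve_points VQ" and Q: "Q \<in> curve_points VQ"
    and rP: "redpt P \<in> nonsing VF" and rQ: "redpt Q \<in> nonsing VF"
  shows "redpt (point_add VQ P Q) = point_add VF (redpt P) (redpt Q)"
proof -
  consider "redpt P = Infinity" "redpt Q = Infinity" | "redpt P = Infinity" "redpt Q \<noteq> Infinity"
    | "redpt P \<noteq> Infinity" "redpt Q = Infinity"
    | "redpt P \<noteq> Infinity" "redpt Q \<noteq> Infinity" "point_add VF (redpt P) (redpt Q) = Infinity"
    | "redpt P \<noteq> Infinity" "redpt Q \<noteq> Infinity" "point_add VF (redpt P) (redpt Q) \<noteq> Infinity" by blast
  then show ?thesis
  proof cases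
    case 1
    then have "point_add VQ P Q \<in> kernel_level p 1"
      using kernel_level_add[of 1 P W Q] redpt_Infinity_iff P Q by simp
    moreover have "point_add VQ P Q \<in> curve_points VQ"
      using P Q nonsing_eq_curve_points[OF disc] point_add_nonsing by metis
    ultimately show ?thesis using redpt_Infinity_iff 1 by simp
  next
    case 2
    then show ?thesis using redpt_add_kernel[OF disc Q P] point_add_commute[OF P Q] by simp
  next
    case 3
    then show ?thesis using redpt_add_kernel[OF disc P Q] by simp
  next
    case 4
    then show ?thesis using redpt_add_opposite[OF P Q] rP by simp
  next
    case 5
    then show ?thesis using redpt_add_affine[OF P Q] by simp
  qed
qed

lemma redpt_mult:
  assumes disc: "discriminant VQ \<noteq> 0" 
    and P: "P \<in> curve_points VQ" and rP: "redpt P \<in> nonsing VF"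
  shows "redpt (point_mult VQ n P) = point_mult VF n (redpt P)"
proof (induction n)
  case (Suc n)
  have "point_mult VQ n P \<in> curve_points VQ"
    using P nonsing_eq_curve_points[OF disc] point_mult_nonsing by metis
  moreover have "redpt (point_mult VQ n P) \<in> nonsing VF"
    unfolding Suc using rP by (rule point_mult_nonsing)
  ultimately show ?case using redpt_add[OF disc P _ rP] Suc by simp
qed simp

end

end

subsection \<open>Nonsingular points modulo a prime as a group\<close>

lemma weierstrass_of_int:
  fixes W :: "int weierstrass"
  shows "weierstrass_poly (map_weierstrass of_int W) (of_int x) (of_int y) = (of_int (weierstrass_poly W x y) :: 'b::comm_ring_1)"
    "weierstrass_poly_dx (map_weierstrass of_int W) (of_int x) (of_int y) = (of_int (weierstrass_poly_dx W x y) :: 'b)"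
    "weierstrass_poly_dy (map_weierstrass of_int W) (of_int x) (of_int y) = (of_int (weierstrass_poly_dy W x y) :: 'b)"
  by (simp_all add: weierstrass_poly_def weierstrass_poly_dx_def weierstrass_poly_dy_def weierstrass.map_sel)

abbreviation residue_point :: "'a::prime_card mod_ring point \<Rightarrow> int point" where
  "residue_point \<equiv> map_point to_int_mod_ring"

lemma of_int_to_int_mod_ring: "of_int (to_int_mod_ring (x :: 'a::prime_card mod_ring)) = x"
  by (simp add: of_int_of_int_mod_ring)

lemma to_int_of_int_mod_ring: "to_int_mod_ring (of_int n :: 'a::prime_card mod_ring) = n mod int CARD('a)"
  unfolding of_int_of_int_mod_ring by transfer simp

lemma to_int_mod_ring_range: "to_int_mod_ring (x :: 'a::prime_card mod_ring) \<in> {0..<int CARD('a)}"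
  by transfer simp

lemma cong_0_iff_of_int: "[n = 0] (mod int CARD('a)) \<longleftrightarrow> (of_int n :: 'a::prime_card mod_ring) = 0"
  by (simp add: of_int_mod_ring_eq_0_iff cong_0_iff)

lemma singular_mod_iff:
  fixes u v :: "'a::prime_card mod_ring"
  shows "Affine u v \<in> nonsing (map_weierstrass of_int W) \<longleftrightarrow>
    [weierstrass_poly W (to_int_mod_ring u) (to_int_mod_ring v) = 0] (mod int CARD('a)) \<and>
    \<not> singular_mod W CARD('a) (to_int_mod_ring u) (to_int_mod_ring v)"
proof -
  define a b where ab: "a = to_int_mod_ring u" "b = to_int_mod_ring v"
  have uv: "u = of_int a" "v = of_int b" unfolding ab by (simp_all add: of_int_to_int_mod_ring)
  show ?thesis unfolding ab[symmetric] unfolding uv Affine_nonsing_iff singular_mod_def weierstrass_of_int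
    cong_0_iff_of_int[where 'a='a] by auto
qed

lemma residue_point_nonsing:
  "residue_point Q \<in> ns_points_mod W CARD('a) \<longleftrightarrow> Q \<in> nonsing (map_weierstrass of_int W)"
  for Q :: "'a::prime_card mod_ring point"
proof (cases Q)
  case (Affine u v)
  then show ?thesis using to_int_mod_ring_range[of u] to_int_mod_ring_range[of v]
    by (simp add: singular_mod_iff) (auto simp: ns_points_mod_def points_mod_def)
qed (simp add: ns_points_mod_def points_mod_def)

lemma residue_point_image:
  "residue_point ` nonsing (map_weierstrass of_int W :: 'a::prime_card mod_ring weierstrass) = ns_points_mod W CARD('a)"
proof
  show "ns_points_mod W CARD('a) \<subseteq> residue_point ` nonsing (map_weierstrass of_int W :: 'a mod_ring weierstrass)"
  proof
    fix R assume R: "R \<in> ns_points_mod W CARD('a)"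
    show "R \<in> residue_point ` nonsing (map_weierstrass of_int W :: 'a mod_ring weierstrass)"
    proof (cases R)
      case (Affine x y)
      then have xy: "x \<in> {0..<int CARD('a)}" "y \<in> {0..<int CARD('a)}" using R by (auto simp: ns_points_mod_def points_mod_def)
      define Q :: "'a mod_ring point" where "Q = Affine (of_int x) (of_int y)"
      have "residue_point Q = R" using xy by (simp add: Q_def Affine to_int_of_int_mod_ring)
      then show ?thesis using R residue_point_nonsing by blast
    qed (auto intro: image_eqI[of _ _ Infinity])
  qed
qed (use residue_point_nonsing in blast)

lemma inj_residue_point: "inj (residue_point :: 'a::prime_card mod_ring point \<Rightarrow> _)"
  by (intro point.inj_map injI) (metis of_int_to_int_mod_ring)

lemma card_ns_points_mod:
  "card (ns_points_mod W CARD('a)) = card (nonsing (map_weierstrass of_int W :: 'a::prime_card mod_ring weierstrass))"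
  unfolding residue_point_image[symmetric] by (rule card_image) (rule inj_on_subset[OF inj_residue_point], simp)

lemma finite_points_mod: "finite (points_mod W p)"
proof -
  have "points_mod W p \<subseteq> insert Infinity ((\<lambda>(x, y). Affine x y) ` ({0..<int p} \<times> {0..<int p}))"
    by (auto simp: points_mod_def)
  then show ?thesis by (rule finite_subset) simp
qed

lemma finite_nonsing: "finite (nonsing (map_weierstrass of_int W :: 'a::prime_card mod_ring weierstrass))"
proof -
  have "finite (ns_points_mod W CARD('a))" using finite_points_mod by (simp add: ns_points_mod_def)
  then show ?thesis unfolding residue_point_image[symmetric]
    by (rule finite_imageD) (rule inj_on_subset[OF inj_residue_point], simp)
qed

context prime_field
begin

lemma rat_mod_eq:
  assumes "pdiv p 0 r"
  shows "rat_mod CARD('a) r = to_int_mod_ring (rd r)"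
proof -
  obtain a b where ab: "quotient_of r = (a, b)" by fastforce
  have b: "\<not> p dvd b" using assms ab integral_iff_denominator by simp
  then have "coprime b p" using prime prime_imp_coprime coprime_commute by blast
  then have "[b * modular_inverse p b = 1] (mod p)" by (rule cong_modular_inverse1)
  then have "p dvd b * modular_inverse p b - 1" by (simp add: cong_iff_dvd_diff)
  then have "(of_int (b * modular_inverse p b - 1) :: 'a mod_ring) = 0" by (simp only: of_int_eq_0_iff' not_False_eq_True)
  then have "(of_int b :: 'a mod_ring) * of_int (modular_inverse p b) = 1" by simp
  moreover have "(of_int b :: 'a mod_ring) \<noteq> 0" using b by (simp add: of_int_eq_0_iff')
  ultimately have "(of_int (modular_inverse p b) :: 'a mod_ring) = 1 / of_int b" by (metis nonzero_eq_divide_eq mult.commute)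
  then have "rd r = of_int (a * modular_inverse p b)" unfolding rd_eq red_def ab by simp
  then show ?thesis unfolding rat_mod_def ab by (simp add: to_int_of_int_mod_ring p_eq del: of_int_mult)
qed

lemma reduce_point_eq:
  assumes "Q \<in> curve_points (over_rat W)"
  shows "reduce_point CARD('a) Q = residue_point (redpt Q)"
proof (cases Q)
  case (Affine x y)
  then have "weierstrass_poly (over_rat W) x y = 0" using assms by (auto simp: curve_points_def)
  then have "pdiv p 0 x \<Longrightarrow> pdiv p 0 y" by (rule integral_ordinate)
  then show ?thesis using rat_mod_eq integral_iff_denominator[of x] by (auto simp: Affine p_eq[symmetric])
qed simp

end

context eds_curve
begin

text \<open>\<open>p\<close> divides \<open>D n\<close> exactly when the \<open>n\<close>-th
  multiple reduces to infinity, so the rank of apparition is the order of the reduced point in a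
  finite group, and Lagrange's theorem applies.\<close>

lemma rank_app_dvd_card_mod_ring:
  fixes ty :: "'a::prime_card itself"
  assumes ns: "reduce_point CARD('a) P \<in> ns_points_mod W CARD('a)"
  shows "rank_app D CARD('a) dvd card (ns_points_mod W CARD('a)) \<and> rank_app D CARD('a) \<ge> 1"
proof -
  interpret F: prime_field "int CARD('a)" "red :: rat \<Rightarrow> 'a mod_ring"
    by unfold_locales (simp_all add: prime_card)
  let ?F = "map_weierstrass of_int W :: 'a mod_ring weierstrass"
  let ?R = "F.redpt P"
  have disc: "discriminant V \<noteq> 0" using elliptic by (simp add: discriminant_of_int elliptic_curve_def)
  have R: "?R \<in> nonsing ?F"
    using ns unfolding F.reduce_point_eq[OF P_curve] residue_point_nonsing .
  interpret G: comm_group "ec_group ?F" by (rule comm_group_ec_group)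
  have fin: "finite (carrier (ec_group ?F))" by (simp add: finite_nonsing)
  have dvd_iff: "CARD('a) dvd D n \<longleftrightarrow> G.ord ?R dvd n" if n: "n \<ge> 1" for n
  proof -
    obtain x y where xy: "mul n = Affine x y"
      using inf n unfolding infinite_order_def by (cases "mul n") auto
    have "CARD('a) dvd D n \<longleftrightarrow> \<not> pdiv (int CARD('a)) 0 x"
      using integral_iff_not_dvd[OF prime_card[where 'a='a] n xy] by simp
    also have "\<dots> \<longleftrightarrow> F.redpt (mul n) = Infinity" unfolding xy by simp
    also have "\<dots> \<longleftrightarrow> ?R [^]\<^bsub>ec_group ?F\<^esub> n = \<one>\<^bsub>ec_group ?F\<^esub>"
      unfolding F.redpt_mult[OF disc P_curve R] point_mult_eq_pow[OF R] by simp
    also have "\<dots> \<longleftrightarrow> G.ord ?R dvd n" using R G.pow_eq_id by simp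
    finally show ?thesis .
  qed
  have o1: "G.ord ?R \<ge> 1" using G.ord_ge_1[OF fin] R by simp
  have "rank_app D CARD('a) = G.ord ?R"
  proof -
    have d: "CARD('a) dvd D (G.ord ?R)" using dvd_iff[OF o1] by simp
    have ex: "\<exists>r\<ge>1. CARD('a) dvd D r" by (rule exI[of _ "G.ord ?R"]) (use o1 d in simp)
    have "(LEAST r. r \<ge> 1 \<and> CARD('a) dvd D r) = G.ord ?R"
    proof (rule Least_equality)
      show "G.ord ?R \<le> r" if "1 \<le> r \<and> CARD('a) dvd D r" for r
        using that dvd_iff[of r] by (auto intro: dvd_imp_le)
    qed (use o1 d in simp)
    then show ?thesis using ex by (simp add: rank_app_def)
  qed
  moreover have "G.ord ?R dvd Coset.order (ec_group ?F)" using G.ord_dvd_group_order[of ?R] R by simp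
  ultimately show ?thesis using o1 by (simp add: Coset.order_def card_ns_points_mod)
qed

end

section \<open>The Hasse bound\<close>

text \<open>
  Manin's proof: on the twist \<open>\<lambda> y\<^sup>2 = x\<^sup>3 + a x + b\<close>, \<open>\<lambda> = t\<^sup>3 + a t + b\<close>, over the
  function field, the degrees of the abscissas of \<open>(t\<^sup>p, \<lambda>\<^sup>(\<^sup>p\<^sup>-\<^sup>1\<^sup>)\<^sup>/\<^sup>2) + k (t, 1)\<close> form a
  quadratic polynomial in \<open>k\<close> which is nonnegative at all integers. Rescaling by \<open>\<lambda>\<close> turns the
  twist into a Weierstrass equation.
\<close>

definition sum_form :: "'a::comm_ring_1 \<Rightarrow> 'a \<Rightarrow> 'a \<Rightarrow> 'a \<Rightarrow> 'a \<Rightarrow> 'a" where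
  "sum_form a b t X Z = 2 * ((X * t + a * Z) * (X + t * Z) + 2 * b * Z^2)"

definition prod_form :: "'a::comm_ring_1 \<Rightarrow> 'a \<Rightarrow> 'a \<Rightarrow> 'a \<Rightarrow> 'a \<Rightarrow> 'a" where
  "prod_form a b t X Z = (X * t - a * Z)^2 - 4 * b * Z * (X + t * Z)"

definition denom_form :: "'a::comm_ring_1 \<Rightarrow> 'a \<Rightarrow> 'a \<Rightarrow> 'a" where
  "denom_form t X Z = (X - t * Z)^2"

text \<open>\<open>f / g\<close> is the abscissa on the twist, hence the division by
  \<open>lam\<close>; the point at infinity has abscissa \<open>(1 : 0)\<close> up to
  scaling.\<close>

fun scaled_abscissa :: "'a::field \<Rightarrow> 'a point \<Rightarrow> 'a \<Rightarrow> 'a \<Rightarrow> bool" where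
  "scaled_abscissa lam Infinity f g \<longleftrightarrow> f \<noteq> 0 \<and> g = 0"
| "scaled_abscissa lam (Affine x y) f g \<longleftrightarrow> g \<noteq> 0 \<and> f = x / lam * g"

locale twisted_curve =
  fixes a b t lam :: "'a::field" and W P
  assumes lam: "lam = t^3 + a * t + b" "lam \<noteq> 0" and two: "(2::'a) \<noteq> 0"
    and W_def: "W = Weierstrass 0 0 0 (a * lam^2) (b * lam^3)"
    and P_def: "P = Affine (lam * t) (lam^2)"
begin

lemma wa_simps [simp]: "wa1 W = 0" "wa2 W = 0" "wa3 W = 0" "wa4 W = a * lam^2" "wa6 W = b * lam^3"
  by (simp_all add: W_def)

lemma neg_P: "point_neg W P = Affine (lam * t) (- (lam^2))"
  by (simp add: P_def)

lemma double_P: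
  obtains y where "point_add W P P = Affine (lam * (((t^2 - a)^2 - 8 * b * t) / (4 * lam))) y"
    "point_add W (point_neg W P) (point_neg W P) = Affine (lam * (((t^2 - a)^2 - 8 * b * t) / (4 * lam))) (- y)"
proof -
  have four: "(4::'a) \<noteq> 0" using two by (metis mult_2 mult_eq_0_iff numeral_Bit0)
  have l2: "2 * lam^2 \<noteq> 0" "- (2 * lam^2) \<noteq> 0" using two lam(2) by simp_all
  define l where "l = (3 * t^2 + a) / 2"
  have l: "2 * l = 3 * t^2 + a" using two by (simp add: l_def)
  define x3 where "x3 = l^2 - lam * t - lam * t"
  have e1: "(3 * (lam * t)^2 + a * lam^2) / (2 * lam^2) = l"
  proof -
    have "l * (2 * lam^2) = (2 * l) * lam^2" by Groebner_Basis.algebra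
    also have "\<dots> = 3 * (lam * t)^2 + a * lam^2" unfolding l by Groebner_Basis.algebra
    finally show ?thesis using l2(1) by (metis nonzero_divide_eq_eq)
  qed
  have e2: "(3 * (lam * t)^2 + a * lam^2) / - (2 * lam^2) = - l"
    unfolding e1[symmetric] by simp
  have n: "lam^2 + lam^2 \<noteq> 0" "- (lam^2) + - (lam^2) \<noteq> 0"
    using l2 unfolding mult_2 minus_add_distrib .
  have 1: "point_add W P P = Affine x3 (- l * x3 - (lam^2 - l * (lam * t)))"
    unfolding P_def by (subst point_add_Affine[of _ _ _ _ _ l x3]) (use n e1 in \<open>simp_all add: x3_def\<close>)
  have 2: "point_add W (point_neg W P) (point_neg W P) = Affine x3 (l * x3 - (- (lam^2) + l * (lam * t)))"
    unfolding neg_P by (subst point_add_Affine[of _ _ _ _ _ "- l" x3]) (use n e2 in \<open>simp_all add: x3_def\<close>)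
  have "4 * x3 = (2 * l)^2 - 8 * (lam * t)" unfolding x3_def by Groebner_Basis.algebra
  also have "\<dots> = (t^2 - a)^2 - 8 * b * t" unfolding l lam by Groebner_Basis.algebra
  finally have "x3 = ((t^2 - a)^2 - 8 * b * t) / 4"
    using four by (metis nonzero_mult_div_cancel_left)
  then have x3: "lam * (((t^2 - a)^2 - 8 * b * t) / (4 * lam)) = x3" using lam(2) by simp
  have neg: "l * x3 - (- (lam^2) + l * (lam * t)) = - (- l * x3 - (lam^2 - l * (lam * t)))" by simp
  show ?thesis
    by (rule that[of "- l * x3 - (lam^2 - l * (lam * t))"]) (simp_all only: 1 2 x3 neg)
qed

lemma curve_cases:
  assumes "Q \<in> curve_points W"
  obtains "Q = Infinity" | "Q = P" | "Q = point_neg W P"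
  | x y where "Q = Affine x y" "y^2 = x^3 + a * lam^2 * x + b * lam^3" "x \<noteq> lam * t"
proof (cases Q)
  case (Affine x y)
  then have c: "y^2 = x^3 + a * lam^2 * x + b * lam^3"
    using assms by (auto simp: curve_points_def weierstrass_poly_def)
  show ?thesis
  proof (cases "x = lam * t")
    case True
    have y2: "y^2 = lam^3 * (t^3 + a * t + b)" unfolding c True by Groebner_Basis.algebra
    have "(y - lam^2) * (y + lam^2) = 0" using y2[folded lam(1)] by Groebner_Basis.algebra
    then have "y = lam^2 \<or> y = - (lam^2)" by (auto simp: eq_neg_iff_add_eq_0)
    then show ?thesis using that Affine True neg_P P_def by auto
  qed (use that Affine c in auto)
qed (use that in auto)

text \<open>\<open>m\<close> and \<open>m'\<close> are the squared slopes of the lines to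
  \<open>P\<close> and to its negative, divided by \<open>lam\<close>. They are exchanged by
  \<open>y\<close> to \<open>- y\<close>, so their sum and product involve \<open>y\<close> only
  through \<open>y^2 = lam^3 * u\<close>.\<close>

lemma chord_coordinates:
  assumes y: "y^2 = x^3 + a * lam^2 * x + b * lam^3" and x: "x \<noteq> lam * t"
  obtains X3 X4 y3 y4 where
    "point_add W (Affine x y) P = Affine (lam * X3) y3"
    "point_add W (Affine x y) (point_neg W P) = Affine (lam * X4) y4"
    "(X3 + X4) * denom_form t (x / lam) 1 = sum_form a b t (x / lam) 1"
    "X3 * X4 * denom_form t (x / lam) 1 = prod_form a b t (x / lam) 1"
proof -
  define X where "X = x / lam"
  have xX: "x = lam * X" using lam(2) by (simp add: X_def)
  define d where "d = t - X"
  have d0: "d \<noteq> 0" using x xX by (auto simp: d_def)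
  define u where "u = X^3 + a * X + b"
  have y2: "y^2 = lam^3 * u" unfolding y xX u_def by Groebner_Basis.algebra
  have ld: "lam * t - x = lam * d" unfolding xX d_def by (simp add: algebra_simps)
  define l l' where "l = (lam^2 - y) / (lam * d)" and "l' = (- (lam^2) - y) / (lam * d)"
  define m m' where "m = l^2 / lam" and "m' = l'^2 / lam"
  define X3 X4 where "X3 = m - X - t" and "X4 = m' - X - t"
  have lX: "l^2 - x - lam * t = lam * X3" "l'^2 - x - lam * t = lam * X4"
    unfolding X3_def X4_def m_def m'_def xX using lam(2) by (simp_all add: algebra_simps)
  have l1: "l * (lam * t - x) = lam^2 - y" "l' * (lam * t - x) = - (lam^2) - y"
    unfolding ld l_def l'_def using d0 lam(2) by simp_all
  have A: "point_add W (Affine x y) P = Affine (lam * X3) (- l * (lam * X3) - (y - l * x))"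
    using point_add_chord[OF x, of l "lam^2" y "lam * X3" W] l1 lX by (simp add: P_def)
  have B: "point_add W (Affine x y) (point_neg W P) = Affine (lam * X4) (- l' * (lam * X4) - (y - l' * x))"
    using point_add_chord[OF x, of l' "- (lam^2)" y "lam * X4" W] l1 lX unfolding neg_P by simp
  have lld: "l * (lam * d) = lam^2 - y" "l' * (lam * d) = - (lam^2) - y"
    using l1 unfolding ld .
  have md: "lam^3 * (m * d^2) = (lam^2 - y)^2" "lam^3 * (m' * d^2) = (lam^2 + y)^2"
  proof -
    have "lam^3 * (m * d^2) = (m * lam) * (lam * d)^2" "lam^3 * (m' * d^2) = (m' * lam) * (lam * d)^2"
      by Groebner_Basis.algebra+
    moreover have "m * lam = l^2" "m' * lam = l'^2" using lam(2) by (simp_all add: m_def m'_def)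
    ultimately have "lam^3 * (m * d^2) = (l * (lam * d))^2" "lam^3 * (m' * d^2) = (l' * (lam * d))^2"
      by (simp_all add: power_mult_distrib)
    then show "lam^3 * (m * d^2) = (lam^2 - y)^2" "lam^3 * (m' * d^2) = (lam^2 + y)^2"
      unfolding lld by (Groebner_Basis.algebra+)
  qed
  have "lam^3 * ((m + m') * d^2) = (lam^2 - y)^2 + (lam^2 + y)^2" using md by (simp add: algebra_simps)
  also have "\<dots> = lam^3 * (2 * lam + 2 * u)" using y2 by Groebner_Basis.algebra
  finally have s: "(m + m') * d^2 = 2 * lam + 2 * u" using lam(2) by simp
  \<comment> \<open>\<open>lam\<close> and \<open>u\<close> are values of the same cubic at
    \<open>t\<close> and \<open>X\<close>, so \<open>d\<close> divides their difference; this
    cancels one of the two factors \<open>d^2\<close> in the product of \<open>m\<close> and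
    \<open>m'\<close>.\<close>
  define q where "q = t^2 + t * X + X^2 + a"
  have q: "lam - u = d * q" unfolding lam u_def d_def q_def by Groebner_Basis.algebra
  have "lam^6 * (m * m' * (d^2 * d^2)) = (lam^3 * (m * d^2)) * (lam^3 * (m' * d^2))" by Groebner_Basis.algebra
  also have "\<dots> = (lam^4 - y^2)^2" unfolding md by Groebner_Basis.algebra
  also have "\<dots> = lam^6 * (lam - u)^2" unfolding y2 by Groebner_Basis.algebra
  also have "\<dots> = lam^6 * (q^2 * d^2)" unfolding q by Groebner_Basis.algebra
  finally have "m * m' * d^2 * d^2 = q^2 * d^2" using lam(2) by (simp add: mult.assoc)
  then have pr: "m * m' * d^2 = q^2" using d0 by simp
  have den: "denom_form t X 1 = d^2" unfolding denom_form_def d_def mult_1_right by Groebner_Basis.algebra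
  have "(X3 + X4) * d^2 = (m + m') * d^2 - 2 * (X + t) * d^2" unfolding X3_def X4_def by Groebner_Basis.algebra
  also have "\<dots> = sum_form a b t X 1" unfolding s unfolding lam u_def d_def sum_form_def power_one mult_1_right by Groebner_Basis.algebra
  finally have S: "(X3 + X4) * denom_form t X 1 = sum_form a b t X 1" unfolding den .
  have "X3 * X4 * d^2 = m * m' * d^2 - (X + t) * ((m + m') * d^2) + (X + t)^2 * d^2"
    unfolding X3_def X4_def by Groebner_Basis.algebra
  also have "\<dots> = prod_form a b t X 1" unfolding s pr unfolding lam u_def d_def q_def prod_form_def power_one mult_1_right by Groebner_Basis.algebra
  finally have "X3 * X4 * denom_form t X 1 = prod_form a b t X 1" unfolding den .
  then show ?thesis using that A B S unfolding X_def by blast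
qed

text \<open>
  The abscissas of \<open>Q + P\<close> and \<open>Q - P\<close>, as points of the projective line, are the roots of
  the binary quadratic form with coefficients \<open>denom_form, - sum_form, prod_form\<close>.
\<close>

lemma abscissa_forms:
  assumes Q: "Q \<in> curve_points W" and f: "scaled_abscissa lam Q f g"
    and f3: "scaled_abscissa lam (point_add W Q P) f3 g3"
    and f4: "scaled_abscissa lam (point_add W Q (point_neg W P)) f4 g4"
  shows "f3 * f4 * denom_form t f g = g3 * g4 * prod_form a b t f g"
    "(f3 * g4 + f4 * g3) * denom_form t f g = g3 * g4 * sum_form a b t f g"
    "f3 * f4 * sum_form a b t f g = (f3 * g4 + f4 * g3) * prod_form a b t f g"
proof -
  have four: "(4::'a) \<noteq> 0" using two by (metis mult_2 mult_eq_0_iff numeral_Bit0)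
  have hom: "sum_form a b t (X * c) c = c^2 * sum_form a b t X 1" 
    "prod_form a b t (X * c) c = c^2 * prod_form a b t X 1" 
    "denom_form t (X * c) c = c^2 * denom_form t X 1" for X c
    unfolding sum_form_def prod_form_def denom_form_def power_one mult_1_right by Groebner_Basis.algebra+
  have tt: "denom_form t t 1 = 0" "sum_form a b t t 1 = 4 * lam" "prod_form a b t t 1 = (t^2 - a)^2 - 8 * b * t"
  proof -
    show "denom_form t t 1 = 0" by (simp add: denom_form_def)
    show "sum_form a b t t 1 = 4 * lam" "prod_form a b t t 1 = (t^2 - a)^2 - 8 * b * t"
      unfolding sum_form_def prod_form_def lam power_one mult_1_right by Groebner_Basis.algebra+
  qed
  have PP: "point_add W P (point_neg W P) = Infinity" "point_add W (point_neg W P) P = Infinity"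
    by (simp_all add: point_add_eq_Infinity_iff)
  define X2 where "X2 = ((t^2 - a)^2 - 8 * b * t) / (4 * lam)"
  have X2: "X2 * (4 * lam) = (t^2 - a)^2 - 8 * b * t"
    unfolding X2_def using four lam(2) by simp
  have lX: "lam * Y / lam = Y" for Y using lam(2) by simp
  obtain y2 where dbl: "point_add W P P = Affine (lam * X2) y2" 
    "point_add W (point_neg W P) (point_neg W P) = Affine (lam * X2) (- y2)"
    unfolding X2_def by (rule double_P)
  have "f3 * f4 * denom_form t f g = g3 * g4 * prod_form a b t f g \<and>
    (f3 * g4 + f4 * g3) * denom_form t f g = g3 * g4 * sum_form a b t f g \<and>
    f3 * f4 * sum_form a b t f g = (f3 * g4 + f4 * g3) * prod_form a b t f g"
    using Q
  proof (cases rule: curve_cases)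
    case 1
    have g: "g = 0" using f 1 by simp
    have "f3 = t * g3" using f3 unfolding 1 P_def by (simp add: lX)
    moreover have "f4 = t * g4" using f4 unfolding 1 neg_P by (simp add: lX)
    ultimately show ?thesis unfolding g sum_form_def prod_form_def denom_form_def
      by (simp add: power2_eq_square algebra_simps)
  next
    case 2
    have g: "f = t * g" using f unfolding 2 P_def by (simp add: lX)
    have 3: "f3 = X2 * g3" using f3 unfolding 2 dbl by (simp add: lX)
    have 4: "g4 = 0" using f4 unfolding 2 PP by simp
    show ?thesis unfolding g 3 4 hom tt X2[symmetric] by (simp add: algebra_simps)
  next
    case 3
    have g: "f = t * g" using f unfolding 3 neg_P by (simp add: lX)
    have 4: "f4 = X2 * g4" using f4 unfolding 3 dbl by (simp add: lX)
    have 3: "g3 = 0" using f3 unfolding 3 PP by simp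
    show ?thesis unfolding g 3 4 hom tt X2[symmetric] by (simp add: algebra_simps)
  next
    case (4 x y)
    obtain X3 X4 y3 y4 where *:
      "point_add W (Affine x y) P = Affine (lam * X3) y3"
      "point_add W (Affine x y) (point_neg W P) = Affine (lam * X4) y4"
      "(X3 + X4) * denom_form t (x / lam) 1 = sum_form a b t (x / lam) 1"
      "X3 * X4 * denom_form t (x / lam) 1 = prod_form a b t (x / lam) 1"
      using 4(2,3) by (rule chord_coordinates)
    have g: "f = x / lam * g" using f unfolding 4 by simp
    have 3: "f3 = X3 * g3" "f4 = X4 * g4" using f3 f4 unfolding 4 * by (simp_all add: lX)
    show ?thesis unfolding g 3 hom *(3,4)[symmetric] by (simp add: algebra_simps)
  qed
  then show "f3 * f4 * denom_form t f g = g3 * g4 * prod_form a b t f g"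
    "(f3 * g4 + f4 * g3) * denom_form t f g = g3 * g4 * sum_form a b t f g"
    "f3 * f4 * sum_form a b t f g = (f3 * g4 + f4 * g3) * prod_form a b t f g" by auto
qed

end

section \<open>Degrees of the forms and proportional triples\<close>

lemma degree_mult_leI:
  "degree p \<le> m \<Longrightarrow> degree q \<le> n \<Longrightarrow> m + n \<le> k \<Longrightarrow> degree (p * q) \<le> k"
  using degree_mult_le[of p q] by linarith

lemma degree_diff_eq_left: "degree q < degree p \<Longrightarrow> degree (p - q) = degree p" for p q :: "'a::ab_group_add poly"
  using degree_add_eq_left[of "- q" p] by simp

lemma degree_eq_if_dvd_dvd: "p dvd q \<Longrightarrow> q dvd p \<Longrightarrow> degree p = degree q" for p q :: "'a::idom poly"
  by (metis dvd_imp_degree_le dvd_0_left_iff order.antisym)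

text \<open>A pole of \<open>f / g\<close> at infinity makes the square of
  \<open>f * [:0, 1:]\<close> dominate all three forms; the \<open>+ 2\<close> is the contribution
  of the base point, whose abscissa is the variable itself.\<close>

lemma degree_forms:
  fixes f g :: "'a::field poly"
  assumes f: "f \<noteq> 0" and g: "g = 0 \<or> degree g < degree f"
  shows "degree (prod_form [:a:] [:b:] [:0, 1:] f g) = 2 * degree f + 2"
    "degree (sum_form [:a:] [:b:] [:0, 1:] f g) < 2 * degree f + 2"
    "degree (denom_form [:0, 1:] f g) < 2 * degree f + 2"
proof -
  let ?T = "[:0, 1:] :: 'a poly"
  have gf: "degree g \<le> degree f" using g by auto
  have Tg: "degree (?T * g) \<le> degree f" using g by (auto simp: degree_mult_eq)
  have ag: "degree ([:a:] * g) \<le> degree f" using gf by simp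
  have fT: "degree (f * ?T) = degree f + 1" using f by (simp add: degree_mult_eq)
  have 1: "degree (f * ?T - [:a:] * g) = degree f + 1"
    using fT ag by (subst degree_diff_eq_left) simp_all
  then have "f * ?T - [:a:] * g \<noteq> 0" by auto
  then have 2: "degree ((f * ?T - [:a:] * g)^2) = 2 * degree f + 2" using 1 by (simp add: degree_power_eq)
  have fTg: "degree (f + ?T * g) \<le> degree f" by (intro degree_add_le order.refl Tg)
  have "degree (4 * [:b:] * g * (f + ?T * g)) \<le> 2 * degree f"
    by (rule degree_mult_leI[OF degree_mult_leI[OF degree_mult_leI[of 4 0 "[:b:]" 0 0] gf order.refl] fTg]) simp_all
  then show "degree (prod_form [:a:] [:b:] ?T f g) = 2 * degree f + 2"
    unfolding prod_form_def using 2 by (subst degree_diff_eq_left) simp_all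
  have "degree ((f * ?T + [:a:] * g) * (f + ?T * g)) \<le> 2 * degree f + 1"
    by (rule degree_mult_leI[OF degree_add_le[of _ "degree f + 1"] fTg]) (use fT ag in auto)
  moreover have "degree (2 * [:b:] * g^2) \<le> 2 * degree f + 1"
    unfolding power2_eq_square
    by (rule degree_mult_leI[OF degree_mult_leI[of 2 0 "[:b:]" 0 0] degree_mult_leI[OF gf gf order.refl]]) simp_all
  ultimately have "degree ((f * ?T + [:a:] * g) * (f + ?T * g) + 2 * [:b:] * g^2) \<le> 2 * degree f + 1"
    by (rule degree_add_le)
  then have "degree (sum_form [:a:] [:b:] ?T f g) \<le> 2 * degree f + 1"
    unfolding sum_form_def by (intro degree_mult_leI[of 2 0]) simp_all
  then show "degree (sum_form [:a:] [:b:] ?T f g) < 2 * degree f + 2" by simp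
  have "degree (f - ?T * g) \<le> degree f" by (intro degree_diff_le order.refl Tg)
  then have "degree (denom_form ?T f g) \<le> 2 * degree f"
    unfolding denom_form_def power2_eq_square by (intro degree_mult_leI[of _ "degree f" _ "degree f"]) simp_all
  then show "degree (denom_form ?T f g) < 2 * degree f + 2" by simp
qed

text \<open>If \<open>g3\<close> had at least the degree of \<open>f3\<close>, the last bound would
  give \<open>g4\<close> a smaller degree than \<open>f4\<close>, and then \<open>f4 * g3\<close>
  could not be cancelled in the middle expression.\<close>

lemma pole_at_infinity:
  fixes f3 f4 g3 g4 :: "'a::field poly"
  assumes "f3 * f4 \<noteq> 0" "degree (f3 * g4 + f4 * g3) < degree (f3 * f4)" "degree (g3 * g4) < degree (f3 * f4)"
  shows "g3 = 0 \<or> degree g3 < degree f3"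
proof (rule ccontr)
  assume n: "\<not> (g3 = 0 \<or> degree g3 < degree f3)"
  have nz: "f3 \<noteq> 0" "f4 \<noteq> 0" "g3 \<noteq> 0" using assms(1) n by auto
  have d: "degree (f3 * f4) = degree f3 + degree f4" "degree (f4 * g3) = degree f4 + degree g3"
    using nz by (simp_all add: degree_mult_eq)
  show False
  proof (cases "g4 = 0")
    case True
    then show False using assms(2) d n by simp
  next
    case False
    then have e: "degree (g3 * g4) = degree g3 + degree g4" "degree (f3 * g4) = degree f3 + degree g4"
      using nz by (simp_all add: degree_mult_eq)
    then have "degree (f3 * g4) < degree (f4 * g3)" using assms(3) d n by linarith
    then have "degree (f3 * g4 + f4 * g3) = degree (f4 * g3)" by (rule degree_add_eq_right)
    then show False using assms(2) d n by linarith
  qed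
qed

text \<open>Write 1 as a Bezout combination of the \<open>v\<close> and multiply by
  \<open>u1\<close>: the vanishing minors turn every summand into a multiple of
  \<open>v1\<close>.\<close>

lemma cross_ratio_dvd:
  fixes u1 u2 u3 v1 v2 v3 :: "'b::euclidean_ring_gcd"
  assumes "gcd (gcd v1 v2) v3 = 1" "u1 * v2 = v1 * u2" "u1 * v3 = v1 * u3"
  shows "v1 dvd u1"
proof -
  obtain r s where "r * v1 + s * v2 = gcd v1 v2" using bezout_coefficients_fst_snd by metis
  moreover obtain r' s' where "r' * gcd v1 v2 + s' * v3 = 1"
    using bezout_coefficients_fst_snd assms(1) by metis
  ultimately have "1 = r' * (r * v1 + s * v2) + s' * v3" by simp
  then have "u1 = u1 * (r' * (r * v1 + s * v2) + s' * v3)" by simp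
  also have "\<dots> = r' * r * v1 * u1 + r' * s * (u1 * v2) + s' * (u1 * v3)" by (simp add: algebra_simps)
  also have "\<dots> = v1 * (r' * r * u1 + r' * s * u2 + s' * u3)" unfolding assms(2,3) by (simp add: algebra_simps)
  finally show ?thesis by (rule dvdI)
qed

lemma gcd3_eq_1I:
  fixes v1 v2 v3 :: "'b::factorial_ring_gcd"
  assumes "\<And>q. prime q \<Longrightarrow> q dvd v1 \<Longrightarrow> q dvd v2 \<Longrightarrow> q dvd v3 \<Longrightarrow> False" "v1 \<noteq> 0"
  shows "gcd (gcd v1 v2) v3 = 1"
proof (rule ccontr)
  assume "gcd (gcd v1 v2) v3 \<noteq> 1"
  then have "\<not> is_unit (gcd (gcd v1 v2) v3)" by (simp add: is_unit_gcd_iff)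
  moreover have "gcd (gcd v1 v2) v3 \<noteq> 0" using assms(2) by simp
  ultimately obtain q where "prime q" "q dvd gcd (gcd v1 v2) v3" using prime_divisor_exists by blast
  then show False using assms(1)[of q] by (meson dvd_trans gcd_dvd1 gcd_dvd2)
qed

section \<open>Heights of points over the rational function field\<close>

locale function_field_curve =
  fixes a b :: "'a::field_gcd"
  assumes disc: "4 * a^3 + 27 * b^2 \<noteq> 0" and char2: "(2::'a) \<noteq> 0"
begin

definition T :: "'a poly" where "T = [:0, 1:]"
definition cub :: "'a poly" where "cub = [:b, a, 0, 1:]"

lemma cub_eq: "cub = T^3 + [:a:] * T + [:b:]"
  by (simp add: cub_def T_def power3_eq_cube)

lemma cub_nz: "cub \<noteq> 0" by (simp add: cub_def)

definition FW :: "'a poly fract weierstrass" where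
  "FW = Weierstrass 0 0 0 (to_fract [:a:] * to_fract cub^2) (to_fract [:b:] * to_fract cub^3)"

definition FP :: "'a poly fract point" where
  "FP = Affine (to_fract cub * to_fract T) (to_fract cub^2)"

lemma to_fract_power: "to_fract (x ^ n) = to_fract x ^ n"
  by (induction n) simp_all

lemma to_fract_numeral: "to_fract (numeral n) = numeral n"
proof -
  have "to_fract (of_nat k) = of_nat k" for k by (induction k) simp_all
  from this[of "numeral n"] show ?thesis by simp
qed

sublocale twisted_curve "to_fract [:a:]" "to_fract [:b:]" "to_fract T" "to_fract cub" FW FP
proof
  show "to_fract cub = to_fract T ^ 3 + to_fract [:a:] * to_fract T + to_fract [:b:]"
    unfolding cub_eq by (simp only: to_fract_add to_fract_mult to_fract_power)
  show "(2 :: 'a poly fract) \<noteq> 0"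
  proof -
    have "(2 :: 'a poly) = [:2:]" by (simp add: numeral_poly)
    then have "(2 :: 'a poly) \<noteq> 0" using char2 by (metis pCons_eq_0_iff)
    then show ?thesis by (metis to_fract_eq_0_iff to_fract_numeral)
  qed
qed (simp_all add: cub_nz FW_def FP_def)

text \<open>Modulo a prime factor of \<open>denom_form\<close> one has \<open>f = T * g\<close>, and
  the other two forms become \<open>g^2\<close> times the denominator and the numerator of the
  duplication formula. A common factor of these divides the discriminant, a nonzero
  constant.\<close>

lemma no_common_prime_forms:
  assumes "coprime f g" and q: "prime q" "q dvd denom_form T f g" "q dvd sum_form [:a:] [:b:] T f g"
    "q dvd prod_form [:a:] [:b:] T f g"
  shows False
proof -
  let ?a = "[:a:]" and ?b = "[:b:]"
  have "q dvd f - T * g" using q(1,2) unfolding denom_form_def by (rule prime_dvd_power)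
  then obtain h where h: "f = T * g + q * h" by (metis dvdE diff_eq_eq add.commute)
  have "sum_form ?a ?b T f g = 4 * cub * g^2 + q * (2 * (h * T * (2 * T * g + q * h) + h * (T^2 * g + ?a * g)))"
    unfolding sum_form_def h cub_eq by Groebner_Basis.algebra
  then have 1: "q dvd 4 * cub * g^2" using q(3) by (simp add: dvd_add_left_iff)
  have "prod_form ?a ?b T f g = ((T^2 - ?a)^2 - 8 * ?b * T) * g^2 + q * (h * T * (2 * (T^2 - ?a) * g + q * h * T) - 4 * ?b * g * h)"
    unfolding prod_form_def h by Groebner_Basis.algebra
  then have 2: "q dvd ((T^2 - ?a)^2 - 8 * ?b * T) * g^2" using q(4) by (simp add: dvd_add_left_iff)
  have ng: "\<not> q dvd g"
  proof
    assume "q dvd g"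
    then have "q dvd f" unfolding h by simp
    then show False using \<open>q dvd g\<close> assms(1) q(1) by (meson coprime_common_divisor not_prime_unit)
  qed
  then have ng2: "\<not> q dvd g^2" using q(1) prime_dvd_power by blast
  have c4: "is_unit (4 :: 'a poly)"
  proof -
    have "(4::'a) \<noteq> 0" using char2 by (metis mult_2 mult_eq_0_iff numeral_Bit0)
    then have "[:4:] * [:inverse 4 :: 'a:] = 1" by (simp add: one_pCons)
    then have "is_unit [:4 :: 'a:]" by (rule dvdI[OF sym])
    then show ?thesis by (simp only: numeral_poly)
  qed
  have "q dvd 4 * cub" using 1 ng2 q(1) by (simp add: prime_dvd_mult_iff)
  then have 3: "q dvd cub" using c4 q(1) by (metis not_prime_unit dvd_trans prime_dvd_mult_iff)
  have 4: "q dvd (T^2 - ?a)^2 - 8 * ?b * T" using 2 ng2 q(1) by (simp add: prime_dvd_mult_iff)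
  \<comment> \<open>The Bezout relation between the two polynomials of the duplication formula, up
    to the constant 4.\<close>
  have "(3 * T^2 + 4 * ?a) * ((T^2 - ?a)^2 - 8 * ?b * T) - (3 * T^3 - 5 * ?a * T - 27 * ?b) * cub
    = 4 * ?a^3 + 27 * ?b^2"
    unfolding cub_eq by Groebner_Basis.algebra
  then have "q dvd 4 * ?a^3 + 27 * ?b^2" using 3 4 by (metis dvd_diff dvd_mult)
  also have "4 * ?a^3 + 27 * ?b^2 = [:4 * a^3 + 27 * b^2:]"
    by (simp add: power2_eq_square power3_eq_cube numeral_poly)
  finally have "is_unit q" using disc by (meson dvd_trans is_unit_const_poly_iff dvd_field_iff)
  then show False using q(1) not_prime_unit by blast
qed

definition rep :: "'a poly fract point \<Rightarrow> 'a poly \<Rightarrow> 'a poly \<Rightarrow> bool" where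
  "rep Q f g \<longleftrightarrow> coprime f g \<and> scaled_abscissa (to_fract cub) Q (to_fract f) (to_fract g)"

lemma rep_exists: "\<exists>f g. rep Q f g"
proof (cases Q)
  case Infinity
  have "rep Infinity 1 0" by (simp add: rep_def)
  then show ?thesis using Infinity by blast
next
  case (Affine x y)
  define z where "z = x / to_fract cub"
  have z: "z = to_fract (fst (quot_of_fract z)) / to_fract (snd (quot_of_fract z))"
    using Fract_quot_of_fract[of z] by (simp add: to_fract_def)
  have "to_fract (fst (quot_of_fract z)) = z * to_fract (snd (quot_of_fract z))"
    by (subst (2) z) simp
  then have "rep Q (fst (quot_of_fract z)) (snd (quot_of_fract z))"
    unfolding rep_def Affine by (simp add: coprime_quot_of_fract z_def)
  then show ?thesis by blast
qed

lemma rep_nz: "rep Q f g \<Longrightarrow> g = 0 \<Longrightarrow> f \<noteq> 0"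
  by (cases Q) (auto simp: rep_def)

lemma rep_unique_degree:
  assumes "rep Q f g" "rep Q f' g'"
  shows "degree f = degree f'" "g = 0 \<longleftrightarrow> g' = 0" "degree g = degree g'"
proof -
  have eq: "f * g' = f' * g"
  proof -
    have "to_fract f * to_fract g' = to_fract f' * to_fract g"
      using assms by (cases Q) (auto simp: rep_def)
    then show ?thesis by (metis to_fract_eq_iff to_fract_mult)
  qed
  have c: "coprime f g" "coprime f' g'" using assms by (auto simp: rep_def)
  have "f dvd f'" using eq c(1) by (metis coprime_dvd_mult_left_iff dvd_triv_left)
  moreover have "f' dvd f" using eq c(2) by (metis coprime_dvd_mult_left_iff dvd_triv_left)
  moreover have "g dvd g'" using eq c(1) by (metis coprime_commute coprime_dvd_mult_right_iff dvd_triv_right)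
  moreover have "g' dvd g" using eq c(2) by (metis coprime_commute coprime_dvd_mult_right_iff dvd_triv_right)
  ultimately show "degree f = degree f'" "g = 0 \<longleftrightarrow> g' = 0" "degree g = degree g'"
    by (auto intro: degree_eq_if_dvd_dvd)
qed

text \<open>The last condition means that the abscissa has a pole at infinity.\<close>

definition has_height :: "'a poly fract point \<Rightarrow> nat \<Rightarrow> bool" where
  "has_height Q n \<longleftrightarrow> (\<exists>f g. rep Q f g \<and> degree f = n \<and> (g = 0 \<or> degree g < degree f))"

lemma has_height_unique: "has_height Q m \<Longrightarrow> has_height Q n \<Longrightarrow> m = n"
  unfolding has_height_def using rep_unique_degree by metis

text \<open>By \<open>abscissa_forms\<close> the triple built from the abscissas of
  \<open>Q + P\<close> and \<open>Q - P\<close> is proportional to the triple of forms. Both are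
  primitive, so corresponding entries are associated and have equal degrees. This is the
  parallelogram law for heights; the constant 2 is twice the height of the base point, whose
  abscissa is \<open>T\<close>.\<close>

theorem height_parallelogram:
  assumes Q: "Q \<in> curve_points FW" and h: "has_height Q n"
  obtains n3 n4 where "has_height (point_add FW Q FP) n3" "has_height (point_add FW Q (point_neg FW FP)) n4"
    "n3 + n4 = 2 * n + 2"
proof -
  obtain f g where fg: "rep Q f g" "degree f = n" "g = 0 \<or> degree g < degree f"
    using h by (auto simp: has_height_def)
  obtain f3 g3 where 3: "rep (point_add FW Q FP) f3 g3" using rep_exists by blast
  obtain f4 g4 where 4: "rep (point_add FW Q (point_neg FW FP)) f4 g4" using rep_exists by blast
  have f0: "f \<noteq> 0" using fg rep_nz by auto
  let ?A = "sum_form [:a:] [:b:] T f g" and ?B = "prod_form [:a:] [:b:] T f g" and ?C = "denom_form T f g"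
  have emb: "to_fract ?A = sum_form (to_fract [:a:]) (to_fract [:b:]) (to_fract T) (to_fract f) (to_fract g)"
    "to_fract ?B = prod_form (to_fract [:a:]) (to_fract [:b:]) (to_fract T) (to_fract f) (to_fract g)"
    "to_fract ?C = denom_form (to_fract T) (to_fract f) (to_fract g)"
    unfolding sum_form_def prod_form_def denom_form_def
    by (simp_all only: to_fract_add to_fract_mult to_fract_diff to_fract_power to_fract_numeral)
  have sc: "scaled_abscissa (to_fract cub) Q (to_fract f) (to_fract g)"
    "scaled_abscissa (to_fract cub) (point_add FW Q FP) (to_fract f3) (to_fract g3)"
    "scaled_abscissa (to_fract cub) (point_add FW Q (point_neg FW FP)) (to_fract f4) (to_fract g4)"
    using fg 3 4 by (auto simp: rep_def)
  have cop: "coprime f g" "coprime f3 g3" "coprime f4 g4" using fg 3 4 by (auto simp: rep_def)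
  let ?u1 = "f3 * f4" and ?u2 = "f3 * g4 + f4 * g3" and ?u3 = "g3 * g4"
  have "to_fract (?u1 * ?C) = to_fract (?u3 * ?B)" "to_fract (?u2 * ?C) = to_fract (?u3 * ?A)"
    "to_fract (?u1 * ?A) = to_fract (?u2 * ?B)"
    using abscissa_forms[OF Q sc] by (simp_all add: emb)
  then have minors: "?u1 * ?C = ?u3 * ?B" "?u2 * ?C = ?u3 * ?A" "?u1 * ?A = ?u2 * ?B"
    by (simp_all only: to_fract_eq_iff)
  note deg = degree_forms(1)[OF f0 fg(3), of a b, folded T_def] degree_forms(2)[OF f0 fg(3), of a b, folded T_def]
    degree_forms(3)[OF f0 fg(3), folded T_def]
  have B0: "?B \<noteq> 0" using deg(1) by (metis degree_0 add_is_0 numeral_eq_iff zero_neq_numeral)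
  have gB: "gcd (gcd ?B ?A) ?C = 1"
    using no_common_prime_forms[OF cop(1)] by (intro gcd3_eq_1I B0) blast
  have m: "?u1 * ?A = ?B * ?u2" "?u1 * ?C = ?B * ?u3" "?u2 * ?C = ?A * ?u3"
    using minors by (simp_all only: mult.commute)
  have m': "?u2 * ?B = ?A * ?u1" "?u3 * ?B = ?C * ?u1" "?u3 * ?A = ?C * ?u2"
    using minors by (simp_all only: mult.commute)
  have "?B dvd ?u1" by (rule cross_ratio_dvd[OF gB m(1,2)])
  have u1: "?u1 \<noteq> 0"
  proof
    assume z: "?u1 = 0"
    then have "?u2 = 0" "?u3 = 0" using minors B0 by auto
    then show False using z cop by (auto simp: coprime_0_left_iff coprime_0_right_iff)
  qed
  \<comment> \<open>Gauss's lemma for the product of the primitive linear forms with coefficients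
    \<open>f3\<close>, \<open>g3\<close> and \<open>f4\<close>, \<open>g4\<close>.\<close>
  have "gcd (gcd ?u1 ?u2) ?u3 = 1"
  proof (intro gcd3_eq_1I u1)
    fix q assume q: "prime q" "q dvd ?u1" "q dvd ?u2" "q dvd ?u3"
    have n: "\<not> (q dvd f3 \<and> q dvd g3)" "\<not> (q dvd f4 \<and> q dvd g4)"
      using cop q(1) by (meson coprime_common_divisor not_prime_unit)+
    have d: "q dvd f3 \<or> q dvd f4" "q dvd g3 \<or> q dvd g4" using q by (simp_all add: prime_dvd_mult_iff)
    consider "q dvd f3" "q dvd g4" "\<not> q dvd g3" "\<not> q dvd f4" | "q dvd f4" "q dvd g3" "\<not> q dvd g4" "\<not> q dvd f3"
      using n d by blast
    then show False
    proof cases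
      case 1
      then have "q dvd f4 * g3" using q(3) by (simp add: dvd_add_right_iff)
      then show False using 1 q(1) by (simp add: prime_dvd_mult_iff)
    next
      case 2
      then have "q dvd f3 * g4" using q(3) by (simp add: dvd_add_left_iff)
      then show False using 2 q(1) by (simp add: prime_dvd_mult_iff)
    qed
  qed
  note gu = this
  have gu2: "gcd (gcd ?u2 ?u1) ?u3 = 1" "gcd (gcd ?u3 ?u1) ?u2 = 1"
    using gu by (simp_all add: gcd.commute gcd.left_commute gcd.assoc)
  have dvd: "?u1 dvd ?B" "?u2 dvd ?A" "?u3 dvd ?C"
    by (rule cross_ratio_dvd[OF gu m(1,2)[symmetric]] cross_ratio_dvd[OF gu2(1) m'(1)[symmetric] m(3)[symmetric]]
        cross_ratio_dvd[OF gu2(2) m'(2,3)[symmetric]])+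
  have gB2: "gcd (gcd ?A ?B) ?C = 1" "gcd (gcd ?C ?B) ?A = 1"
    using gB by (simp_all add: gcd.commute gcd.left_commute gcd.assoc)
  have dvd': "?A dvd ?u2" "?C dvd ?u3"
    by (rule cross_ratio_dvd[OF gB2(1) m'(1) m(3)] cross_ratio_dvd[OF gB2(2) m'(2,3)])+
  have du: "degree ?u1 = degree ?B" "degree ?u2 = degree ?A" "degree ?u3 = degree ?C"
    by (intro degree_eq_if_dvd_dvd dvd dvd' \<open>?B dvd ?u1\<close>)+
  have lt: "degree ?u2 < degree ?u1" "degree ?u3 < degree ?u1"
    unfolding du deg(1) by (rule deg)+
  have sw: "f4 * f3 = ?u1" "f4 * g3 + f3 * g4 = ?u2" "g4 * g3 = ?u3"
    by (simp_all only: mult.commute add.commute)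
  have p3: "g3 = 0 \<or> degree g3 < degree f3"
    using u1 lt by (rule pole_at_infinity)
  have p4: "g4 = 0 \<or> degree g4 < degree f4"
    by (rule pole_at_infinity[of f4 f3 g3 g4]) (unfold sw, (rule u1 lt)+)
  have "degree f3 + degree f4 = 2 * n + 2" using u1 du(1) deg(1) fg(2) by (simp add: degree_mult_eq)
  then show ?thesis using that 3 4 p3 p4 unfolding has_height_def by blast
qed

end

section \<open>From heights to the number of points\<close>

lemma numeral_mod_ring_neq_0:
  assumes "numeral n < CARD('q)"
  shows "(numeral n :: 'q::prime_card mod_ring) \<noteq> 0"
proof
  assume "(numeral n :: 'q mod_ring) = 0"
  then have "(of_nat (numeral n) :: 'q mod_ring) = 0" by simp
  then have "CARD('q) dvd numeral n" by (rule of_nat_0_mod_ring_dvd)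
  then show False using assms by (auto dest: dvd_imp_le)
qed

lemma sum_order_le_degree:
  fixes g :: "'a::{idom,finite} poly"
  assumes "g \<noteq> 0"
  shows "(\<Sum>x\<in>UNIV. order x g) \<le> degree g"
proof -
  have "size (proots g) = (\<Sum>x\<in>set_mset (proots g). order x g)"
    unfolding size_multiset_overloaded_eq using assms by simp
  also have "\<dots> = (\<Sum>x\<in>UNIV. order x g)"
    using assms by (intro sum.mono_neutral_left) (auto simp: order_0I)
  finally show ?thesis using size_proots_le[of g] by simp
qed

text \<open>
  \<open>q k\<close> takes integer values, so its discriminant is at most 1, and it can be 1 only if
  the product \<open>p\<close> of two consecutive integers occurs as a prime.
\<close>

lemma nonneg_quadratic_bound:
  fixes p e :: nat
  assumes p: "prime p" "p \<ge> 3" and q: "\<And>k::nat. (int k)^2 - (int e - int p + 1) * int k + int e \<ge> 0"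
  shows "int e \<le> int p + 1 \<or> (int e - int p - 1)^2 \<le> 4 * int p"
proof (rule disjCI)
  assume "\<not> (int e - int p - 1)^2 \<le> 4 * int p"
  then have big: "(int e - int p - 1)^2 > 4 * int p" by simp
  show "int e \<le> int p + 1"
  proof (rule ccontr)
    assume n: "\<not> int e \<le> int p + 1"
    define s where "s = int e - int p + 1"
    have s: "s > 0" using n by (simp add: s_def)
    have disc: "(int e - int p - 1)^2 = s^2 - 4 * int e + 4 * int p"
      unfolding s_def by (simp add: power2_eq_square algebra_simps)
    \<comment> \<open>The integer at or just below the vertex \<open>s / 2\<close> of the
      quadratic.\<close>
    define k where "k = nat (s div 2)"
    have k: "int k = s div 2" using s by (simp add: k_def)
    have qk: "(int k)^2 - s * int k + int e \<ge> 0" using q[of k] by (simp add: s_def)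
    show False
    proof (cases "even s")
      case True
      then obtain r where r: "s = 2 * r" by blast
      then have "int k = r" using k by simp
      then have "r^2 \<le> int e" using qk r by (simp add: power2_eq_square)
      then show False using big disc r by (simp add: power2_eq_square)
    next
      case False
      then obtain r where r: "s = 2 * r + 1" by (elim oddE)
      then have "int k = r" using k by simp
      then have "r^2 + r \<le> int e" using qk r by (simp add: power2_eq_square algebra_simps)
      then have "s^2 \<le> 4 * int e + 1" using r by (simp add: power2_eq_square algebra_simps)
      then have eq: "(int e - int p - 1)^2 = 4 * int p + 1" using big disc by linarith
      define u where "u = r - 1"
      have eu: "int e - int p - 1 = 2 * u + 1" using r by (simp add: s_def u_def)
      have "(2 * u + 1)^2 = 4 * int p + 1" using eq unfolding eu .
      then have up: "u * (u + 1) = int p" by (simp add: power2_eq_square algebra_simps)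
      have u0: "u \<ge> 0" using eu n by linarith
      have "u \<noteq> 0" using up p by auto
      have "u * (u + 1) = int (nat u * (nat u + 1))" using u0 by (simp add: algebra_simps)
      then have "p = nat u * (nat u + 1)" using up by linarith
      then have "nat u = 1 \<or> nat u + 1 = 1" using p(1) by (metis prime_product)
      then have "u = 1" using \<open>u \<noteq> 0\<close> u0 by auto
      then show False using up p(2) by simp
    qed
  qed
qed

text \<open>\<open>e\<close> is the height of the Frobenius point minus the base point. It is
  bounded because the parallelogram law makes the heights along the progression a quadratic in
  \<open>k\<close>, and \<open>N \<le> e\<close> because every affine point over the prime field
  forces a zero of the denominator of that abscissa.\<close>

lemma hasse_bound_short:
  fixes a b :: "'q::prime_card mod_ring"
  assumes p5: "CARD('q) \<ge> 5" and disc: "4 * a^3 + 27 * b^2 \<noteq> 0"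
  defines "N \<equiv> card {(x, y). y^2 = x^3 + a * x + b} + 1"
  shows "int N \<le> int CARD('q) + 1 \<or> (int N - int CARD('q) - 1)^2 \<le> 4 * int CARD('q)"
proof -
  define p where "p = CARD('q)"
  have pp: "prime p" unfolding p_def by (rule prime_card)
  have two: "(2 :: 'q mod_ring) \<noteq> 0" using numeral_mod_ring_neq_0[of "num.Bit0 num.One", where 'q='q] p5 by simp
  have four: "(4 :: 'q mod_ring) \<noteq> 0" using numeral_mod_ring_neq_0[of "num.Bit0 (num.Bit0 num.One)", where 'q='q] p5 by simp
  interpret F: function_field_curve a b by unfold_locales (use disc two in auto)
  let ?lam = "to_fract F.cub" and ?t = "to_fract F.T"
  have "odd p" using pp p5 prime_odd_nat[of p] by (simp add: p_def)
  then obtain h where h: "p = 2 * h + 1" by (elim oddE)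
  have h1: "h \<ge> 1" using h p5 by (simp add: p_def)
  have char: "p = CHAR('q mod_ring poly)" by (simp add: p_def)
  have frob: "(x + y) ^ p = x ^ p + y ^ p" for x y :: "'q mod_ring poly"
    by (rule freshmans_dream) (use char pp in auto)
  have frob': "(x + y) ^ p = x ^ p + y ^ p" for x y :: "'q mod_ring"
    by (rule freshmans_dream) (use pp in \<open>auto simp: p_def\<close>)
  have fermat: "x ^ p = x" for x :: "'q mod_ring"
  proof -
    have "(of_nat n) ^ p = (of_nat n :: 'q mod_ring)" for n
      by (induction n) (use pp prime_gt_0_nat[of p] in \<open>auto simp: frob'\<close>)
    then show ?thesis using surj_of_nat_mod_ring[of x] by metis
  qed
  have const: "[:c:] ^ p = [:c:]" for c :: "'q mod_ring"
    using fermat[of c] by (simp add: poly_const_pow)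
  have cubp: "F.cub ^ p = (F.T ^ p)^3 + [:a:] * F.T ^ p + [:b:]"
    unfolding F.cub_eq frob power_mult_distrib const by (simp only: mult.commute flip: power_mult)
  \<comment> \<open>The Frobenius image \<open>(t^p, lam^h)\<close> of the base point on the twist,
    with \<open>h = (p - 1) / 2\<close>. The transfer to the Weierstrass equation multiplies
    abscissas by \<open>lam\<close> and ordinates by \<open>lam^2\<close>, whence
    \<open>h + 2\<close>.\<close>
  define Q where "Q = Affine (?lam * ?t ^ p) (?lam ^ (h + 2))"
  have twist: "L^3 * (X^3 + A * X + B) = (L * X)^3 + A * L^2 * (L * X) + B * L^3"
    for L X A B :: "'q mod_ring poly fract" by Groebner_Basis.algebra
  have Q_curve: "Q \<in> curve_points F.FW"
  proof -
    have "?lam ^ p = (?t ^ p)^3 + to_fract [:a:] * ?t ^ p + to_fract [:b:]"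
      using arg_cong[OF cubp, of to_fract] by (simp only: to_fract_add to_fract_mult F.to_fract_power)
    moreover have "(?lam ^ (h + 2))^2 = ?lam ^ 3 * ?lam ^ p"
    proof -
      have "(h + 2) * 2 = 3 + p" using h by simp
      then show ?thesis by (metis power_add power_mult)
    qed
    ultimately have "(?lam ^ (h + 2))^2 = (?lam * ?t ^ p)^3 + to_fract [:a:] * ?lam^2 * (?lam * ?t ^ p) + to_fract [:b:] * ?lam^3"
      by (simp only: twist)
    then show ?thesis by (simp add: Q_def curve_points_def weierstrass_poly_def)
  qed
  have discK: "discriminant F.FW \<noteq> 0"
  proof -
    have "discriminant F.FW = - (16 * (4 * to_fract [:a:]^3 + 27 * to_fract [:b:]^2) * ?lam^6)"
    proof -
      have "discriminant F.FW = - (8 * (2 * (to_fract [:a:] * ?lam^2))^3) - 27 * (4 * (to_fract [:b:] * ?lam^3))^2"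
        by (simp add: discriminant_def Let_def)
      also have "- (8 * (2 * (A * L^2))^3) - 27 * (4 * (B * L^3))^2 = - (16 * (4 * A^3 + 27 * B^2) * L^6)"
        for A B L :: "'q mod_ring poly fract" by Groebner_Basis.algebra
      finally show ?thesis .
    qed
    also have "\<dots> = to_fract (- (16 * (4 * [:a:]^3 + 27 * [:b:]^2) * F.cub^6))"
      by (simp only: to_fract_uminus to_fract_add to_fract_mult F.to_fract_power F.to_fract_numeral)
    finally have "discriminant F.FW = to_fract (- (16 * (4 * [:a:]^3 + 27 * [:b:]^2) * F.cub^6))" .
    moreover have "4 * [:a:]^3 + 27 * [:b:]^2 = [:4 * a^3 + 27 * b^2:]"
      by (simp add: power2_eq_square power3_eq_cube numeral_poly)
    moreover have "(16 :: 'q mod_ring poly) \<noteq> 0"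
    proof -
      have "(16 :: 'q mod_ring) = 4 * 4" by simp
      then have "(16 :: 'q mod_ring) \<noteq> 0" using four by (metis mult_eq_0_iff)
      moreover have "(16 :: 'q mod_ring poly) = [:16:]" by (simp add: numeral_poly)
      ultimately show ?thesis by (metis pCons_eq_0_iff)
    qed
    ultimately show ?thesis using disc F.cub_nz by simp
  qed
  note ns = nonsing_eq_curve_points[OF discK]
  have P_curve: "F.FP \<in> curve_points F.FW"
  proof -
    have "?lam^4 = ?lam^3 * (?t^3 + to_fract [:a:] * ?t + to_fract [:b:])"
      using F.lam(1) by (simp add: power4_eq_xxxx power3_eq_cube)
    then have "(?lam^2)^2 = (?lam * ?t)^3 + to_fract [:a:] * ?lam^2 * (?lam * ?t) + to_fract [:b:] * ?lam^3"
      by Groebner_Basis.algebra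
    then show ?thesis by (simp add: F.FP_def curve_points_def weierstrass_poly_def)
  qed
  have Q_height: "F.has_height Q p"
  proof -
    have "F.rep Q (F.T ^ p) 1"
      unfolding F.rep_def Q_def using F.cub_nz by (simp add: F.to_fract_power)
    moreover have "degree (F.T ^ p) = p" by (simp add: F.T_def degree_power_eq)
    ultimately show ?thesis using p5 unfolding F.has_height_def p_def by fastforce
  qed
  let ?N = "point_neg F.FW F.FP"
  \<comment> \<open>\<open>A k\<close> is \<open>Q\<close> plus \<open>k - 1\<close> times the base
    point; beginning one step before \<open>Q\<close> keeps the index a natural number.\<close>
  define A where "A = rec_nat (point_add F.FW Q ?N) (\<lambda>_ R. point_add F.FW R F.FP)"
  have A0: "A 0 = point_add F.FW Q ?N" and AS: "A (Suc k) = point_add F.FW (A k) F.FP" for k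
    by (simp_all add: A_def)
  have Pn: "F.FP \<in> nonsing F.FW" "?N \<in> nonsing F.FW" "Q \<in> nonsing F.FW"
    using P_curve Q_curve by (simp_all only: point_neg_nonsing) (simp_all only: ns)
  have An: "A k \<in> nonsing F.FW" for k
    by (induction k) (simp_all add: A0 AS point_add_nonsing Pn)
  have A1: "A 1 = Q" using point_add_cancel_neg(2)[OF Pn(2,3)] by (simp add: A0 AS)
  have pred: "point_add F.FW (A (Suc k)) ?N = A k" for k
    unfolding AS by (rule point_add_cancel_neg(2)[OF Pn(1) An])
  obtain e where e: "F.has_height (A 0) e"
    using F.height_parallelogram[OF Q_curve Q_height] unfolding A0 by metis
  \<comment> \<open>The quadratic with \<open>q 0 = e\<close>, \<open>q 1 = p\<close> and second
    difference 2, as the parallelogram law prescribes.\<close>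
  define q where "q k = (int k)^2 - (int e - int p + 1) * int k + int e" for k
  have heights: "\<exists>m m'. F.has_height (A k) m \<and> F.has_height (A (Suc k)) m' \<and> int m = q k \<and> int m' = q (Suc k)" for k
  proof (induction k)
    case 0
    then show ?case using e Q_height A1 by (intro exI[of _ e] exI[of _ p]) (simp add: q_def)
  next
    case (Suc k)
    then obtain m m' where m: "F.has_height (A k) m" "F.has_height (A (Suc k)) m'" "int m = q k" "int m' = q (Suc k)"
      by blast
    have "A (Suc k) \<in> curve_points F.FW" using An ns by simp
    then obtain n3 n4 where n: "F.has_height (A (Suc (Suc k))) n3" "F.has_height (A k) n4" "n3 + n4 = 2 * m' + 2"
      using F.height_parallelogram[OF _ m(2)] unfolding pred AS[symmetric] by metis
    have "n4 = m" using n(2) m(1) by (rule F.has_height_unique)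
    then have "int n3 = 2 * q (Suc k) + 2 - q k" using n(3) m(3,4) by linarith
    also have "\<dots> = q (Suc (Suc k))" by (simp add: q_def power2_eq_square algebra_simps)
    finally show ?case using n(1) m by blast
  qed
  have "q k \<ge> 0" for k using heights[of k] by (metis of_nat_0_le_iff)
  then have bound: "int e \<le> int p + 1 \<or> (int e - int p - 1)^2 \<le> 4 * int p"
    using nonneg_quadratic_bound[OF pp] p5 unfolding q_def p_def by simp
  have "N \<le> e"
  proof -
    obtain f g where fg: "F.rep (A 0) f g" "degree f = e" "g = 0 \<or> degree g < degree f"
      using e by (auto simp: F.has_height_def)
    define D where "D = F.T ^ p - F.T"
    have D0: "D \<noteq> 0"
    proof
      assume "D = 0"
      then have "degree (F.T ^ p) = degree F.T" by (simp add: D_def)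
      then show False using p5 by (simp add: F.T_def degree_power_eq p_def)
    qed
    \<comment> \<open>The numerator of the abscissa of \<open>A 0\<close> over the denominator
      \<open>D^2\<close>, before cancellation.\<close>
    define M where "M = F.cub * (1 + F.cub ^ h)^2 - (F.T ^ p + F.T) * D^2"
    have DK: "?t ^ p - ?t \<noteq> 0"
    proof -
      have "to_fract D \<noteq> 0" using D0 by simp
      then show ?thesis by (simp add: D_def F.to_fract_power)
    qed
    define l where "l = ?lam * (1 + ?lam ^ h) / (?t ^ p - ?t)"
    have lD: "l * (?t ^ p - ?t) = ?lam * (1 + ?lam ^ h)" using DK by (simp add: l_def)
    have "l * (?lam * ?t - ?lam * ?t ^ p) = - (?lam * (l * (?t ^ p - ?t)))" by Groebner_Basis.algebra
    also have "\<dots> = - (?lam^2) - ?lam ^ (h + 2)" unfolding lD by (simp add: algebra_simps power2_eq_square)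
    finally have ch: "l * (?lam * ?t - ?lam * ?t ^ p) = - (?lam^2) - ?lam ^ (h + 2)" .
    have xne: "?lam * ?t ^ p \<noteq> ?lam * ?t" using DK F.cub_nz by simp
    define x3 where "x3 = l^2 - ?lam * ?t ^ p - ?lam * ?t"
    obtain y3 where A0': "A 0 = Affine x3 y3"
      using point_add_chord[OF xne ch, of x3 F.FW] unfolding A0 Q_def F.neg_P by (simp add: x3_def)
    have sc: "to_fract g \<noteq> 0" "to_fract f = x3 / ?lam * to_fract g" and cop: "coprime f g"
      using fg(1) unfolding F.rep_def A0' by auto
    have g0: "g \<noteq> 0" using sc by simp
    have "x3 * (?t ^ p - ?t)^2 = (l * (?t ^ p - ?t))^2 - ?lam * (?t ^ p + ?t) * (?t ^ p - ?t)^2"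
      unfolding x3_def by Groebner_Basis.algebra
    also have "\<dots> = ?lam * to_fract M" unfolding lD
      by (simp add: M_def D_def F.to_fract_power F.to_fract_numeral algebra_simps power2_eq_square)
    finally have "x3 / ?lam * (?t ^ p - ?t)^2 = to_fract M" using F.lam(2) by simp
    moreover have "to_fract (f * D^2) = (x3 / ?lam * (?t ^ p - ?t)^2) * to_fract g"
      using sc(2) by (simp add: D_def F.to_fract_power)
    ultimately have "to_fract (f * D^2) = to_fract (M * g)" by simp
    then have eq: "f * D^2 = M * g" by (simp only: to_fract_eq_iff)
    have f0: "f \<noteq> 0" using fg(2,3) g0 by auto
    have nz: "M * g \<noteq> 0" using eq f0 D0 by (metis mult_eq_0_iff power_not_zero)
    have polyT: "poly F.T x = x" for x by (simp add: F.T_def)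
    have polyD: "poly D x = 0" for x by (simp add: D_def polyT fermat)
    have ordD: "order x (D^2) \<ge> 2" for x
    proof -
      have "[:- x, 1:] dvd D" using polyD poly_eq_0_iff_dvd by blast
      then have "[:- x, 1:]^2 dvd D^2" by (rule dvd_power_same)
      then show ?thesis using D0 by (simp add: order_divides)
    qed
    \<comment> \<open>\<open>D\<close> vanishes at every element of the field, so the double factor
      of \<open>D^2\<close> at \<open>x\<close> is either absorbed by \<open>M\<close> or survives
      in the denominator \<open>g\<close>.\<close>
    have ord: "order x M + order x g \<ge> 2" for x
    proof -
      have "order x (f * D^2) = order x f + order x (D^2)" using f0 D0 by (intro order_mult) simp
      moreover have "order x (M * g) = order x M + order x g" using nz by (rule order_mult)
      ultimately show ?thesis using ordD[of x] eq by simp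
    qed
    have polyc: "poly F.cub x = x^3 + a * x + b" for x
      by (simp add: F.cub_eq polyT)
    have roots: "card {y. y^2 = x^3 + a * x + b} \<le> order x g" for x
    proof (cases "\<exists>y. y^2 = x^3 + a * x + b")
      case False
      then have "{y. y^2 = x^3 + a * x + b} = {}" by blast
      then show ?thesis by simp
    next
      case True
      then obtain y where y: "y^2 = x^3 + a * x + b" by blast
      have sq: "{z. z^2 = x^3 + a * x + b} \<subseteq> {y, - y}"
        unfolding y[symmetric] by (auto simp: power2_eq_iff)
      show ?thesis
      proof (cases "y = 0")
        case False
        \<comment> \<open>Euler's criterion: a nonzero square has \<open>h\<close>-th power 1, so
          \<open>M\<close> takes the value \<open>4 * y^2\<close> and absorbs nothing. The full
          order 2 matches the two ordinates.\<close>
        have "y ^ (2 * h) * y = y" using fermat[of y] h by (simp add: mult.commute)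
        then have "y ^ (2 * h) = 1" using False by simp
        then have "poly (F.cub ^ h) x = 1" by (simp add: polyc y[symmetric] power_mult)
        then have "poly M x = (x^3 + a * x + b) * 2^2" by (simp add: M_def polyD polyc)
        then have "poly M x = y^2 * 2^2" by (simp only: y)
        then have "poly M x \<noteq> 0" using False two by (metis mult_eq_0_iff power_not_zero)
        then have "order x M = 0" by (rule order_0I)
        then have "order x g \<ge> 2" using ord[of x] by simp
        moreover have "card {z. z^2 = x^3 + a * x + b} \<le> card {y, - y}" using sq by (intro card_mono) auto
        moreover have "card {y, - y} \<le> 2" by (simp add: card_insert_if)
        ultimately show ?thesis by linarith
      next
        case True
        \<comment> \<open>At a root of the cubic there is a single ordinate, and \<open>M\<close>
          absorbs at most one factor because the cubic is squarefree.\<close>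
        have root: "poly F.cub x = 0" using y True by (simp add: polyc)
        have "\<not> [:- x, 1:]^2 dvd M"
        proof
          assume d: "[:- x, 1:]^2 dvd M"
          have "[:- x, 1:]^2 dvd D^2"
            using polyD poly_eq_0_iff_dvd by (intro dvd_power_same) blast
          then have "[:- x, 1:]^2 dvd M + (F.T ^ p + F.T) * D^2" using d by (intro dvd_add dvd_mult)
          then have d': "[:- x, 1:]^2 dvd F.cub * (1 + F.cub ^ h)^2" by (simp add: M_def)
          have px: "poly ((1 + F.cub ^ h)^2) x \<noteq> 0" using root h1 by (simp add: power_0_left)
          have "order x ((1 + F.cub ^ h)^2) = 0" using px by (rule order_0I)
          moreover have z: "(1 + F.cub ^ h)^2 \<noteq> 0" using px by (metis poly_0)
          moreover have "order x (F.cub * (1 + F.cub ^ h)^2) = order x F.cub + order x ((1 + F.cub ^ h)^2)"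
            using F.cub_nz z by (intro order_mult) (metis mult_eq_0_iff)
          ultimately have "2 \<le> order x F.cub" using d' F.cub_nz by (simp add: order_divides)
          then have "[:- x, 1:]^2 dvd F.cub" by (simp add: order_divides)
          then obtain r where r: "F.cub = [:- x, 1:]^2 * r" by blast
          have "poly (pderiv F.cub) x = 0" 
            unfolding r power2_eq_square mult.assoc pderiv_mult poly_add poly_mult by simp
          then have d1: "3 * x^2 + a = 0" by (simp add: F.cub_def pderiv_pCons power2_eq_square algebra_simps)
          have d0: "x^3 + a * x + b = 0" using root polyc by simp
          have aa: "a = - (3 * x^2)" using d1 by (simp add: eq_neg_iff_add_eq_0 add.commute)
          have bb: "b = 2 * x^3" using d0 unfolding aa by Groebner_Basis.algebra
          have "4 * a^3 + 27 * b^2 = 0" unfolding aa bb by Groebner_Basis.algebra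
          then show False using disc by simp
        qed
        then have "order x M < 2" using nz by (auto simp: order_divides)
        then have "order x g \<ge> 1" using ord[of x] by simp
        moreover have "card {z. z^2 = x^3 + a * x + b} \<le> card {y, - y}" using sq by (intro card_mono) auto
        ultimately show ?thesis using True by simp
      qed
    qed
    have "{(x, y). y^2 = x^3 + a * x + b} = Sigma UNIV (\<lambda>x. {y. y^2 = x^3 + a * x + b})" by auto
    then have "card {(x, y). y^2 = x^3 + a * x + b} = (\<Sum>x\<in>UNIV. card {y. y^2 = x^3 + a * x + b})"
      by (simp add: card_SigmaI)
    also have "\<dots> \<le> (\<Sum>x\<in>UNIV. order x g)" by (intro sum_mono roots)
    also have "\<dots> \<le> degree g" using g0 by (rule sum_order_le_degree)
    \<comment> \<open>The strict inequality \<open>degree g < degree f = e\<close> accounts for the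
      point at infinity.\<close>
    finally show ?thesis using fg g0 by (simp add: N_def)
  qed
  show ?thesis
  proof (cases "int N \<le> int p + 1")
    case False
    then have "(int N - int p - 1)^2 \<le> (int e - int p - 1)^2"
      using \<open>N \<le> e\<close> by (intro power_mono) auto
    moreover have "\<not> int e \<le> int p + 1" using False \<open>N \<le> e\<close> by linarith
    ultimately show ?thesis using bound unfolding p_def by linarith
  qed (simp add: p_def)
qed

section \<open>Counting points modulo a prime\<close>

definition b2 :: "'a::comm_ring_1 weierstrass \<Rightarrow> 'a" where "b2 V = wa1 V ^ 2 + 4 * wa2 V"
definition b4 :: "'a::comm_ring_1 weierstrass \<Rightarrow> 'a" where "b4 V = 2 * wa4 V + wa1 V * wa3 V"
definition b6 :: "'a::comm_ring_1 weierstrass \<Rightarrow> 'a" where "b6 V = wa3 V ^ 2 + 4 * wa6 V"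

text \<open>Multiplying by 4 removes \<open>b8\<close>, since
  \<open>4 * b8 = b2 V * b6 V - b4 V ^ 2\<close>.\<close>

lemma discriminant_b:
  fixes V :: "'a::idom weierstrass"
  shows "4 * discriminant V = - (b2 V ^ 3 * b6 V) + b2 V ^ 2 * b4 V ^ 2 - 32 * b4 V ^ 3 - 108 * b6 V ^ 2
    + 36 * b2 V * b4 V * b6 V"
proof -
  define b8 where "b8 = wa1 V ^ 2 * wa6 V + 4 * wa2 V * wa6 V - wa1 V * wa3 V * wa4 V
               + wa2 V * wa3 V ^ 2 - wa4 V ^ 2"
  have b8: "4 * b8 = b2 V * b6 V - b4 V ^ 2"
    unfolding b8_def b2_def b4_def b6_def by Groebner_Basis.algebra
  have "4 * discriminant V = - (b2 V ^ 2 * (4 * b8)) - 32 * b4 V ^ 3 - 108 * b6 V ^ 2 + 36 * b2 V * b4 V * b6 V"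
    unfolding discriminant_def Let_def b8_def[symmetric] b2_def[symmetric] b4_def[symmetric] b6_def[symmetric]
    by Groebner_Basis.algebra
  then show ?thesis unfolding b8 by Groebner_Basis.algebra
qed

lemma weierstrass_complete_square:
  fixes V :: "'a::idom weierstrass"
  shows "4 * weierstrass_poly V x y = weierstrass_poly_dy V x y ^ 2 - (4 * x^3 + b2 V * x^2 + 2 * b4 V * x + b6 V)"
    "4 * weierstrass_poly_dx V x y = 2 * wa1 V * weierstrass_poly_dy V x y - (12 * x^2 + 2 * b2 V * x + 2 * b4 V)"
  unfolding weierstrass_poly_def weierstrass_poly_dx_def weierstrass_poly_dy_def b2_def b4_def b6_def
  by Groebner_Basis.algebra+

subsection \<open>Existence of a singular point\<close>

lemma singular_point_char_2:
  fixes V :: "'a::field weierstrass"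
  assumes two: "(2::'a) = 0" and sq: "\<And>x::'a. x^2 = x" and disc: "discriminant V = 0"
  shows "\<exists>x y. weierstrass_poly V x y = 0 \<and> weierstrass_poly_dx V x y = 0 \<and> weierstrass_poly_dy V x y = 0"
proof -
  have dbl: "z + z = 0" for z :: 'a using two by (metis mult_2 mult_zero_left)
  have neg: "- z = z" for z :: 'a using dbl[of z] by (simp add: eq_neg_iff_add_eq_0)
  have num: "numeral (num.Bit0 n) = (0::'a)" "numeral (num.Bit1 n) = (1::'a)" for n
    by (simp_all add: numeral_Bit0 numeral_Bit1 dbl del: numeral_plus_numeral one_add_one add_numeral_special)
  have z01: "z = 0 \<or> z = 1" for z :: 'a
    using sq[of z] by (metis mult_cancel_right1 power2_eq_square)
  show ?thesis
    using z01[of "wa1 V"]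
  proof
    assume a1: "wa1 V = 1"
    \<comment> \<open>For \<open>a1 = 1\<close> this is the only point at which both derivatives
      vanish, so the curve is singular exactly if it passes through it.\<close>
    have "discriminant V = weierstrass_poly V (wa3 V) (wa3 V + wa4 V)"
      using z01[of "wa2 V"] z01[of "wa3 V"] z01[of "wa4 V"] z01[of "wa6 V"]
      unfolding discriminant_def Let_def weierstrass_poly_def a1
      by (elim disjE) (simp_all add: num neg)
    moreover have "weierstrass_poly_dx V (wa3 V) (wa3 V + wa4 V) = 0"
      "weierstrass_poly_dy V (wa3 V) (wa3 V + wa4 V) = 0"
      using z01[of "wa2 V"] z01[of "wa3 V"] z01[of "wa4 V"]
      unfolding weierstrass_poly_dx_def weierstrass_poly_dy_def a1
      by (elim disjE; simp add: num neg)+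
    ultimately show ?thesis using disc by metis
  next
    assume a1: "wa1 V = 0"
    have "discriminant V = wa3 V"
      using z01[of "wa2 V"] z01[of "wa3 V"] z01[of "wa4 V"] z01[of "wa6 V"]
      unfolding discriminant_def Let_def a1 by (elim disjE) (simp_all add: num neg)
    then have a3: "wa3 V = 0" using disc by simp
    \<comment> \<open>With \<open>a1 = a3 = 0\<close> the derivative in \<open>x\<close> is
      \<open>x^2 + a4\<close>, whose root is \<open>a4\<close>; \<open>?y\<close> is the square root
      of the cubic in \<open>x\<close> at this abscissa.\<close>
    let ?y = "wa2 V * wa4 V + wa6 V"
    have "weierstrass_poly V (wa4 V) ?y = 0" "weierstrass_poly_dx V (wa4 V) ?y = 0" "weierstrass_poly_dy V (wa4 V) ?y = 0"
      using z01[of "wa2 V"] z01[of "wa4 V"] z01[of "wa6 V"]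
      unfolding weierstrass_poly_def weierstrass_poly_dx_def weierstrass_poly_dy_def a1 a3
      by (elim disjE; simp add: num neg)+
    then show ?thesis by blast
  qed
qed

text \<open>Completing the square puts the singular point on the line
  \<open>2 * y + a1 * x + a3 = 0\<close>, over a multiple root of the cubic in
  \<open>x\<close>.\<close>

lemma singular_point_if_double_root:
  fixes V :: "'a::field weierstrass"
  assumes two: "(2::'a) \<noteq> 0" and g: "4 * x^3 + b2 V * x^2 + 2 * b4 V * x + b6 V = 0"
    and g': "12 * x^2 + 2 * b2 V * x + 2 * b4 V = 0"
  shows "\<exists>x y. weierstrass_poly V x y = 0 \<and> weierstrass_poly_dx V x y = 0 \<and> weierstrass_poly_dy V x y = 0"
proof -
  have four: "(4::'a) \<noteq> 0" using two by (metis mult_2 mult_eq_0_iff numeral_Bit0)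
  define y where "y = - (wa1 V * x + wa3 V) / 2"
  have "2 * y = - (wa1 V * x + wa3 V)" using two by (simp add: y_def)
  then have dy: "weierstrass_poly_dy V x y = 0" by (simp add: weierstrass_poly_dy_def)
  have "4 * weierstrass_poly V x y = 0" "4 * weierstrass_poly_dx V x y = 0"
    unfolding weierstrass_complete_square dy g g' by simp_all
  then have "weierstrass_poly V x y = 0" "weierstrass_poly_dx V x y = 0" using four by (metis mult_eq_0_iff)+
  then show ?thesis using dy by blast
qed

text \<open>In characteristic 3 the derivative of the cubic is linear, with root
  \<open>- b4 / b2\<close>. If \<open>b2\<close> vanishes, the discriminant forces \<open>b4\<close>
  to vanish too, and the cubic is \<open>x^3 + b6\<close>, a perfect cube.\<close>

lemma singular_point_char_3:
  fixes V :: "'a::field weierstrass"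
  assumes three: "(3::'a) = 0" and cube: "\<And>x::'a. x^3 = x" and disc: "discriminant V = 0"
  shows "\<exists>x y. weierstrass_poly V x y = 0 \<and> weierstrass_poly_dx V x y = 0 \<and> weierstrass_poly_dy V x y = 0"
proof -
  have nums: "(12::'a) = 0" "(4::'a) = 1" "(32::'a) = - 1" "(36::'a) = 0" "(108::'a) = 0" "(2::'a) = - 1"
  proof -
    have e: "(12::'a) = 3 * 4" "(4::'a) = 3 + 1" "(32::'a) = 3 * 11 - 1" "(36::'a) = 3 * 12" "(108::'a) = 3 * 36" "(2::'a) = 3 - 1"
      by simp_all
    show "(12::'a) = 0" "(4::'a) = 1" "(32::'a) = - 1" "(36::'a) = 0" "(108::'a) = 0" "(2::'a) = - 1"
      by (simp_all only: e three) simp_all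
  qed
  have two: "(2::'a) \<noteq> 0" unfolding nums by simp
  have D: "- (b2 V ^ 3 * b6 V) + b2 V ^ 2 * b4 V ^ 2 + b4 V ^ 3 = 0"
    using discriminant_b[of V] unfolding disc nums by simp
  show ?thesis
  proof (cases "b2 V = 0")
    case True
    then have b4: "b4 V = 0" using D by simp
    show ?thesis
      by (rule singular_point_if_double_root[OF two, of "- b6 V"]) (simp_all add: True b4 nums cube)
  next
    case False
    define x where "x = - b4 V / b2 V"
    have x: "b4 V = - (b2 V * x)" using False by (simp add: x_def)
    have "b2 V ^ 3 * (4 * x^3 + b2 V * x^2 + 2 * b4 V * x + b6 V) = - (- (b2 V ^ 3 * b6 V) + b2 V ^ 2 * b4 V ^ 2 + b4 V ^ 3) + 3 * (b2 V ^ 3 * x^3)"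
      unfolding x by Groebner_Basis.algebra
    then have "b2 V ^ 3 * (4 * x^3 + b2 V * x^2 + 2 * b4 V * x + b6 V) = 0" unfolding D three by simp
    then have g: "4 * x^3 + b2 V * x^2 + 2 * b4 V * x + b6 V = 0" using False by (metis mult_eq_0_iff power_not_zero)
    have "12 * x^2 + 2 * b2 V * x + 2 * b4 V = 0" unfolding x nums(1) by simp
    then show ?thesis by (rule singular_point_if_double_root[OF two g])
  qed
qed

text \<open>\<open>c4^3 - c6^2\<close> is 1728 times the discriminant. Hence \<open>c4 = 0\<close>
  gives \<open>c6 = 0\<close> and the triple root \<open>- b2 / 12\<close>; otherwise the classical
  formula for the double root of a cubic applies.\<close>

lemma singular_point_generic:
  fixes V :: "'a::field weierstrass"
  assumes two: "(2::'a) \<noteq> 0" and three: "(3::'a) \<noteq> 0" and disc: "discriminant V = 0"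
  shows "\<exists>x y. weierstrass_poly V x y = 0 \<and> weierstrass_poly_dx V x y = 0 \<and> weierstrass_poly_dy V x y = 0"
proof -
  define c4 where "c4 = b2 V ^ 2 - 24 * b4 V"
  define c6 where "c6 = - (b2 V ^ 3) + 36 * b2 V * b4 V - 216 * b6 V"
  have D: "- (b2 V ^ 3 * b6 V) + b2 V ^ 2 * b4 V ^ 2 - 32 * b4 V ^ 3 - 108 * b6 V ^ 2
    + 36 * b2 V * b4 V * b6 V = 0" using discriminant_b[of V] unfolding disc by simp
  have nums: "(12::'a) \<noteq> 0" "(216::'a) \<noteq> 0"
  proof -
    have "(12::'a) = 2 * 2 * 3" "(216::'a) = 2 * 2 * 2 * 3 * 3 * 3" by simp_all
    then show "(12::'a) \<noteq> 0" "(216::'a) \<noteq> 0" using two three by (metis mult_eq_0_iff)+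
  qed
  show ?thesis
  proof (cases "c4 = 0")
    case True
    have "c4 ^ 3 - c6 ^ 2 = 432 * (- (b2 V ^ 3 * b6 V) + b2 V ^ 2 * b4 V ^ 2 - 32 * b4 V ^ 3 - 108 * b6 V ^ 2
      + 36 * b2 V * b4 V * b6 V)"
      unfolding c4_def c6_def by Groebner_Basis.algebra
    then have c6: "c6 = 0" unfolding D True by simp
    define x where "x = - b2 V / 12"
    have x: "b2 V = - (12 * x)" using nums by (simp add: x_def)
    have "12 * (12 * x^2 + 2 * b2 V * x + 2 * b4 V) = - c4" unfolding c4_def x by Groebner_Basis.algebra
    then have "12 * (12 * x^2 + 2 * b2 V * x + 2 * b4 V) = 0" unfolding True by simp
    then have g': "12 * x^2 + 2 * b2 V * x + 2 * b4 V = 0" using nums(1) by (metis mult_eq_0_iff)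
    have "216 * (4 * x^3 + b2 V * x^2 + 2 * b4 V * x + b6 V) = - c6"
      unfolding c6_def x by Groebner_Basis.algebra
    then have "216 * (4 * x^3 + b2 V * x^2 + 2 * b4 V * x + b6 V) = 0" unfolding c6 by simp
    then have g: "4 * x^3 + b2 V * x^2 + 2 * b4 V * x + b6 V = 0" using nums(2) by (metis mult_eq_0_iff)
    show ?thesis by (rule singular_point_if_double_root[OF two g g'])
  next
    case False
    define x where "x = (18 * b6 V - b2 V * b4 V) / c4"
    have x: "x * c4 = 18 * b6 V - b2 V * b4 V" using False by (simp add: x_def)
    have "c4^3 * (4 * x^3 + b2 V * x^2 + 2 * b4 V * x + b6 V) =
      4 * (x * c4)^3 + b2 V * (x * c4)^2 * c4 + 2 * b4 V * (x * c4) * c4^2 + b6 V * c4^3"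
      by Groebner_Basis.algebra
    also have "\<dots> = c6 * (- (b2 V ^ 3 * b6 V) + b2 V ^ 2 * b4 V ^ 2 - 32 * b4 V ^ 3 - 108 * b6 V ^ 2
      + 36 * b2 V * b4 V * b6 V)"
      unfolding x unfolding c4_def c6_def by Groebner_Basis.algebra
    finally have g: "4 * x^3 + b2 V * x^2 + 2 * b4 V * x + b6 V = 0" unfolding D using False by simp
    have "c4^2 * (12 * x^2 + 2 * b2 V * x + 2 * b4 V) =
      12 * (x * c4)^2 + 2 * b2 V * (x * c4) * c4 + 2 * b4 V * c4^2"
      by Groebner_Basis.algebra
    also have "\<dots> = - 36 * (- (b2 V ^ 3 * b6 V) + b2 V ^ 2 * b4 V ^ 2 - 32 * b4 V ^ 3 - 108 * b6 V ^ 2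
      + 36 * b2 V * b4 V * b6 V)"
      unfolding x unfolding c4_def by Groebner_Basis.algebra
    finally have g': "12 * x^2 + 2 * b2 V * x + 2 * b4 V = 0" unfolding D using False by simp
    show ?thesis by (rule singular_point_if_double_root[OF two g g'])
  qed
qed

lemma singular_point_exists:
  fixes V :: "'q::prime_card mod_ring weierstrass"
  assumes "discriminant V = 0"
  shows "\<exists>x y. weierstrass_poly V x y = 0 \<and> weierstrass_poly_dx V x y = 0 \<and> weierstrass_poly_dy V x y = 0"
proof -
  have fermat: "x ^ CARD('q) = x" for x :: "'q mod_ring"
    using finite_field_power_card_eq_same[of x] by simp
  have char: "(of_nat CARD('q) :: 'q mod_ring) = 0" by simp
  consider "CARD('q) = 2" | "CARD('q) = 3" | "CARD('q) > 3" 
    using prime_ge_2_nat[OF prime_card[where 'a='q]] by linarith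
  then show ?thesis
  proof cases
    case 1
    then show ?thesis using singular_point_char_2[OF _ _ assms] fermat char by simp
  next
    case 2
    then show ?thesis using singular_point_char_3[OF _ _ assms] fermat char by simp
  next
    case 3
    then have "(2 :: 'q mod_ring) \<noteq> 0" "(3 :: 'q mod_ring) \<noteq> 0"
      using numeral_mod_ring_neq_0[of _, where 'q='q] by simp_all
    then show ?thesis using singular_point_generic[OF _ _ assms] by blast
  qed
qed

subsection \<open>The nonsingular points of a singular cubic\<close>

text \<open>
  A line of slope \<open>l\<close> through the singular point meets the cubic in exactly one further point,
  unless \<open>l\<close> is a root of \<open>l\<^sup>2 + a1 l - (3 x0 + a2)\<close>.
\<close>

lemma card_nonsing_singular:
  fixes V :: "'a::{field,finite} weierstrass"
  assumes s: "weierstrass_poly V x0 y0 = 0" "weierstrass_poly_dx V x0 y0 = 0" "weierstrass_poly_dy V x0 y0 = 0"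
  shows "card (nonsing V) + card {l. l^2 + wa1 V * l - (3 * x0 + wa2 V) = 0} = CARD('a) + 1"
proof -
  define e where "e = 3 * x0 + wa2 V"
  define q where "q l = l^2 + wa1 V * l - e" for l
  define \<phi> where "\<phi> l = Affine (x0 + q l) (y0 + l * q l)" for l
  have tay: "weierstrass_poly V (x0 + X) (y0 + Y) = Y^2 + wa1 V * X * Y - X^3 - e * X^2" for X Y
    using weierstrass_poly_taylor[OF s(1), of "x0 + X" "y0 + Y"] s(2,3) by (simp add: e_def)
  have dy: "weierstrass_poly_dy V (x0 + X) (y0 + Y) = 2 * Y + wa1 V * X" for X Y
    using s(3) unfolding weierstrass_poly_dy_def by Groebner_Basis.algebra
  have dx: "weierstrass_poly_dx V (x0 + X) (y0 + Y) = wa1 V * Y - 3 * X^2 - 2 * e * X" for X Y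
    using s(2) unfolding weierstrass_poly_dx_def e_def by Groebner_Basis.algebra
  have "bij_betw \<phi> {l. q l \<noteq> 0} (nonsing V - {Infinity})"
  proof (rule bij_betwI')
    fix l l' assume l: "l \<in> {l. q l \<noteq> 0}" "l' \<in> {l. q l \<noteq> 0}"
    have "l = l'" if "\<phi> l = \<phi> l'"
    proof -
      have "q l = q l'" "l * q l = l' * q l'" using that by (auto simp: \<phi>_def)
      then show ?thesis using l by simp
    qed
    then show "\<phi> l = \<phi> l' \<longleftrightarrow> l = l'" by auto
  next
    fix l assume l: "l \<in> {l. q l \<noteq> 0}"
    define X where "X = q l"
    have X: "X \<noteq> 0" "l^2 + wa1 V * l - e = X" using l by (auto simp: X_def q_def)
    have "weierstrass_poly V (x0 + X) (y0 + l * X) = (l^2 + wa1 V * l - e - X) * X^2"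
      unfolding tay by Groebner_Basis.algebra
    then have on: "weierstrass_poly V (x0 + X) (y0 + l * X) = 0" using X(2) by simp
    have "weierstrass_poly_dx V (x0 + X) (y0 + l * X) \<noteq> 0 \<or> weierstrass_poly_dy V (x0 + X) (y0 + l * X) \<noteq> 0"
    proof (rule ccontr)
      assume "\<not> ?thesis"
      then have z: "wa1 V * (l * X) - 3 * X^2 - 2 * e * X = 0" "2 * (l * X) + wa1 V * X = 0"
        unfolding dx dy by auto
      \<comment> \<open>The derivative along the line of slope \<open>l\<close>: where the line
        meets the cubic, that is \<open>q l = X\<close>, it equals \<open>- X^2\<close>.\<close>
      have "X * X = 2 * X * ((l^2 + wa1 V * l - e) - X) - (wa1 V * (l * X) - 3 * X^2 - 2 * e * X)
          - l * (2 * (l * X) + wa1 V * X)"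
        by Groebner_Basis.algebra
      then have "X * X = 0" unfolding z X(2) by simp
      then show False using X(1) by simp
    qed
    then show "\<phi> l \<in> nonsing V - {Infinity}" using on by (simp add: \<phi>_def Affine_nonsing_iff X_def)
  next
    fix R assume R: "R \<in> nonsing V - {Infinity}"
    then obtain x y where xy: "R = Affine x y" "weierstrass_poly V x y = 0"
      "weierstrass_poly_dx V x y \<noteq> 0 \<or> weierstrass_poly_dy V x y \<noteq> 0"
      by (cases R) (auto simp: Affine_nonsing_iff)
    define X Y where "X = x - x0" and "Y = y - y0"
    have x: "x = x0 + X" "y = y0 + Y" by (simp_all add: X_def Y_def)
    have on: "Y^2 + wa1 V * X * Y - X^3 - e * X^2 = 0" using xy(2) unfolding x tay .
    have "X \<noteq> 0"
    proof
      assume "X = 0"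
      then have "Y = 0" using on by simp
      then show False using xy(3) s \<open>X = 0\<close> by (simp add: x)
    qed
    define l where "l = Y / X"
    have Y: "Y = l * X" using \<open>X \<noteq> 0\<close> by (simp add: l_def)
    have "(l^2 + wa1 V * l - e - X) * X^2 = 0" using on unfolding Y by Groebner_Basis.algebra
    then have "q l = X" using \<open>X \<noteq> 0\<close> by (simp add: q_def)
    then have "R = \<phi> l" "q l \<noteq> 0" using \<open>X \<noteq> 0\<close> by (simp_all add: \<phi>_def xy(1) x Y)
    then show "\<exists>l\<in>{l. q l \<noteq> 0}. R = \<phi> l" by blast
  qed
  then have 1: "card {l. q l \<noteq> 0} = card (nonsing V - {Infinity})" by (rule bij_betw_same_card)
  have fin: "finite (nonsing V)"
  proof -
    have "nonsing V \<subseteq> insert Infinity (range (\<lambda>(x, y). Affine x y))" by (auto simp: nonsing_def)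
    then show ?thesis by (rule finite_subset) simp
  qed
  have "card (nonsing V) = card (nonsing V - {Infinity}) + 1"
    using fin by (simp add: card_Diff_singleton card_gt_0_iff) (metis Infinity_nonsing Suc_pred card_gt_0_iff empty_iff)
  moreover have "card {l. q l \<noteq> 0} + card {l. q l = 0} = CARD('a)"
  proof -
    have "card ({l. q l \<noteq> 0} \<union> {l. q l = 0}) = card {l. q l \<noteq> 0} + card {l. q l = 0}"
      by (rule card_Un_disjoint) auto
    moreover have "{l. q l \<noteq> 0} \<union> {l. q l = 0} = UNIV" by auto
    ultimately show ?thesis by simp
  qed
  ultimately show ?thesis using 1 by (simp add: q_def e_def)
qed

lemma quadratic_roots:
  fixes u v c :: "'a::field"
  assumes "c^2 + u * c - v = 0"
  shows "{l. l^2 + u * l - v = 0} = {c, - u - c}"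
proof -
  have "l^2 + u * l - v = (l - c) * (l - (- u - c))" for l
  proof -
    have "l^2 + u * l - v = (l - c) * (l - (- u - c)) + (c^2 + u * c - v)" by Groebner_Basis.algebra
    then show ?thesis using assms by simp
  qed
  then show ?thesis by auto
qed

text \<open>The roots of the quadratic are the tangent slopes at the singular point: a double root
  at a cusp, and at a node two roots or none, according to whether the tangents are
  rational.\<close>

lemma card_nonsing_bad:
  fixes V :: "'a::{field,finite} weierstrass"
  assumes s: "weierstrass_poly V x0 y0 = 0" "weierstrass_poly_dx V x0 y0 = 0" "weierstrass_poly_dy V x0 y0 = 0"
  shows "(\<exists>c. wa1 V = - 2 * c \<and> - (3 * x0 + wa2 V) = c^2) \<Longrightarrow> card (nonsing V) = CARD('a)"
    "\<not> (\<exists>c. wa1 V = - 2 * c \<and> - (3 * x0 + wa2 V) = c^2) \<Longrightarrow>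
      card (nonsing V) = CARD('a) + 1 \<or> card (nonsing V) + 1 = CARD('a)"
proof -
  let ?R = "{l. l^2 + wa1 V * l - (3 * x0 + wa2 V) = 0}"
  note card = card_nonsing_singular[OF s]
  show "card (nonsing V) = CARD('a)" if ex: "\<exists>c. wa1 V = - 2 * c \<and> - (3 * x0 + wa2 V) = c^2"
  proof -
    obtain c where c: "wa1 V = - 2 * c" "- (3 * x0 + wa2 V) = c^2" using ex by blast
    have "3 * x0 + wa2 V = - (c^2)" using c(2) by (metis minus_minus)
    then have "c^2 + wa1 V * c - (3 * x0 + wa2 V) = 0" unfolding c(1) by (simp add: power2_eq_square)
    from quadratic_roots[OF this] have "?R = {c}" unfolding c(1) by auto
    then show ?thesis using card by simp
  qed
  show "card (nonsing V) = CARD('a) + 1 \<or> card (nonsing V) + 1 = CARD('a)"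
    if n: "\<not> (\<exists>c. wa1 V = - 2 * c \<and> - (3 * x0 + wa2 V) = c^2)"
  proof (cases "?R = {}")
    case True
    then show ?thesis using card by simp
  next
    case False
    then obtain c where c: "c^2 + wa1 V * c - (3 * x0 + wa2 V) = 0" by blast
    have "c \<noteq> - wa1 V - c"
    proof
      assume "c = - wa1 V - c"
      then have a: "wa1 V = - 2 * c" by Groebner_Basis.algebra
      have "- (3 * x0 + wa2 V) = c^2" using c unfolding a by Groebner_Basis.algebra
      then show False using n a by blast
    qed
    then have "card ?R = 2" using quadratic_roots[OF c] by simp
    then show ?thesis using card by simp
  qed
qed

section \<open>The Hasse bound for an arbitrary equation\<close>

lemma card_nonsing_le:
  fixes V :: "'a::{field,finite} weierstrass"
  shows "card (nonsing V) \<le> 2 * CARD('a) + 1"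
proof -
  define Y where "Y x = {y. weierstrass_poly V x y = 0}" for x
  have Y: "card (Y x) \<le> 2" for x
  proof (cases "Y x = {}")
    case False
    then obtain c where c: "weierstrass_poly V x c = 0" by (auto simp: Y_def)
    let ?u = "wa1 V * x + wa3 V" and ?v = "x^3 + wa2 V * x^2 + wa4 V * x + wa6 V"
    have w: "weierstrass_poly V x y = y^2 + ?u * y - ?v" for y
      by (simp add: weierstrass_poly_def algebra_simps)
    have "Y x = {c, - ?u - c}"
      unfolding Y_def w by (rule quadratic_roots) (use c in \<open>simp add: w\<close>)
    then show ?thesis by (simp add: card_insert_if)
  qed simp
  have "nonsing V \<subseteq> insert Infinity ((\<lambda>(x, y). Affine x y) ` (Sigma UNIV Y))"
    by (auto simp: nonsing_def Y_def)
  then have "card (nonsing V) \<le> card (insert Infinity ((\<lambda>(x, y). Affine x y) ` (Sigma UNIV Y)))"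
    by (intro card_mono) auto
  also have "\<dots> \<le> card ((\<lambda>(x, y). Affine x y) ` (Sigma UNIV Y)) + 1"
    by (simp add: card_insert_if)
  also have "card ((\<lambda>(x, y). Affine x y) ` (Sigma UNIV Y)) \<le> card (Sigma UNIV Y)"
    by (intro card_image_le) simp
  also have "card (Sigma UNIV Y) = (\<Sum>x\<in>UNIV. card (Y x))" by (simp add: card_SigmaI)
  also have "\<dots> \<le> (\<Sum>x\<in>(UNIV::'a set). 2)" by (intro sum_mono Y)
  finally show ?thesis by simp
qed

text \<open>For \<open>p \<ge> 5\<close> the equation is brought to the short form
  \<open>Y^2 = X^3 - 27 * c4 * X - 54 * c6\<close>. An injection of points suffices, because the
  bound limits their number from above.\<close>

lemma hasse_bound_large:
  fixes V :: "'q::prime_card mod_ring weierstrass"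
  assumes p5: "CARD('q) \<ge> 5" and disc: "discriminant V \<noteq> 0"
  shows "int (card (nonsing V)) \<le> int CARD('q) + 1 \<or>
    (int (card (nonsing V)) - int CARD('q) - 1)^2 \<le> 4 * int CARD('q)"
proof -
  define c4 where "c4 = b2 V ^ 2 - 24 * b4 V"
  define c6 where "c6 = - (b2 V ^ 3) + 36 * b2 V * b4 V - 216 * b6 V"
  define A B where "A = - 27 * c4" and "B = - 54 * c6"
  have two: "(2 :: 'q mod_ring) \<noteq> 0" and three: "(3 :: 'q mod_ring) \<noteq> 0"
    using numeral_mod_ring_neq_0[of _, where 'q='q] p5 by simp_all
  have nums: "(216 :: 'q mod_ring) \<noteq> 0" "(36 :: 'q mod_ring) \<noteq> 0" "(136048896 :: 'q mod_ring) \<noteq> 0"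
  proof -
    have e: "(216 :: 'q mod_ring) = 2 * 2 * 2 * 3 * 3 * 3" "(36 :: 'q mod_ring) = 2 * 2 * 3 * 3"
      by simp_all
    show "(216 :: 'q mod_ring) \<noteq> 0" "(36 :: 'q mod_ring) \<noteq> 0"
      unfolding e using two three by (metis mult_eq_0_iff)+
    moreover have "(136048896 :: 'q mod_ring) = 216 * 216 * 36 * 3 * 3 * 3 * 3"
      by simp
    ultimately show "(136048896 :: 'q mod_ring) \<noteq> 0" using three by (metis mult_eq_0_iff)
  qed
  have "4 * A^3 + 27 * B^2 = - (78732 * (c4^3 - c6^2))"
    unfolding A_def B_def by Groebner_Basis.algebra
  also have "c4 ^ 3 - c6 ^ 2 = 432 * (- (b2 V ^ 3 * b6 V) + b2 V ^ 2 * b4 V ^ 2 - 32 * b4 V ^ 3 - 108 * b6 V ^ 2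
      + 36 * b2 V * b4 V * b6 V)"
    unfolding c4_def c6_def by Groebner_Basis.algebra
  also have "\<dots> = 432 * (4 * discriminant V)" unfolding discriminant_b ..
  finally have "4 * A^3 + 27 * B^2 = - (136048896 * discriminant V)" by simp
  then have AB: "4 * A^3 + 27 * B^2 \<noteq> 0" using disc nums(3) by simp
  let ?S = "{(x, y). weierstrass_poly V x y = 0}"
  let ?T = "{(X, Y). Y^2 = X^3 + A * X + B}"
  \<comment> \<open>The usual substitution, scaled by 36 in \<open>x\<close> and by 216 in
    \<open>y\<close> to avoid denominators.\<close>
  define \<phi> where "\<phi> = (\<lambda>(x, y). (36 * x + 3 * b2 V, 108 * weierstrass_poly_dy V x y))"
  have inj: "inj_on \<phi> ?S"
  proof (rule inj_onI)
    fix P Q assume "\<phi> P = \<phi> Q"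
    then obtain x y x' y' where PQ: "P = (x, y)" "Q = (x', y')" and
      e: "36 * x + 3 * b2 V = 36 * x' + 3 * b2 V" "108 * weierstrass_poly_dy V x y = 108 * weierstrass_poly_dy V x' y'"
      by (cases P; cases Q) (auto simp: \<phi>_def)
    have x: "x = x'" using e(1) nums by simp
    have "216 * (y - y') = 0" using e(2) unfolding x weierstrass_poly_dy_def by Groebner_Basis.algebra
    then show "P = Q" using x nums PQ by simp
  qed
  have im: "\<phi> ` ?S \<subseteq> ?T"
  proof clarify
    fix x y X Y assume w: "weierstrass_poly V x y = 0" and XY: "(X, Y) = \<phi> (x, y)"
    have X: "X = 36 * x + 3 * b2 V" and Y: "Y = 108 * weierstrass_poly_dy V x y" using XY by (auto simp: \<phi>_def)
    have "weierstrass_poly_dy V x y ^ 2 = 4 * x^3 + b2 V * x^2 + 2 * b4 V * x + b6 V"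
      using weierstrass_complete_square(1)[of V x y] w by simp
    then have "Y^2 = 11664 * (4 * x^3 + b2 V * x^2 + 2 * b4 V * x + b6 V)"
      unfolding Y power_mult_distrib by simp
    also have "\<dots> = X^3 + A * X + B" unfolding X A_def B_def c4_def c6_def by Groebner_Basis.algebra
    finally show "Y^2 = X^3 + A * X + B" .
  qed
  have "card ?S \<le> card ?T" by (rule card_inj_on_le[OF inj im]) simp
  moreover have "card (nonsing V) = card ?S + 1"
  proof -
    have "nonsing V = insert Infinity ((\<lambda>(x, y). Affine x y) ` ?S)"
      unfolding nonsing_eq_curve_points[OF disc] curve_points_def by auto
    moreover have "card ((\<lambda>(x, y). Affine x y) ` ?S) = card ?S"
      by (rule card_image) (auto simp: inj_on_def)
    moreover have "Infinity \<notin> (\<lambda>(x, y). Affine x y) ` ?S" by auto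
    ultimately show ?thesis by simp
  qed
  ultimately have le: "card (nonsing V) \<le> card ?T + 1" by simp
  show ?thesis
  proof (cases "int (card (nonsing V)) \<le> int CARD('q) + 1")
    case False
    have "int (card ?T + 1) \<le> int CARD('q) + 1 \<or> (int (card ?T + 1) - int CARD('q) - 1)^2 \<le> 4 * int CARD('q)"
      by (rule hasse_bound_short[OF p5 AB])
    moreover have "\<not> int (card ?T + 1) \<le> int CARD('q) + 1" using False le by linarith
    ultimately have "(int (card ?T + 1) - int CARD('q) - 1)^2 \<le> 4 * int CARD('q)" by blast
    moreover have "(int (card (nonsing V)) - int CARD('q) - 1)^2 \<le> (int (card ?T + 1) - int CARD('q) - 1)^2"
      using False le by (intro power_mono) linarith+
    ultimately show ?thesis by linarith
  qed simp
qed

lemma hasse_bound_mod_ring: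
  fixes V :: "'q::prime_card mod_ring weierstrass"
  assumes disc: "discriminant V \<noteq> 0"
  shows "int (card (nonsing V)) \<le> int CARD('q) + 1 \<or>
    (int (card (nonsing V)) - int CARD('q) - 1)^2 \<le> 4 * int CARD('q)"
proof (cases "CARD('q) \<ge> 5")
  case True
  then show ?thesis using hasse_bound_large[OF _ disc] by blast
next
  case False
  let ?N = "int (card (nonsing V))" and ?p = "int CARD('q)"
  have "prime CARD('q)" by (rule prime_card)
  moreover have "\<not> prime (4::nat)" using prime_product[of 2 2] by auto
  ultimately have "CARD('q) \<noteq> 4" by metis
  then have p: "?p = 2 \<or> ?p = 3" using False prime_ge_2_nat[OF prime_card[where 'a='q]] by linarith
  have "card (nonsing V) \<le> 2 * CARD('q) + 1" using card_nonsing_le[of V] by simp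
  then have N: "?N \<le> 2 * ?p + 1" by linarith
  \<comment> \<open>For the primes 2 and 3 the trivial count already lies within the bound, as
    \<open>p^2 \<le> 4 * p\<close>.\<close>
  have "(?N - ?p - 1)^2 \<le> ?p^2" if "?N > ?p + 1"
    using that N by (intro power_mono) linarith+
  moreover have "?p^2 \<le> 4 * ?p" using p by auto
  ultimately show ?thesis by linarith
qed

section \<open>Passage from residue types to all primes\<close>

lemma cong_iff_of_int: "[m = n] (mod int CARD('a)) \<longleftrightarrow> (of_int m :: 'a::prime_card mod_ring) = of_int n"
  unfolding cong_iff_dvd_diff of_int_mod_ring_eq_0_iff[where 'a='a, symmetric] of_int_diff right_minus_eq ..

lemma ex_mod_ring_iff: "(\<exists>u::'a::prime_card mod_ring. Q u) \<longleftrightarrow> (\<exists>m::int. Q (of_int m))"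
  by (metis of_int_to_int_mod_ring)

lemma additive_reduction_iff:
  fixes F :: "'q::prime_card mod_ring weierstrass"
  assumes F: "F = map_weierstrass of_int W"
  shows "additive_reduction W CARD('q) \<longleftrightarrow> (\<exists>x y c. weierstrass_poly F x y = 0 \<and> weierstrass_poly_dx F x y = 0 \<and>
    weierstrass_poly_dy F x y = 0 \<and> wa1 F = - 2 * c \<and> - (3 * x + wa2 F) = c^2)" (is "?L = ?R")
proof -
  have a: "wa1 F = of_int (wa1 W)" "wa2 F = of_int (wa2 W)" unfolding F by (simp_all add: weierstrass.map_sel)
  have "?L \<longleftrightarrow> (\<exists>x y c :: int. weierstrass_poly F (of_int x) (of_int y) = 0 \<and> weierstrass_poly_dx F (of_int x) (of_int y) = 0 \<and>
    weierstrass_poly_dy F (of_int x) (of_int y) = 0 \<and> wa1 F = - 2 * of_int c \<and> - (3 * of_int x + wa2 F) = (of_int c)^2)"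
    unfolding additive_reduction_def singular_mod_def cong_iff_of_int[where 'a='q] a unfolding F weierstrass_of_int
    by simp
  also have "\<dots> \<longleftrightarrow> ?R" by (simp only: ex_mod_ring_iff)
  finally show ?thesis .
qed

text \<open>Bundles everything proved by means of residue types into one predicate on numbers, so
  that the passage to arbitrary primes is made once.\<close>

definition reduction_facts :: "nat \<Rightarrow> bool" where
  "reduction_facts p \<longleftrightarrow> (\<forall>W :: int weierstrass.
     (additive_reduction W p \<longrightarrow> int p dvd discriminant W \<and> card (ns_points_mod W p) = p) \<and>
     (int p dvd discriminant W \<and> \<not> additive_reduction W p \<longrightarrow>
        card (ns_points_mod W p) = p + 1 \<or> card (ns_points_mod W p) + 1 = p) \<and>
     (\<not> int p dvd discriminant W \<longrightarrow> ns_points_mod W p = points_mod W p \<and>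
        card (ns_points_mod W p) \<le> 2 * p + 1 \<and>
        (int (card (ns_points_mod W p)) \<le> int p + 1 \<or> (int (card (ns_points_mod W p)) - int p - 1)^2 \<le> 4 * int p)) \<and>
     (\<forall>P \<in> curve_points (over_rat W). \<not> int p dvd discriminant W \<longrightarrow> reduce_point p P \<in> ns_points_mod W p) \<and>
     (\<forall>P D. eds_curve W P D \<and> reduce_point p P \<in> ns_points_mod W p \<longrightarrow>
        rank_app D p dvd card (ns_points_mod W p) \<and> rank_app D p \<ge> 1))"

lemma reduction_facts_mod_ring: "reduction_facts CARD('q::prime_card)"
  unfolding reduction_facts_def
proof (intro allI ballI conjI impI)
  fix W :: "int weierstrass"
  define F :: "'q mod_ring weierstrass" where F: "F = map_weierstrass of_int W"
  let ?N = "card (ns_points_mod W CARD('q))"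
  have N: "?N = card (nonsing F)" unfolding F by (rule card_ns_points_mod)
  have disc: "int CARD('q) dvd discriminant W \<longleftrightarrow> discriminant F = 0"
    unfolding F discriminant_of_int of_int_mod_ring_eq_0_iff ..
  {
    assume "additive_reduction W CARD('q)"
    then obtain x y c where *: "weierstrass_poly F x y = 0" "weierstrass_poly_dx F x y = 0"
      "weierstrass_poly_dy F x y = 0" "wa1 F = - 2 * c \<and> - (3 * x + wa2 F) = c^2"
      unfolding additive_reduction_iff[OF F] by blast
    show "int CARD('q) dvd discriminant W" unfolding disc using *(1-3) by (rule discriminant_singular)
    show "?N = CARD('q)" unfolding N using card_nonsing_bad(1)[OF *(1-3)] *(4) by auto
  }
  {
    assume a: "int CARD('q) dvd discriminant W \<and> \<not> additive_reduction W CARD('q)"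
    then obtain x y where *: "weierstrass_poly F x y = 0" "weierstrass_poly_dx F x y = 0"
      "weierstrass_poly_dy F x y = 0" using singular_point_exists[of F] disc by blast
    then have "\<not> (\<exists>c. wa1 F = - 2 * c \<and> - (3 * x + wa2 F) = c^2)"
      using a unfolding additive_reduction_iff[OF F] by blast
    then show "?N = CARD('q) + 1 \<or> ?N + 1 = CARD('q)"
      unfolding N using card_nonsing_bad(2)[OF *] by simp
  }
  {
    assume "\<not> int CARD('q) dvd discriminant W"
    then have d: "discriminant F \<noteq> 0" using disc by simp
    show "?N \<le> 2 * CARD('q) + 1" unfolding N using card_nonsing_le[of F] by simp
    show "int ?N \<le> int CARD('q) + 1 \<or> (int ?N - int CARD('q) - 1)^2 \<le> 4 * int CARD('q)"
      unfolding N by (rule hasse_bound_mod_ring[OF d])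
    have "\<not> singular_mod W CARD('q) x y" for x y
    proof
      assume "singular_mod W CARD('q) x y"
      then have "weierstrass_poly F (of_int x) (of_int y) = 0" "weierstrass_poly_dx F (of_int x) (of_int y) = 0"
        "weierstrass_poly_dy F (of_int x) (of_int y) = 0"
        unfolding F weierstrass_of_int singular_mod_def cong_0_iff_of_int[where 'a='q] by auto
      then show False using d discriminant_singular by blast
    qed
    then show "ns_points_mod W CARD('q) = points_mod W CARD('q)" by (auto simp: ns_points_mod_def)
  }
  {
    fix P assume P: "P \<in> curve_points (over_rat W)" and d: "\<not> int CARD('q) dvd discriminant W"
    interpret R: prime_field "int CARD('q)" "red :: rat \<Rightarrow> 'q mod_ring"
      by unfold_locales (simp_all add: prime_card)
    have "R.redpt P \<in> nonsing F"
      using R.redpt_curve[OF P] nonsing_eq_curve_points[of F] d disc unfolding F by simp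
    then show "reduce_point CARD('q) P \<in> ns_points_mod W CARD('q)"
      unfolding R.reduce_point_eq[OF P] residue_point_nonsing F .
  }
  {
    fix P D assume "eds_curve W P D \<and> reduce_point CARD('q) P \<in> ns_points_mod W CARD('q)"
    then have "rank_app D CARD('q) dvd ?N \<and> rank_app D CARD('q) \<ge> 1"
      using eds_curve.rank_app_dvd_card_mod_ring by blast
    then show "rank_app D CARD('q) dvd ?N" "rank_app D CARD('q) \<ge> 1" by auto
  }
qed

text \<open>
  Types cannot depend on a prime. The following type has as its cardinality a prime that violates
  \<open>reduction_facts\<close>, if there is any, so that no prime can do so.
\<close>

definition exceptional_prime :: nat where
  "exceptional_prime = (SOME p. prime p \<and> ((\<exists>q. prime q \<and> \<not> reduction_facts q) \<longrightarrow> \<not> reduction_facts p))"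

lemma exceptional_prime:
  "prime exceptional_prime" "prime q \<Longrightarrow> \<not> reduction_facts q \<Longrightarrow> \<not> reduction_facts exceptional_prime"
proof -
  have "\<exists>p::nat. prime p \<and> ((\<exists>q. prime q \<and> \<not> reduction_facts q) \<longrightarrow> \<not> reduction_facts p)"
    using two_is_prime_nat by blast
  from someI_ex[OF this] show "prime exceptional_prime"
    "prime q \<Longrightarrow> \<not> reduction_facts q \<Longrightarrow> \<not> reduction_facts exceptional_prime"
    unfolding exceptional_prime_def by blast+
qed

typedef exceptional = "{0..<exceptional_prime}"
  using prime_gt_0_nat[OF exceptional_prime(1)] by auto

lemma card_exceptional: "CARD(exceptional) = exceptional_prime"
  using type_definition.card[OF type_definition_exceptional] by simp

instance exceptional :: prime_card
  by standard (simp add: card_exceptional exceptional_prime)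

lemma reduction_facts_prime: "prime p \<Longrightarrow> reduction_facts p"
  using exceptional_prime(2)[of p] reduction_facts_mod_ring[where 'q=exceptional] unfolding card_exceptional by blast

section \<open>Indices dividing their terms\<close>

lemma prime_power_dvd_imp_dvd:
  fixes a b :: nat
  assumes "a > 0" "\<And>p. prime p \<Longrightarrow> p ^ multiplicity p a dvd b"
  shows "a dvd b"
proof (cases "b = 0")
  case False
  show ?thesis
  proof (rule multiplicity_le_imp_dvd)
    show "multiplicity p a \<le> multiplicity p b" if "prime p" for p
      using assms(2)[OF that] that False by (intro multiplicity_geI) (auto dest: not_prime_unit)
  qed (use assms(1) in simp)
qed simp

text \<open>\<open>q * m\<close> and \<open>m\<close> differ only in the exponent of
  \<open>q\<close>, so a divisor of the former that does not divide the latter carries the full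
  power of \<open>q\<close>.\<close>

lemma prime_power_dvd_quotient:
  fixes q r m :: nat
  assumes q: "prime q" and m: "m > 0" and r: "r dvd q * m" "\<not> r dvd m"
  shows "q ^ multiplicity q (q * m) dvd r"
proof (rule ccontr)
  assume n: "\<not> q ^ multiplicity q (q * m) dvd r"
  have qm: "q * m > 0" using q m prime_gt_0_nat by simp
  then have r0: "r > 0" using r(1) by (auto intro: Nat.gr0I)
  have "multiplicity q r < multiplicity q (q * m)"
    using n r0 q by (meson multiplicity_dvd' not_less)
  then have le: "multiplicity q r \<le> multiplicity q m"
    using q m by (simp add: prime_elem_multiplicity_mult_distrib prime_imp_prime_elem)
  have "r dvd m"
  proof (rule prime_power_dvd_imp_dvd[OF r0])
    fix p :: nat assume p: "prime p"
    show "p ^ multiplicity p r dvd m"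
    proof (cases "p = q")
      case True
      then show ?thesis using le by (simp add: multiplicity_dvd')
    next
      case False
      have "p ^ multiplicity p r dvd q * m" using r(1) multiplicity_dvd dvd_trans by blast
      moreover have "coprime (p ^ multiplicity p r) q" using False p q by (simp add: primes_coprime)
      ultimately show ?thesis using coprime_dvd_mult_right_iff by blast
    qed
  qed
  then show False using r(2) by blast
qed

text \<open>The interface between geometry and combinatorics: \<open>N p\<close> stands for the
  number of nonsingular points modulo \<open>p\<close>, and the last assumption is regularity at
  2.\<close>

locale eds_divisibility =
  fixes D :: "nat \<Rightarrow> nat" and N :: "nat \<Rightarrow> nat" and good additive :: "nat \<Rightarrow> bool"
  assumes D_pos: "n \<ge> 1 \<Longrightarrow> D n > 0"
    and prime_power_dvd_iff: "prime p \<Longrightarrow> k \<ge> 1 \<Longrightarrow> n \<ge> 1 \<Longrightarrow> p ^ k dvd D n \<longleftrightarrow> rank_app D (p ^ k) dvd n"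
    and lift: "prime p \<Longrightarrow> k \<ge> 1 \<Longrightarrow> n \<ge> 1 \<Longrightarrow> p ^ k dvd D n \<Longrightarrow> p ^ (k + 1) dvd D (p * n)"
    and rank_dvd_N: "prime p \<Longrightarrow> rank_app D p dvd N p"
    and rank_pos: "prime p \<Longrightarrow> rank_app D p \<ge> 1"
    and N_pos: "prime p \<Longrightarrow> N p \<ge> 1"
    and N_additive: "prime p \<Longrightarrow> additive p \<Longrightarrow> N p = p"
    and N_good: "prime p \<Longrightarrow> good p \<Longrightarrow> N p \<le> 2 * p + 1"
    and N_bad: "prime p \<Longrightarrow> \<not> good p \<Longrightarrow> \<not> additive p \<Longrightarrow> N p = p + 1 \<or> N p + 1 = p"
    and regular_2: "good 2 \<Longrightarrow> N 2 = 4 \<Longrightarrow> rank_app D 2 = 4 \<Longrightarrow> odd (D 2) \<Longrightarrow> multiplicity 2 (D 4) \<noteq> 1"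
begin

abbreviation "r \<equiv> rank_app D"
abbreviation "S \<equiv> index_divisors D"

lemma S_iff: "n \<in> S \<longleftrightarrow> n \<ge> 1 \<and> n dvd D n" by (simp add: index_divisors_def)

lemma prime_dvd_iff: "prime p \<Longrightarrow> n \<ge> 1 \<Longrightarrow> p dvd D n \<longleftrightarrow> r p dvd n"
  using prime_power_dvd_iff[of p 1 n] by simp

lemma dvd_mono:
  assumes "prime p" "p ^ k dvd D m" "m dvd n" "n \<ge> 1"
  shows "p ^ k dvd D n"
proof (cases "k = 0")
  case False
  have "m \<ge> 1" using assms(3,4) by (cases m) auto
  then show ?thesis using assms False prime_power_dvd_iff[of p k] dvd_trans by simp
qed simp

lemma S_I:
  assumes "n \<ge> 1" "\<And>p. prime p \<Longrightarrow> p dvd n \<Longrightarrow> p ^ multiplicity p n dvd D n"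
  shows "n \<in> S"
  unfolding S_iff using assms by (metis not_dvd_imp_multiplicity_0 power_0 one_dvd prime_power_dvd_imp_dvd
    less_le_trans zero_less_one)

lemma S_power: "n \<in> S \<Longrightarrow> p ^ multiplicity p n dvd D n"
  unfolding S_iff using multiplicity_dvd dvd_trans by blast

text \<open>Only the exponent of \<open>p\<close> grows: \<open>lift\<close> supplies the new factor
  if \<open>p\<close> divides \<open>n\<close> already, and the hypothesis on
  \<open>D (n * p)\<close> does if not.\<close>

lemma S_mult_prime:
  assumes n: "n \<in> S" and p: "prime p" and d: "p dvd D (n * p)"
  shows "n * p \<in> S"
proof (rule S_I)
  have n1: "n \<ge> 1" using n S_iff by blast
  show np: "n * p \<ge> 1" using n1 prime_gt_0_nat[OF p] by simp
  fix q :: nat assume q: "prime q"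
  show "q ^ multiplicity q (n * p) dvd D (n * p)"
  proof (cases "q = p")
    case False
    then have "multiplicity q (n * p) = multiplicity q n"
      using p q n1 by (simp add: prime_elem_multiplicity_mult_distrib prime_imp_prime_elem prime_multiplicity_other prime_gt_0_nat)
    then show ?thesis using dvd_mono[OF q S_power[OF n]] np by simp
  next
    case True
    then have m: "multiplicity q (n * p) = multiplicity q n + 1"
      using p q n1 by (simp add: prime_elem_multiplicity_mult_distrib prime_imp_prime_elem prime_gt_0_nat)
    show ?thesis
    proof (cases "multiplicity q n = 0")
      case True
      then show ?thesis using m d \<open>q = p\<close> by simp
    next
      case False
      then show ?thesis using lift[OF q _ n1 S_power[OF n]] m \<open>q = p\<close> by (simp add: mult.commute)
    qed
  qed
qed

lemma arrow_mult_prime: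
  assumes "n \<in> S" "n * p \<in> S" and p: "prime p"
  shows "(n, n * p) \<in> arrows D"
proof -
  have n: "n > 0" using assms(1) S_iff by auto
  have "k = n \<or> k = n * p" if k: "n dvd k" "k dvd n * p" for k
  proof -
    obtain e where e: "k = n * e" using k(1) by blast
    then have "e dvd p" using k(2) n by simp
    then have "e = 1 \<or> e = p" using p prime_nat_iff by blast
    then show ?thesis using e by auto
  qed
  moreover have "n \<noteq> n * p" using n prime_gt_1_nat[OF p] by simp
  ultimately show ?thesis using assms by (auto simp: arrows_def)
qed

lemma part_a:
  assumes "n \<in> S" "prime p" "p dvd D n \<or> additive p"
  shows "n * p \<in> S" "(n, n * p) \<in> arrows D"
proof -
  have n1: "n \<ge> 1" "n * p \<ge> 1" using assms S_iff by (auto simp: prime_ge_Suc_0_nat)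
  have "p dvd D (n * p)" using assms(3)
  proof
    assume "p dvd D n"
    then show ?thesis using dvd_mono[of p 1 n "n * p"] assms(2) n1 by simp
  next
    assume "additive p"
    then have "r p dvd n * p" using rank_dvd_N[OF assms(2)] N_additive[OF assms(2)] by simp
    then show ?thesis using prime_dvd_iff assms(2) n1 by simp
  qed
  then show *: "n * p \<in> S" by (rule S_mult_prime[OF assms(1,2)])
  show "(n, n * p) \<in> arrows D" by (rule arrow_mult_prime[OF assms(1) * assms(2)])
qed

text \<open>By \<open>lift\<close> the rank of \<open>p^(k+1)\<close> divides \<open>p * n\<close>;
  if it also divides \<open>q * n\<close>, it divides their gcd \<open>n\<close>. Thus a further
  prime \<open>q\<close> in the index gains no factor \<open>p\<close> once \<open>p\<close> divides
  the term.\<close>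

lemma power_dvd_coprime_index:
  assumes "prime p" "prime q" "p \<noteq> q" "n \<ge> 1" "p dvd D n"
  shows "k \<ge> 1 \<Longrightarrow> p ^ k dvd D (q * n) \<Longrightarrow> p ^ k dvd D n"
proof (induction k rule: dec_induct)
  case (step k)
  have k: "p ^ k dvd D n" using step(3) step.prems by (metis dvd_trans le_imp_power_dvd le_SucI order_refl)
  have qn: "q * n \<ge> 1" "p * n \<ge> 1" using assms by (auto simp: prime_ge_Suc_0_nat)
  have "p ^ Suc k dvd D (p * n)" using lift[OF assms(1) step(1) assms(4) k] by simp
  then have "r (p ^ Suc k) dvd p * n" "r (p ^ Suc k) dvd q * n"
    using prime_power_dvd_iff[OF assms(1), of "Suc k"] qn step.prems by auto
  then have "r (p ^ Suc k) dvd gcd (p * n) (q * n)" by simp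
  also have "gcd (p * n) (q * n) = n"
    using primes_coprime[OF assms(1-3)] by (simp add: gcd_mult_distrib_nat[symmetric] mult.commute[of _ n])
  finally show ?case using prime_power_dvd_iff[OF assms(1), of "Suc k" n] assms(4) by simp
qed (use assms in simp)

lemma lift_iterate:
  assumes "prime p" "k \<ge> 1" "n \<ge> 1" "p ^ k dvd D n"
  shows "p ^ (k + i) dvd D (p ^ i * n)"
proof (induction i)
  case (Suc i)
  have "p ^ i * n \<ge> 1" using assms prime_gt_0_nat[OF assms(1)] by simp
  from lift[OF assms(1) _ this Suc] show ?case using assms(2) by (simp add: mult.assoc)
qed (use assms in simp)

subsection \<open>Generalized aliquot cycles\<close>

text \<open>If a prime of the cycle divides \<open>m\<close>, it divides \<open>D m\<close>, so its
  rank, the next prime of the cycle, divides \<open>m\<close> too.\<close>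

lemma cycle_closed:
  assumes c: "gen_aliquot_cycle D ps" and m: "m \<in> S" and p: "p \<in> set ps" "p dvd m"
  shows "\<forall>q\<in>set ps. q dvd m"
proof -
  let ?l = "length ps"
  have l: "?l > 0" using c by (auto simp: gen_aliquot_cycle_def)
  obtain i where i: "i < ?l" "ps ! i = p" using p(1) by (metis in_set_conv_nth)
  have step: "ps ! (Suc j mod ?l) dvd m" if "j < ?l" "ps ! j dvd m" for j
  proof -
    have "prime (ps ! j)" using c that(1) by (auto simp: gen_aliquot_cycle_def)
    moreover have "ps ! j dvd D m" using that(2) m S_iff dvd_trans by blast
    ultimately have "r (ps ! j) dvd m" using prime_dvd_iff m S_iff by blast
    then show ?thesis using c that(1) by (simp add: gen_aliquot_cycle_def)
  qed
  have all: "ps ! ((i + j) mod ?l) dvd m" for j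
  proof (induction j)
    case (Suc j)
    have "(i + j) mod ?l < ?l" using l by simp
    from step[OF this Suc] show ?case by (simp add: mod_Suc_eq)
  qed (use i p in simp)
  show ?thesis
  proof
    fix q assume "q \<in> set ps"
    then obtain k where k: "k < ?l" "ps ! k = q" by (metis in_set_conv_nth)
    \<comment> \<open>Going round by \<open>k + ?l - i\<close> steps avoids truncated subtraction
      when \<open>k < i\<close>.\<close>
    have "(i + (k + ?l - i)) mod ?l = k" using i k by simp
    then show "q dvd m" using all[of "k + ?l - i"] k by simp
  qed
qed

lemma cycle_primes:
  assumes "gen_aliquot_cycle D ps"
  shows "\<And>p. p \<in> set ps \<Longrightarrow> prime p" "prod_list ps = \<Prod>(set ps)" "prod_list ps > 1" "distinct ps"
    "\<And>p. p \<in> set ps \<Longrightarrow> r p \<in> set ps"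
proof -
  show pr: "\<And>p. p \<in> set ps \<Longrightarrow> prime p" and dis: "distinct ps" using assms by (auto simp: gen_aliquot_cycle_def)
  show pl: "prod_list ps = \<Prod>(set ps)" using dis by (induction ps) auto
  obtain p where p: "p \<in> set ps" using assms by (cases ps) (auto simp: gen_aliquot_cycle_def)
  have "prod_list ps \<noteq> 0" using pr[of 0] by (auto simp: prod_list_zero_iff)
  moreover have "p dvd prod_list ps" unfolding pl using dvd_prodI[OF _ p, of "\<lambda>x. x"] by simp
  ultimately have "p \<le> prod_list ps" by (intro dvd_imp_le) blast+
  then show "prod_list ps > 1" using prime_gt_1_nat[OF pr[OF p]] by linarith
  show "r p \<in> set ps" if "p \<in> set ps" for p
  proof -
    have "\<exists>i<length ps. ps ! i = p" using that by (simp only: in_set_conv_nth)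
    then obtain i where i: "i < length ps" "ps ! i = p" by blast
    have "r (ps ! i) = ps ! (Suc i mod length ps)" using assms i(1) by (simp add: gen_aliquot_cycle_def)
    moreover have "Suc i mod length ps < length ps" by (rule mod_less_divisor) (use i(1) in linarith)
    ultimately show ?thesis unfolding i(2) by simp
  qed
qed

lemma prod_primes_dvd:
  fixes X :: "nat set"
  assumes "finite X" "\<And>p. p \<in> X \<Longrightarrow> prime p" "\<And>p. p \<in> X \<Longrightarrow> p dvd m"
  shows "\<Prod>X dvd m"
  using assms
proof (induction X rule: finite_induct)
  case (insert p X)
  have "coprime p (\<Prod>X)"
    using insert by (intro prod_coprime_right) (metis insertCI primes_coprime)
  then show ?case using insert by (simp add: divides_mult)
qed simp

lemma multiplicity_prod_primes:
  fixes X :: "nat set"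
  assumes "finite X" "\<And>p. p \<in> X \<Longrightarrow> prime p" "prime q"
  shows "multiplicity q (\<Prod>X) = (if q \<in> X then 1 else 0)"
proof -
  have "0 \<notin> X" using assms(2) not_prime_0 by blast
  then have "multiplicity q (\<Prod>X) = (\<Sum>p\<in>X. multiplicity q p)"
    using assms by (subst prime_elem_multiplicity_prod_distrib) auto
  also have "\<dots> = (\<Sum>p\<in>X. if p = q then 1 else 0)"
    using assms by (intro sum.cong) (auto simp: prime_multiplicity_other)
  finally show ?thesis using assms(1) by simp
qed

text \<open>Each prime of the cycle raises its exponent by one: \<open>lift\<close> covers this if
  the prime divides \<open>n\<close>, and otherwise its rank is in the cycle and so divides
  \<open>d\<close>. Nothing lies strictly between because an element of \<open>S\<close> divisible
  by one prime of the cycle is divisible by all.\<close>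

lemma part_b:
  assumes n: "n \<in> S" and d: "d \<in> gen_aliquot_products D"
  shows "n * d \<in> S" "gcd d n \<in> {1, d}" "gcd d n = 1 \<Longrightarrow> (n, n * d) \<in> arrows D"
proof -
  obtain ps where ps: "gen_aliquot_cycle D ps" "d = prod_list ps"
    using d by (auto simp: gen_aliquot_products_def)
  note c = cycle_primes[OF ps(1)]
  have dX: "d = \<Prod>(set ps)" using ps c(2) by simp
  have d1: "d > 1" using c(3) ps by simp
  have n1: "n \<ge> 1" using n S_iff by blast
  have in_X: "p \<in> set ps" if p: "prime p" "p dvd d" for p
  proof -
    obtain q where "q \<in> set ps" "p dvd q" 
      using p prime_dvd_prod_iff[of "set ps" p "\<lambda>x. x"] unfolding dX by auto
    then show ?thesis using p(1) c(1) primes_dvd_imp_eq by blast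
  qed
  have all: "d dvd m" if "m \<in> S" "p \<in> set ps" "p dvd m" for m p
    unfolding dX using cycle_closed[OF ps(1) that] c(1) by (intro prod_primes_dvd) auto
  show "gcd d n \<in> {1, d}"
  proof (cases "gcd d n = 1")
    case False
    then obtain p where p: "prime p" "p dvd gcd d n" using prime_factor_nat by blast
    then have "p dvd d" "p dvd n" by auto
    then have "d dvd n" using all[OF n in_X] p by blast
    then show ?thesis by (simp add: gcd_proj1_if_dvd)
  qed simp
  show nd: "n * d \<in> S"
  proof (rule S_I)
    show nd1: "n * d \<ge> 1" using n1 d1 by simp
    fix q :: nat assume q: "prime q"
    have m: "multiplicity q (n * d) = multiplicity q n + (if q \<in> set ps then 1 else 0)"
      using q n1 d1 multiplicity_prod_primes[of "set ps" q] c(1)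
      by (simp add: prime_elem_multiplicity_mult_distrib prime_imp_prime_elem flip: dX)
    show "q ^ multiplicity q (n * d) dvd D (n * d)"
    proof (cases "q \<in> set ps")
      case False
      then show ?thesis using m dvd_mono[OF q S_power[OF n]] nd1 by simp
    next
      case True
      have qd: "q dvd d" unfolding dX using dvd_prodI[OF _ True, of "\<lambda>x. x"] by simp
      show ?thesis
      proof (cases "multiplicity q n = 0")
        case True
        have "r q dvd d" unfolding dX using dvd_prodI[OF _ c(5)[OF \<open>q \<in> set ps\<close>], of "\<lambda>x. x"] by simp
        then have "q dvd D (n * d)" using prime_dvd_iff[OF q nd1] by simp
        then show ?thesis using m True \<open>q \<in> set ps\<close> by simp
      next
        case False
        then have "q ^ (multiplicity q n + 1) dvd D (q * n)" using lift[OF q _ n1 S_power[OF n]] by simp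
        moreover have "q * n dvd n * d" using qd by (simp add: mult.commute)
        ultimately have "q ^ (multiplicity q n + 1) dvd D (n * d)" using nd1 by (rule dvd_mono[OF q])
        then show ?thesis using m \<open>q \<in> set ps\<close> by simp
      qed
    qed
  qed
  show "(n, n * d) \<in> arrows D" if cop: "gcd d n = 1"
  proof -
    have "k = n \<or> k = n * d" if k: "k \<in> S" "n dvd k" "k dvd n * d" for k
    proof -
      obtain e where e: "k = n * e" using k(2) by blast
      then have "e dvd d" using k(3) n1 by simp
      show ?thesis
      proof (cases "e = 1")
        case False
        then obtain p where p: "prime p" "p dvd e" using prime_factor_nat by blast
        then have "d dvd k" using all[OF k(1) in_X, of p] \<open>e dvd d\<close> e by auto
        moreover have "coprime n d" using cop by (metis coprime_iff_gcd_eq_1 gcd.commute)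
        ultimately have "n * d dvd k" using k(2) by (intro divides_mult)
        then show ?thesis using k(3) by (simp add: dvd_antisym)
      qed (simp add: e)
    qed
    then show ?thesis using n nd n1 d1 by (auto simp: arrows_def)
  qed
qed

subsection \<open>Arrows with prime and with composite weight\<close>

text \<open>\<open>r p\<close> divides \<open>n * p\<close> but not \<open>n\<close>, so
  \<open>p\<close> divides \<open>r p\<close> and thus \<open>N p\<close>. At a good prime this
  leaves \<open>N p = p\<close> or \<open>N p = 2 * p\<close>; at a node \<open>N p\<close> would be
  \<open>p - 1\<close> or \<open>p + 1\<close>, which \<open>p\<close> does not divide.\<close>

lemma part_c:
  assumes n: "n \<in> S" and p: "prime p" and pD: "\<not> p dvd D n" and arr: "(n, n * p) \<in> arrows D"
  shows "good p \<Longrightarrow> N p \<noteq> 2 * p \<Longrightarrow> gen_aliquot_cycle D [p]" "\<not> good p \<Longrightarrow> additive p"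
proof -
  have n1: "n \<ge> 1" using n S_iff by blast
  have np: "n * p \<in> S" using arr by (simp add: arrows_def)
  have "p dvd D (n * p)" using np S_iff dvd_trans by (metis dvd_triv_right)
  then have r: "r p dvd n * p" "\<not> r p dvd n"
    using prime_dvd_iff[OF p] np S_iff pD n1 by auto
  have pr: "p dvd r p"
  proof (rule ccontr)
    assume "\<not> p dvd r p"
    then have "coprime (r p) p" using p by (simp add: prime_imp_coprime coprime_commute)
    then show False using r by (simp add: coprime_dvd_mult_left_iff)
  qed
  then have pN: "p dvd N p" using rank_dvd_N[OF p] dvd_trans by blast
  have p2: "p \<ge> 2" using p by (rule prime_ge_2_nat)
  show "gen_aliquot_cycle D [p]" if g: "good p" "N p \<noteq> 2 * p"
  proof -
    obtain k where k: "N p = p * k" using pN by blast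
    have "k \<noteq> 0" using N_pos[OF p] k by auto
    moreover have "k < 3"
    proof (rule ccontr)
      assume "\<not> k < 3"
      then have "p * 3 \<le> N p" unfolding k by simp
      then show False using N_good[OF p g(1)] p2 by linarith
    qed
    moreover have "k \<noteq> 2" using g(2) k by auto
    ultimately have "N p = p" using k by (simp add: numeral_eq_Suc less_Suc_eq)
    then have "r p = p" using rank_dvd_N[OF p] pr by (simp add: dvd_antisym)
    then show ?thesis using p by (simp add: gen_aliquot_cycle_def)
  qed
  show "additive p" if "\<not> good p"
  proof (rule ccontr)
    assume "\<not> additive p"
    then have "N p = p + 1 \<or> N p + 1 = p" using N_bad[OF p that] by blast
    then have "p dvd 1" using pN by (metis dvd_add_right_iff dvd_refl)
    then show False using p2 by simp
  qed
qed

end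

text \<open>On a finite set the iterates of \<open>p\<close> repeat, and injectivity pulls the
  repetition back to \<open>p\<close> itself; the least period then lists the orbit without
  repetition.\<close>

lemma orbit_cycle:
  fixes f :: "'a \<Rightarrow> 'a"
  assumes X: "finite X" "f ` X \<subseteq> X" "inj_on f X" and p: "p \<in> X"
  obtains ps where "ps \<noteq> []" "distinct ps" "set ps \<subseteq> X"
    "\<And>i. i < length ps \<Longrightarrow> f (ps ! i) = ps ! (Suc i mod length ps)"
proof -
  have in_X: "(f ^^ i) p \<in> X" for i using X(2) p by (induction i) auto
  have cancel: "(f ^^ j) p = p" if "(f ^^ (i + j)) p = (f ^^ i) p" for i j
    using that
  proof (induction i)
    case (Suc i)
    then have "f ((f ^^ (i + j)) p) = f ((f ^^ i) p)" by simp
    then have "(f ^^ (i + j)) p = (f ^^ i) p" using X(3) in_X by (simp add: inj_on_def)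
    then show ?case by (rule Suc.IH)
  qed simp
  have "\<exists>l\<ge>1. (f ^^ l) p = p"
  proof -
    have "\<not> inj (\<lambda>i. (f ^^ i) p)"
    proof
      assume "inj (\<lambda>i. (f ^^ i) p)"
      moreover have "range (\<lambda>i. (f ^^ i) p) \<subseteq> X" using in_X by auto
      ultimately have "finite (UNIV :: nat set)" using X(1) by (metis finite_imageD finite_subset)
      then show False by simp
    qed
    then obtain i j where ij: "i < j" "(f ^^ i) p = (f ^^ j) p"
      unfolding inj_def by (metis linorder_neqE_nat)
    then have "(f ^^ (j - i)) p = p" using cancel[of i "j - i"] by simp
    then show ?thesis using ij(1) by (intro exI[of _ "j - i"]) simp
  qed
  define l where "l = (LEAST l. l \<ge> 1 \<and> (f ^^ l) p = p)"
  have l: "l \<ge> 1 \<and> (f ^^ l) p = p"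
    unfolding l_def by (rule LeastI_ex) (use \<open>\<exists>l\<ge>1. (f ^^ l) p = p\<close> in blast)
  have min: "l \<le> k" if "k \<ge> 1" "(f ^^ k) p = p" for k
    unfolding l_def by (rule Least_le) (use that in blast)
  define ps where "ps = map (\<lambda>i. (f ^^ i) p) [0..<l]"
  have len: "length ps = l" by (simp add: ps_def)
  have nth: "ps ! i = (f ^^ i) p" if "i < l" for i using that by (simp add: ps_def)
  show ?thesis
  proof
    show "ps \<noteq> []" using l len by auto
    show "set ps \<subseteq> X" using in_X by (auto simp: ps_def)
    have "i = j" if "i < l" "j < l" "(f ^^ i) p = (f ^^ j) p" "i \<le> j" for i j
    proof (rule ccontr)
      assume "i \<noteq> j"
      then have "(f ^^ (j - i)) p = p" using cancel[of i "j - i"] that by simp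
      moreover have "j - i \<ge> 1" using that \<open>i \<noteq> j\<close> by linarith
      ultimately have "l \<le> j - i" by (intro min)
      then show False using that by linarith
    qed
    then have "inj_on (\<lambda>i. (f ^^ i) p) {0..<l}"
      unfolding inj_on_def by (metis atLeastLessThan_iff nat_le_linear)
    then show "distinct ps" by (simp add: ps_def distinct_map)
    show "f (ps ! i) = ps ! (Suc i mod length ps)" if "i < length ps" for i
    proof (cases "Suc i = l")
      case True
      then have "f (ps ! i) = (f ^^ l) p" using that by (simp add: nth len flip: True)
      then show ?thesis using l nth[of 0] True by (simp add: len)
    next
      case False
      then show ?thesis using that by (simp add: nth len)
    qed
  qed
qed

context eds_divisibility
begin

context
  fixes n d :: nat
  assumes arr: "(n, n * d) \<in> arrows D" and comp: "composite d"
begin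

lemma nS: "n \<in> S" and ndS: "n * d \<in> S" and n1: "n \<ge> 1" and d1: "d > 1" and nd1: "n * d \<ge> 1"
  and between: "k \<in> S \<Longrightarrow> n dvd k \<Longrightarrow> k dvd n * d \<Longrightarrow> k = n \<or> k = n * d"
proof -
  show nS: "n \<in> S" and ndS: "n * d \<in> S" using arr by (simp_all add: arrows_def)
  show "n \<ge> 1" "n * d \<ge> 1" using nS ndS S_iff by blast+
  show "d > 1" using comp by (simp add: composite_def)
  show "k \<in> S \<Longrightarrow> n dvd k \<Longrightarrow> k dvd n * d \<Longrightarrow> k = n \<or> k = n * d"
    using arr by (auto simp: arrows_def)
qed

text \<open>If \<open>p\<close> divided \<open>D n\<close> or were additive, \<open>part_a\<close>
  would put \<open>n * p\<close> into \<open>S\<close>, strictly between \<open>n\<close> and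
  \<open>n * d\<close> because \<open>d\<close> is composite. The other facts follow from
  this.\<close>

lemma weight_prime:
  assumes p: "prime p" "p dvd d"
  shows "\<not> p dvd D n" "\<not> additive p" "\<not> p dvd n" "multiplicity p (n * d) = multiplicity p d"
    "r p dvd n * d" "\<not> r p dvd n" "r p > 1" "N p \<le> 2 * p + 1" "r p \<le> N p" "p dvd n * d"
proof -
  have *: "\<not> (p dvd D n \<or> additive p)"
  proof
    assume "p dvd D n \<or> additive p"
    then have "n * p \<in> S" using part_a(1)[OF nS p(1)] by blast
    then have "n * p = n \<or> n * p = n * d" using p(2) by (intro between) simp_all
    then have "p = d" using n1 prime_gt_1_nat[OF p(1)] by auto
    then show False using comp p(1) by (simp add: composite_def)
  qed
  then show pD: "\<not> p dvd D n" and na: "\<not> additive p" by auto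
  show pn: "\<not> p dvd n" using pD nS S_iff dvd_trans by blast
  then show "multiplicity p (n * d) = multiplicity p d"
    using p(1) n1 d1 by (simp add: prime_elem_multiplicity_mult_distrib prime_imp_prime_elem not_dvd_imp_multiplicity_0)
  show pnd: "p dvd n * d" using p(2) by simp
  have "p dvd D (n * d)" using pnd ndS S_iff dvd_trans by blast
  then show rnd: "r p dvd n * d" using prime_dvd_iff[OF p(1) nd1] by simp
  show rn: "\<not> r p dvd n" using prime_dvd_iff[OF p(1) n1] pD by simp
  have "r p \<noteq> 1" using rn by (metis one_dvd)
  then show "r p > 1" using rank_pos[OF p(1)] by simp
  show "N p \<le> 2 * p + 1"
    using N_good[OF p(1)] N_bad[OF p(1)] na by (cases "good p") auto
  show "r p \<le> N p" using rank_dvd_N[OF p(1)] N_pos[OF p(1)] by (intro dvd_imp_le) auto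
qed

text \<open>
  Removing one factor \<open>q\<close> must leave \<open>S\<close>; regularity at 2 excludes that the obstruction comes
  from the \<open>q\<close>-adic valuation with \<open>q\<close> still dividing the term.
\<close>

lemma weight_prime_in_rank:
  assumes q: "prime q" "q dvd d"
  shows "\<exists>p. prime p \<and> p dvd d \<and> q ^ multiplicity q d dvd r p"
proof -
  obtain c where c: "d = q * c" using q(2) by blast
  define m where "m = n * c"
  have nd: "n * d = q * m" by (simp add: m_def c)
  have m1: "m \<ge> 1" using nd1 unfolding nd by (cases m) auto
  \<comment> \<open>\<open>m\<close> is \<open>n * d / q\<close>, which lies strictly between
    \<open>n\<close> and \<open>n * d\<close>.\<close>
  have "m \<notin> S"
  proof
    assume "m \<in> S"
    then have "m = n \<or> m = n * d" by (intro between) (simp_all add: m_def c)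
    then show False
    proof
      assume "m = n"
      then have "c = 1" using n1 by (simp add: m_def)
      then show False using comp q(1) c by (simp add: composite_def)
    next
      assume "m = n * d"
      then show False using nd m1 prime_gt_1_nat[OF q(1)] by simp
    qed
  qed
  then obtain p where p: "prime p" "p dvd m" "\<not> p ^ multiplicity p m dvd D m" using S_I m1 by blast
  have from_rank: "q ^ multiplicity q d dvd r p'" if "r p' dvd n * d" "\<not> r p' dvd m" for p'
    using prime_power_dvd_quotient[OF q(1), of m "r p'"] that m1 weight_prime(4)[OF q] unfolding nd by simp
  show ?thesis
  proof (cases "p = q")
    \<comment> \<open>The exponent of \<open>p\<close> in \<open>m\<close> is that of
      \<open>n * d\<close>. If \<open>p\<close> divided \<open>D m\<close>,
      \<open>power_dvd_coprime_index\<close> would carry the full power from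
      \<open>D (n * d)\<close> down to \<open>D m\<close>; hence \<open>r p\<close> does not divide
      \<open>m\<close>.\<close>
    case False
    have pnd: "p dvd n * d" using p(2) nd by simp
    have e: "multiplicity p m = multiplicity p (n * d)"
      using p(1) q(1) m1 False unfolding nd
      by (simp add: prime_elem_multiplicity_mult_distrib prime_imp_prime_elem prime_multiplicity_other prime_gt_0_nat)
    have e1: "multiplicity p m \<ge> 1"
      using p(1,2) m1 by (intro multiplicity_geI) (auto dest: not_prime_unit)
    have "\<not> p dvd D m"
    proof
      assume "p dvd D m"
      moreover have "p ^ multiplicity p m dvd D (q * m)" unfolding e using S_power[OF ndS, of p] by (simp add: nd)
      ultimately have "p ^ multiplicity p m dvd D m"
        by (intro power_dvd_coprime_index[OF p(1) q(1) False m1 _ e1])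
      then show False using p(3) by blast
    qed
    then have rm: "\<not> r p dvd m" using prime_dvd_iff[OF p(1) m1] by simp
    have "\<not> p dvd n"
    proof
      assume "p dvd n"
      then have "p dvd D n" using nS S_iff dvd_trans by blast
      then have "p ^ 1 dvd D m" using dvd_mono[of p 1 n m] p(1) m1 by (simp add: m_def)
      then show False using \<open>\<not> p dvd D m\<close> by simp
    qed
    then have pd: "p dvd d" using pnd p(1) by (simp add: prime_dvd_mult_iff)
    show ?thesis using from_rank[OF weight_prime(5)[OF p(1) pd] rm] p(1) pd by blast
  next
    case True
    note wq = weight_prime[OF q]
    show ?thesis
    proof (cases "r q dvd m")
      case False
      then show ?thesis using from_rank[OF wq(5)] q by blast
    next
      case rm: True
      define j where "j = multiplicity q d"
      define a where "a = multiplicity q (r q)"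
      have mm: "multiplicity q m + 1 = j"
      proof -
        have "multiplicity q (q * m) = 1 + multiplicity q m"
          using q(1) m1 prime_gt_0_nat[OF q(1)] by (subst prime_elem_multiplicity_mult_distrib) (auto simp: prime_imp_prime_elem)
        then show ?thesis using wq(4) unfolding nd j_def by simp
      qed
      have r0: "r q \<noteq> 0" using wq(7) by simp
      have qa: "q ^ a dvd r q" unfolding a_def by (rule multiplicity_dvd)
      have "a \<le> multiplicity q m"
        unfolding a_def using rm m1 by (intro dvd_imp_multiplicity_le) auto
      then have aj: "a + 1 \<le> j" using mm by simp
      \<comment> \<open>\<open>m0 = m / q^i\<close> keeps exactly \<open>a\<close> factors
        \<open>q\<close>, the least that \<open>r q\<close> allows. Lifting \<open>i\<close> times
        from \<open>q dvd D m0\<close> yields \<open>q^(i+1)\<close>, while \<open>q^(a+i)\<close>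
        is required, so an obstruction needs \<open>a \<ge> 2\<close>.\<close>
      define i where "i = j - 1 - a"
      have qi: "q ^ i dvd m"
      proof -
        have "q ^ i dvd q ^ multiplicity q m" using mm i_def by (intro le_imp_power_dvd) simp
        then show ?thesis using multiplicity_dvd dvd_trans by blast
      qed
      then obtain m0 where m0: "m = q ^ i * m0" by blast
      have m01: "m0 \<ge> 1" using m0 m1 by (cases m0) auto
      have q0: "q > 0" using q(1) by (rule prime_gt_0_nat)
      have rm0: "r q dvd m0"
      proof (rule prime_power_dvd_imp_dvd)
        fix p' :: nat assume p': "prime p'"
        show "p' ^ multiplicity p' (r q) dvd m0"
        proof (cases "p' = q")
          case True
          have "multiplicity q m = i + multiplicity q m0"
            unfolding m0 using q(1) m01 q0
            by (subst prime_elem_multiplicity_mult_distrib) (auto simp: prime_imp_prime_elem)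
          then have "multiplicity q m0 = a" using mm aj by (simp add: i_def)
          then show ?thesis using True multiplicity_dvd[of q m0] by (simp add: a_def)
        next
          case False
          have "p' ^ multiplicity p' (r q) dvd q ^ i * m0"
            unfolding m0[symmetric] using rm multiplicity_dvd dvd_trans by blast
          moreover have "coprime (p' ^ multiplicity p' (r q)) (q ^ i)"
            using False p' q(1) by (simp add: primes_coprime)
          ultimately show ?thesis using coprime_dvd_mult_right_iff by blast
        qed
      qed (use r0 in simp)
      then have qD: "q dvd D m0" using prime_dvd_iff[OF q(1) m01] by simp
      have contra: False if "k + i \<ge> multiplicity q m" "k \<ge> 1" "q ^ k dvd D m0" for k
      proof -
        have "q ^ (k + i) dvd D m" unfolding m0 using lift_iterate[OF q(1) that(2) m01 that(3)] .
        then have "q ^ multiplicity q m dvd D m" using that(1) le_imp_power_dvd dvd_trans by blast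
        then show False using p(3) True by simp
      qed
      have a2: "a \<ge> 2"
      proof (rule ccontr)
        assume "\<not> a \<ge> 2"
        then have "1 + i \<ge> multiplicity q m" using mm aj unfolding i_def by linarith
        then show False using contra[of 1] qD by simp
      qed
      \<comment> \<open>Now \<open>q^2\<close> divides a number of size at most
        \<open>2 * q + 1\<close>, which leaves \<open>q = 2\<close> and rank 4.\<close>
      have rq: "r q \<le> 2 * q + 1" using wq(8,9) by simp
      have "q ^ 2 dvd r q" using qa a2 le_imp_power_dvd dvd_trans by blast
      then obtain s where s: "r q = q^2 * s" by blast
      have "s \<ge> 1" using s r0 by (cases s) auto
      have q2: "q = 2"
      proof (rule ccontr)
        assume "q \<noteq> 2"
        then have "q \<ge> 3" using prime_ge_2_nat[OF q(1)] by simp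
        then have "3 * q * 1 \<le> q * q * s" using \<open>s \<ge> 1\<close> by (intro mult_le_mono) auto
        then have "3 * q \<le> q^2 * s" by (simp add: power2_eq_square)
        then show False using rq s \<open>q \<ge> 3\<close> by simp
      qed
      have r2: "r 2 = 4" using rq s \<open>s \<ge> 1\<close> unfolding q2 by simp
      have N4: "N 2 = 4"
      proof -
        obtain k where k: "N 2 = 4 * k" using rank_dvd_N[of 2] r2 by auto
        have "k \<noteq> 0" using N_pos[of 2] k by auto
        moreover have "4 * k \<le> 5" using wq(8) k q2 by simp
        ultimately show ?thesis using k by simp
      qed
      have g2: "good 2" using N_bad[of 2] wq(2) N4 q2 by auto
      \<comment> \<open>With this all conditions of irregularity but the last hold, so regularity
        makes 4 divide \<open>D 4\<close>; lifting can then start at \<open>q^2\<close>, which is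
        enough for \<open>a = 2\<close>.\<close>
      have "odd (D 2)" using prime_dvd_iff[of 2 2] r2 by simp
      then have n1': "multiplicity 2 (D 4) \<noteq> 1" using regular_2 g2 N4 r2 by blast
      have D4: "D 4 > 0" by (rule D_pos) simp
      have "2 dvd D 4" using prime_dvd_iff[of 2 4] r2 by simp
      then have "multiplicity 2 (D 4) \<ge> 1" using D4 by (intro multiplicity_geI) auto
      then have "multiplicity 2 (D 4) \<ge> 2" using n1' by simp
      then have "2 ^ 2 dvd D 4" using multiplicity_dvd' by blast
      moreover have "4 dvd m0" using rm0 r2 q2 by simp
      ultimately have "2 ^ 2 dvd D m0" using dvd_mono[of 2 2 4 m0] m01 by simp
      moreover have "a = 2"
        unfolding a_def q2 r2 using multiplicity_same_power[of "2::nat" 2] by simp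
      moreover from this have "2 + i \<ge> multiplicity q m" using mm aj unfolding i_def by linarith
      ultimately show ?thesis using contra[of 2] q2 by simp
    qed
  qed
qed

section \<open>The inequality between primes and ranks\<close>

context
  fixes t p0 :: nat
  assumes t: "t = card {p. prime p \<and> p dvd d \<and> composite (r p)}"
    and p0: "p0 = Min (prime_factors (n * d))"
begin

lemma p0_le:
  assumes "s dvd n * d" "s > 1"
  shows "p0 \<le> s"
proof -
  obtain q where q: "prime q" "q dvd s" using prime_factor_nat[of s] assms(2) by auto
  have "q dvd n * d" using q(2) assms(1) dvd_trans by blast
  then have "q \<in> prime_factors (n * d)" using q(1) nd1 by (simp add: in_prime_factors_iff)
  then have "p0 \<le> q" unfolding p0 by simp
  also have "q \<le> s" using q(2) assms(2) by (intro dvd_imp_le) auto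
  finally show ?thesis .
qed

lemma p0_pos: "p0 \<ge> 1"
proof -
  obtain q where q: "prime q" "q dvd d" using prime_factor_nat[of d] d1 by auto
  then have "q \<in> prime_factors (n * d)" using nd1 by (simp add: in_prime_factors_iff)
  then have "p0 \<in> prime_factors (n * d)" unfolding p0 by (intro Min_in) auto
  then show ?thesis using prime_ge_1_nat by (auto simp: in_prime_factors_iff)
qed

text \<open>
  Each prime \<open>q\<close> of \<open>d\<close> is charged to a prime \<open>g q\<close> whose rank it divides. Multiplying
  both sides by \<open>p0\<close> for every charge avoids subtracting exponents.
\<close>

lemma rank_product_bound:
  "p0 ^ t * (\<Prod>p\<in>prime_factors d. p) \<le> (\<Prod>p\<in>prime_factors d. r p)"
proof -
  define X where "X = prime_factors d"
  have X: "p \<in> X \<longleftrightarrow> prime p \<and> p dvd d" for p using d1 by (auto simp: X_def in_prime_factors_iff)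
  have fin: "finite X" by (simp add: X_def)
  have "\<forall>q\<in>X. \<exists>p. p \<in> X \<and> q ^ multiplicity q d dvd r p"
  proof
    fix q assume "q \<in> X"
    then have "prime q" "q dvd d" by (simp_all add: X)
    from weight_prime_in_rank[OF this] show "\<exists>p. p \<in> X \<and> q ^ multiplicity q d dvd r p"
      by (simp add: X conj_assoc)
  qed
  then obtain g where g: "\<And>q. q \<in> X \<Longrightarrow> g q \<in> X \<and> q ^ multiplicity q d dvd r (g q)" by metis
  have qg: "q dvd r (g q)" if "q \<in> X" for q
  proof -
    have "multiplicity q d \<ge> 1" using that X d1 by (intro multiplicity_geI) (auto dest: not_prime_unit)
    then have "q ^ 1 dvd q ^ multiplicity q d" by (rule le_imp_power_dvd)
    then show ?thesis using g[OF that] dvd_trans by auto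
  qed
  define G where "G p = {q \<in> X. g q = p}" for p
  define c where "c p = (if composite (r p) then 1 else 0 :: nat)" for p
  have main: "p0 ^ (1 + c p) * \<Prod>(G p) \<le> r p * p0 ^ card (G p)" if p: "p \<in> X" for p
  proof -
    have wp: "r p dvd n * d" "r p > 1" using weight_prime[of p] p X by auto
    have Gfin: "finite (G p)" using fin by (simp add: G_def)
    have div: "\<Prod>(G p) dvd r p"
      using Gfin qg X by (intro prod_primes_dvd) (auto simp: G_def)
    have sp: "p0 \<le> s" if "s dvd r p" "s > 1" for s using p0_le that wp(1) dvd_trans by blast
    \<comment> \<open>Each case finds enough factors of size \<open>p0\<close>: without charges the
      rank itself consists of them, with one charge the cofactor of \<open>q\<close> is one if the
      rank is composite, and with two or more the right-hand side has them in surplus.\<close>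
    consider "card (G p) = 0" | "card (G p) = 1" | "card (G p) \<ge> 2" by linarith
    then show ?thesis
    proof cases
      case 1
      then have G: "G p = {}" using Gfin by simp
      show ?thesis
      proof (cases "composite (r p)")
        case True
        then obtain s where s: "prime s" "s dvd r p" using prime_factor_nat[of "r p"] wp(2) by auto
        then obtain u where u: "r p = s * u" by blast
        have "u \<noteq> 1" using True s(1) u by (auto simp: composite_def)
        moreover have "u \<noteq> 0" using u wp(2) by (cases u) auto
        ultimately have "u > 1" by linarith
        then have "p0 * p0 \<le> s * u" using sp[of s] sp[of u] u s prime_gt_1_nat[OF s(1)] by (intro mult_le_mono) auto
        then show ?thesis using True 1 G u by (simp add: c_def)
      next
        case False
        then show ?thesis using 1 G sp[of "r p"] wp(2) by (simp add: c_def)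
      qed
    next
      case 2
      then obtain q where q: "G p = {q}" by (metis card_1_singletonE)
      then have "q \<in> X" by (auto simp: G_def)
      then have pq: "prime q" using X by blast
      obtain u where u: "r p = q * u" using div q by auto
      have u0: "u \<noteq> 0" using u wp(2) by (cases u) auto
      show ?thesis
      proof (cases "composite (r p)")
        case True
        then have "u \<noteq> 1" using pq u by (auto simp: composite_def)
        then have "p0 \<le> u" using sp[of u] u u0 by simp
        then have "p0 * (p0 * q) \<le> p0 * (u * q)" by (intro mult_le_mono) auto
        then show ?thesis using True q u by (simp add: c_def mult_ac)
      next
        case False
        have "p0 * q \<le> p0 * (q * u)" using u0 by (intro mult_le_mono) auto
        then show ?thesis using False q u by (simp add: c_def mult_ac)
      qed
    next
      case 3
      have "\<Prod>(G p) \<le> r p" using div wp(2) by (intro dvd_imp_le) auto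
      moreover have "p0 ^ (1 + c p) \<le> p0 ^ card (G p)" using 3 p0_pos by (intro power_increasing) (auto simp: c_def)
      ultimately show ?thesis by (simp only: mult.commute[of "r p"] mult_le_mono)
    qed
  qed
  have tc: "(\<Sum>p\<in>X. c p) = t"
  proof -
    have "(\<Sum>p\<in>X. c p) = card {p \<in> X. composite (r p)}" using fin by (simp add: c_def sum.If_cases Int_def)
    also have "{p \<in> X. composite (r p)} = {p. prime p \<and> p dvd d \<and> composite (r p)}" using X by auto
    finally show ?thesis using t by simp
  qed
  \<comment> \<open>Every prime of \<open>X\<close> is charged once, so the right-hand sides
    contribute \<open>card X\<close> powers of \<open>p0\<close> in total, which cancel the summands
    1 in the exponents on the left.\<close>
  have Gsum: "(\<Sum>p\<in>X. card (G p)) = card X"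
    using sum.group[OF fin fin, of g "\<lambda>_. 1::nat"] g unfolding G_def by auto
  have Gprod: "(\<Prod>p\<in>X. \<Prod>(G p)) = \<Prod>X"
    unfolding G_def using g fin by (intro prod.group[where h = "\<lambda>x. x", simplified]) auto
  have "(\<Prod>p\<in>X. p0 ^ (1 + c p) * \<Prod>(G p)) \<le> (\<Prod>p\<in>X. r p * p0 ^ card (G p))"
    by (intro prod_mono) (use main in auto)
  then have "p0 ^ (\<Sum>p\<in>X. 1 + c p) * \<Prod>X \<le> (\<Prod>p\<in>X. r p) * p0 ^ card X"
    unfolding prod.distrib Gprod power_sum[symmetric] Gsum .
  also have "(\<Sum>p\<in>X. 1 + c p) = card X + t" unfolding sum.distrib using tc by simp
  finally have "p0 ^ card X * (p0 ^ t * \<Prod>X) \<le> p0 ^ card X * (\<Prod>p\<in>X. r p)" by (simp add: power_add mult_ac)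
  then show ?thesis using p0_pos by (simp add: X_def)
qed

lemma part_d_cycle:
  assumes "t = 0"
  shows "d \<in> gen_aliquot_products D"
proof -
  define X where "X = prime_factors d"
  have X: "p \<in> X \<longleftrightarrow> prime p \<and> p dvd d" for p using d1 by (auto simp: X_def in_prime_factors_iff)
  have fin: "finite X" by (simp add: X_def)
  have "finite {p. prime p \<and> p dvd d \<and> composite (r p)}"
    by (rule finite_subset[OF _ fin]) (auto simp: X)
  then have nc: "\<not> composite (r p)" if "p \<in> X" for p using assms t that X by auto
  have rp: "prime (r p)" if "p \<in> X" for p
    using nc[OF that] weight_prime(7)[of p] that X by (auto simp: composite_def)
  have rX: "r p \<in> X" if "p \<in> X" for p
    using rp[OF that] weight_prime(5,6)[of p] that X by (auto simp: prime_dvd_mult_iff)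
  \<comment> \<open>\<open>weight_prime_in_rank\<close> makes the rank surjective on the primes of
    \<open>d\<close>, hence a permutation of them, as \<open>orbit_cycle\<close> requires.\<close>
  have surj: "q \<in> r ` X" if "q \<in> X" for q
  proof -
    obtain p where p: "p \<in> X" "q ^ multiplicity q d dvd r p"
      using weight_prime_in_rank[of q] \<open>q \<in> X\<close> X by blast
    have "multiplicity q d \<ge> 1" using \<open>q \<in> X\<close> X d1 by (intro multiplicity_geI) (auto dest: not_prime_unit)
    then have "q ^ 1 dvd q ^ multiplicity q d" by (rule le_imp_power_dvd)
    then have "q dvd r p" using p(2) dvd_trans by auto
    then have "q = r p" using rp[OF p(1)] \<open>q \<in> X\<close> X primes_dvd_imp_eq by blast
    then show ?thesis using p(1) by blast
  qed
  then have im: "r ` X = X" using rX by blast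
  then have inj: "inj_on r X" using fin by (intro eq_card_imp_inj_on) simp_all
  obtain p where p: "p \<in> X" using prime_factor_nat[of d] d1 X by auto
  obtain ps where ps: "ps \<noteq> []" "distinct ps" "set ps \<subseteq> X"
    "\<And>i. i < length ps \<Longrightarrow> r (ps ! i) = ps ! (Suc i mod length ps)"
    using orbit_cycle[OF fin _ inj p] im by blast
  have cyc: "gen_aliquot_cycle D ps"
    unfolding gen_aliquot_cycle_def using ps X by blast
  define e where "e = prod_list ps"
  have e: "e \<in> gen_aliquot_products D" using cyc by (auto simp: gen_aliquot_products_def e_def)
  \<comment> \<open>The product \<open>e\<close> of one orbit divides \<open>d\<close> and satisfies
    \<open>n * e \<in> S\<close>, so the arrow leaves no room for a second orbit or a repeated
    prime.\<close>
  have "e dvd d" unfolding e_def cycle_primes(2)[OF cyc]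
    using ps(3) X by (intro prod_primes_dvd) auto
  then have "n * e = n \<or> n * e = n * d" by (intro between part_b(1)[OF nS e]) simp_all
  moreover have "e > 1" unfolding e_def by (rule cycle_primes(3)[OF cyc])
  ultimately have "e = d" using n1 by auto
  then show ?thesis using e by simp
qed

lemma part_d_lower:
  "(\<Prod>p\<in>prime_factors d. real (N p) / real p) \<ge> real p0 ^ t"
proof -
  let ?X = "prime_factors d"
  have X: "p \<in> ?X \<Longrightarrow> prime p \<and> p dvd d" for p by (auto simp: in_prime_factors_iff)
  have "real (p0 ^ t * (\<Prod>p\<in>?X. p)) \<le> real (\<Prod>p\<in>?X. r p)"
    using rank_product_bound of_nat_le_iff by blast
  also have "\<dots> \<le> (\<Prod>p\<in>?X. real (N p))"
    unfolding of_nat_prod by (intro prod_mono) (use X weight_prime(9) in auto)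
  finally have "real p0 ^ t * (\<Prod>p\<in>?X. real p) \<le> (\<Prod>p\<in>?X. real (N p))" by simp
  moreover have "(\<Prod>p\<in>?X. real p) > 0" using X prime_gt_0_nat by (intro prod_pos) auto
  ultimately show ?thesis by (simp add: prod_dividef pos_le_divide_eq)
qed

end

end

end

section \<open>The index divisibility digraph\<close>

lemma hasse_ratio:
  fixes p N :: nat
  assumes p: "p > 0" and N: "int N \<le> int p + 1 \<or> (int N - int p - 1)^2 \<le> 4 * int p"
  shows "real N / real p \<le> (1 + 1 / sqrt (real p))\<^sup>2"
proof -
  have "real N - real p - 1 \<le> 2 * sqrt (real p)"
    using N
  proof
    assume "int N \<le> int p + 1"
    then have "real N - real p - 1 \<le> 0" by linarith
    also have "0 \<le> 2 * sqrt (real p)" by simp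
    finally show ?thesis .
  next
    assume "(int N - int p - 1)^2 \<le> 4 * int p"
    then have "real_of_int ((int N - int p - 1)^2) \<le> real_of_int (4 * int p)" by (simp only: of_int_le_iff)
    then have "(real N - real p - 1)^2 \<le> 4 * real p" by simp
    then have "real N - real p - 1 \<le> sqrt (4 * real p)" by (rule real_le_rsqrt)
    then show ?thesis by (simp add: real_sqrt_mult)
  qed
  then have "real N / real p \<le> (real p + 1 + 2 * sqrt (real p)) / real p"
    using p by (intro divide_right_mono) auto
  also have "\<dots> = (1 + 1 / sqrt (real p))\<^sup>2"
    using p by (simp add: power2_eq_square field_simps)
  finally show ?thesis .
qed

theorem theorem15:
  fixes W :: "int weierstrass" and P :: "rat point" and D :: "nat \<Rightarrow> nat"
  assumes "elliptic_curve W"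
    and "global_minimal W"
    and "P \<in> curve_points (over_rat W)"
    and "infinite_order (over_rat W) P"
    and "regular W P"
  defines "D \<equiv> eds W P"
  shows
    "(\<forall>n p. n \<ge> 1 \<and> prime p \<and> n \<in> index_divisors D \<and> (p dvd D n \<or> additive_reduction W p)
        \<longrightarrow> (n, n * p) \<in> arrows D)
     \<and>
     (\<forall>n d. n \<ge> 1 \<and> d \<ge> 1 \<and> n \<in> index_divisors D \<and> d \<in> gen_aliquot_products D
        \<longrightarrow> n * d \<in> index_divisors D \<and> gcd d n \<in> {1, d}
            \<and> (gcd d n = 1 \<longrightarrow> (n, n * d) \<in> arrows D))
     \<and>
     (\<forall>n p. n \<ge> 1 \<and> prime p \<and> n \<in> index_divisors D \<and> \<not> p dvd D n \<and> (n, n * p) \<in> arrows D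
        \<longrightarrow> (good_reduction W p \<and> card (points_mod W p) \<noteq> 2 * p \<longrightarrow> p \<in> aliquot_products W P)
            \<and> (\<not> good_reduction W p \<longrightarrow> additive_reduction W p))
     \<and>
     (\<forall>p. prime p \<and> p \<ge> 7 \<and> good_reduction W p \<longrightarrow> card (points_mod W p) \<noteq> 2 * p)
     \<and>
     (\<forall>n d t p0. n \<ge> 1 \<and> d \<ge> 1 \<and> composite d
          \<and> t = card {p. prime p \<and> p dvd d \<and> composite (rank_app D p)}
          \<and> p0 = Min (prime_factors (n * d))
          \<and> (n, n * d) \<in> arrows D
        \<longrightarrow> (t = 0 \<and> d \<in> gen_aliquot_products D)
            \<or> (t \<ge> 1
               \<and> (\<Prod>p\<in>prime_factors d. (1 + 1 / sqrt (real p))\<^sup>2)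
                   \<ge> (\<Prod>p\<in>prime_factors d. real (card (ns_points_mod W p)) / real p)
               \<and> (\<Prod>p\<in>prime_factors d. real (card (ns_points_mod W p)) / real p) \<ge> real p0 ^ t))"
proof -
  interpret E: eds_curve W P D
    using assms by unfold_locales auto
  define N where "N p = card (ns_points_mod W p)" for p
  note facts = reduction_facts_prime[unfolded reduction_facts_def, rule_format]
  \<comment> \<open>Regularity supplies the bad primes; at good primes every reduced point is
    nonsingular.\<close>
  have ns: "reduce_point p P \<in> ns_points_mod W p" if p: "prime p" for p
    using facts[OF p, of W] assms(3,5) p by (cases "int p dvd discriminant W") (auto simp: regular_def)
  have good: "ns_points_mod W p = points_mod W p"
    "int (N p) \<le> int p + 1 \<or> (int (N p) - int p - 1)^2 \<le> 4 * int p"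
    if "prime p" "good_reduction W p" for p
    using facts[OF that(1), of W] that(2) by (auto simp: good_reduction_def N_def)
  have rank: "rank_app D p dvd N p \<and> rank_app D p \<ge> 1" if p: "prime p" for p
    using facts[OF p, of W] ns[OF p] E.eds_curve_axioms unfolding N_def by blast
  have bad: "N p = p + 1 \<or> N p + 1 = p" if "prime p" "\<not> good_reduction W p" "\<not> additive_reduction W p" for p
    using facts[OF that(1), of W] that(2,3) by (auto simp: good_reduction_def N_def)
  interpret M: eds_divisibility D N "good_reduction W" "additive_reduction W"
  proof
    show "N p \<ge> 1" for p
    proof -
      have "Infinity \<in> ns_points_mod W p" by (simp add: ns_points_mod_def points_mod_def)
      moreover have "finite (ns_points_mod W p)" using finite_points_mod by (simp add: ns_points_mod_def)
      ultimately show ?thesis unfolding N_def by (metis card_gt_0_iff empty_iff Suc_leI One_nat_def)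
    qed
    show "N p = p" if "prime p" "additive_reduction W p" for p
      using facts[OF that(1), of W] that(2) by (simp add: N_def)
    show "N p \<le> 2 * p + 1" if "prime p" "good_reduction W p" for p
      using facts[OF that(1), of W] that(2) unfolding good_reduction_def N_def by blast
    show "multiplicity 2 (D 4) \<noteq> 1" if "good_reduction W 2" "N 2 = 4" "rank_app D 2 = 4" "odd (D 2)"
    proof -
      have "card (points_mod W 2) = 4" using good(1)[of 2] that(1,2) by (simp add: N_def)
      then show ?thesis
        using assms(5) that unfolding regular_def two_irregular_def D_def by blast
    qed
  qed (use E.D_pos E.eds_prime_power_dvd_iff E.eds_lift rank bad in auto)
  have upper: "(\<Prod>p\<in>prime_factors d. real (N p) / real p) \<le> (\<Prod>p\<in>prime_factors d. (1 + 1 / sqrt (real p))\<^sup>2)"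
    if arr: "(n, n * d) \<in> arrows D" and comp: "composite d" for n d
  proof (intro prod_mono conjI)
    fix p assume "p \<in> prime_factors d"
    then have p: "prime p" "p dvd d" by (auto simp: in_prime_factors_iff)
    \<comment> \<open>Additive primes do not divide \<open>d\<close>, so a bad prime has at most
      \<open>p + 1\<close> nonsingular points here.\<close>
    have "int (N p) \<le> int p + 1 \<or> (int (N p) - int p - 1)^2 \<le> 4 * int p"
    proof (cases "good_reduction W p")
      case False
      then show ?thesis using bad[OF p(1)] M.weight_prime(2)[OF arr comp p] by auto
    qed (use good(2) p in blast)
    then show "real (N p) / real p \<le> (1 + 1 / sqrt (real p))\<^sup>2"
      using prime_gt_0_nat[OF p(1)] by (intro hasse_ratio)
  qed simp
  show ?thesis
  proof (intro conjI allI impI; (elim conjE)?)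
    fix n p assume "prime p" "n \<in> index_divisors D" "p dvd D n \<or> additive_reduction W p"
    then show "(n, n * p) \<in> arrows D" by (intro M.part_a(2))
  next
    fix n d assume "n \<in> index_divisors D" "d \<in> gen_aliquot_products D"
    note b = M.part_b[OF this]
    show "n * d \<in> index_divisors D" "gcd d n \<in> {1, d}" by (fact b(1), fact b(2))
    show "(n, n * d) \<in> arrows D" if "gcd d n = 1" using that by (rule b(3))
  next
    fix n p assume p: "prime p" and a: "n \<in> index_divisors D" "\<not> p dvd D n" "(n, n * p) \<in> arrows D"
      and g: "good_reduction W p" "card (points_mod W p) \<noteq> 2 * p"
    have "N p \<noteq> 2 * p" using g good(1)[OF p] by (simp add: N_def)
    then have "gen_aliquot_cycle D [p]" using M.part_c(1)[OF a(1) p a(2,3) g(1)] by blast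
    then have "aliquot_cycle W P [p]" using g(1) by (simp add: aliquot_cycle_def D_def)
    then show "p \<in> aliquot_products W P" unfolding aliquot_products_def by force
  next
    fix n p assume p: "prime p" and a: "n \<in> index_divisors D" "\<not> p dvd D n" "(n, n * p) \<in> arrows D"
      and "\<not> good_reduction W p"
    then show "additive_reduction W p" using M.part_c(2)[OF a(1) p a(2,3)] by blast
  next
    fix p :: nat assume p: "prime p" "7 \<le> p" "good_reduction W p"
    show "card (points_mod W p) \<noteq> 2 * p"
    proof
      assume "card (points_mod W p) = 2 * p"
      then have "N p = 2 * p" using good(1) p by (simp add: N_def)
      \<comment> \<open>\<open>N p - p - 1\<close> is \<open>p - 1\<close> here; the bound amounts
        to \<open>p^2 \<le> 6 * p - 1\<close>, which contradicts
        \<open>p^2 \<ge> 7 * p\<close>.\<close>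
      then have "(int p - 1)^2 \<le> 4 * int p" using good(2)[OF p(1,3)] p(2) by auto
      moreover have "7 * int p \<le> int p * int p" using p(2) by (intro mult_right_mono) auto
      ultimately show False using p(2) by (simp add: power2_eq_square algebra_simps)
    qed
  next
    fix n d t p0 assume comp: "composite d"
      and t: "t = card {p. prime p \<and> p dvd d \<and> composite (rank_app D p)}"
      and p0: "p0 = Min (prime_factors (n * d))" and arr: "(n, n * d) \<in> arrows D"
    show "t = 0 \<and> d \<in> gen_aliquot_products D \<or>
      t \<ge> 1 \<and> (\<Prod>p\<in>prime_factors d. (1 + 1 / sqrt (real p))\<^sup>2)
                   \<ge> (\<Prod>p\<in>prime_factors d. real (card (ns_points_mod W p)) / real p)
               \<and> (\<Prod>p\<in>prime_factors d. real (card (ns_points_mod W p)) / real p) \<ge> real p0 ^ t"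
    proof (cases "t = 0")
      case True
      then show ?thesis using M.part_d_cycle[OF arr comp t p0] by blast
    next
      case False
      then show ?thesis
        using upper[OF arr comp] M.part_d_lower[OF arr comp t p0] unfolding N_def by simp
    qed
  qed
qed

end
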